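(* Let $1\le p\le\infty$. Let $S\subset Y$ be a compact open set such that $S\cap Y(\mathbb{Q},\infty)=\varnothing$. Let $S$ be defined over a number field $K$ which has at least one real archimedean place, and suppose there are at least two places $v\neq w$ in $M_K$ such that $Y(K,v)\cup Y(K,w)\subseteq S$. Then the closure in the $L^p$ norm of the $S$-unit space $\mathcal{F}(S)=\{f\in\mathcal{F}:\operatorname{supp}(f)\subseteq S\}$ is a proper subspace of $$\mathcal{F}_p(S,0)=\Big\{f\in\mathcal{F}_p : \operatorname{supp}(f)\subseteq S \text{ and } \int_S f\,d\lambda=0\Big\}.$$
   Context: Number fields are finite extensions of $\mathbb{Q}$ inside a fixed algebraic closure $\overline{\mathbb{Q}}$. For a number field $K$, $M_K$ is its set of places; for $v\in M_K$ lying over the rational place $p$ (a prime or $\infty$), $\|\cdot\|_v$ is the absolute value on $K$ extending the usual absolute value $|\cdot|_p$ on $\mathbb{Q}$. Give each $M_K$ the discrete topology; for $L/K$ an extension of number fields let $M_L\to M_K$ be restriction of places. Put $Y=\varprojlim_K M_K$ over all number fields $K$: a locally compact, totally disconnected Hausdorff space whose points are the places of $\overline{\mathbb{Q}}$. For $v\in M_K$ let $Y(K,v)=\{y\in Y: y\mid v\}$ (the points whose image in $M_K$ is $v$); these sets form a basis of the topology. The archimedean places are exactly the points of $Y(\mathbb{Q},\infty)$. For $\alpha\in K^\times$ and $y\in Y(K,v)$, $\|\alpha\|_y=\|\alpha\|_v$. A compact open set $S\subset Y$ is said to be defined over a number field $K$ if $S=\bigcup_{v\in T}Y(K,v)$ for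 some (necessarily finite) set $T\subset M_K$. $\lambda$ is the Borel measure on $Y$ with $\lambda(Y(K,v))=[K_v:\mathbb{Q}_v]/[K:\mathbb{Q}]$ for every number field $K$ and $v\in M_K$ (where $\mathbb{Q}_v$ is the completion of $\mathbb{Q}$ at the place below $v$). For $\alpha\in\overline{\mathbb{Q}}^\times$ let $f_\alpha:Y\to\mathbb{R}$, $f_\alpha(y)=\log\|\alpha\|_y$; it lies in $C_c(Y)$ and depends only on the class of $\alpha$ modulo roots of unity. $\mathcal{F}=\{f_\alpha:\alpha\in\overline{\mathbb{Q}}^\times/\operatorname{Tor}(\overline{\mathbb{Q}}^\times)\}\subset C_c(Y)$, a $\mathbb{Q}$-vector space. $\mathcal{F}_p$ denotes the completion of $\mathcal{F}$ under the $L^p(Y,\lambda)$ norm, $1\le p\le\infty$; it is identified (Allcock–Vaaler) with $\{f\in L^1(Y,\lambda):\int_Y f\,d\lambda=0\}$ if $p=1$, with $L^p(Y,\lambda)$ if $1<p<\infty$, and with $C_0(Y)$ (real continuous functions vanishing at infinity, sup norm) if $p=\infty$. All functions are real-valued; for an $L^p$ class $f$, $\operatorname{supp}(f)\subseteq S$ means $f=0$ almost everywhere outside $S$. *)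

theory Defs
  imports
    "HOL-Analysis.Analysis"
    "HOL-Algebra.Algebraic_Closure_Type"
    "HOL-Algebra.Embedded_Algebras"
    "HOL-Algebra.QuotRing"
begin

section \<open>Number fields and their places\<close>

type_synonym qbar = "rat alg_closure"

abbreviation Qbar_ring :: "qbar ring" where
  "Qbar_ring \<equiv> ring_of_type_algebra"

definition number_field :: "qbar set \<Rightarrow> bool" where
  "number_field K \<longleftrightarrow> subfield K Qbar_ring \<and> ring.finite_dimension Qbar_ring \<rat> K"

definition global_degree :: "qbar set \<Rightarrow> nat" where
  "global_degree K = ring.dim Qbar_ring \<rat> K"

text \<open>An absolute value on \<open>K\<close> is a function on \<open>qbar\<close> that is \<open>undefined\<close> outside \<open>K\<close>, so that
  equality of absolute values on \<open>K\<close> is equality of functions.\<close>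

definition absolute_value :: "qbar set \<Rightarrow> (qbar \<Rightarrow> real) \<Rightarrow> bool" where
  "absolute_value K a \<longleftrightarrow>
     a \<in> extensional K \<and>
     (\<forall>x\<in>K. 0 \<le> a x \<and> (a x = 0 \<longleftrightarrow> x = 0)) \<and>
     (\<forall>x\<in>K. \<forall>y\<in>K. a (x * y) = a x * a y) \<and>
     (\<forall>x\<in>K. \<forall>y\<in>K. a (x + y) \<le> a x + a y)"

definition nontrivial_av :: "qbar set \<Rightarrow> (qbar \<Rightarrow> real) \<Rightarrow> bool" where
  "nontrivial_av K a \<longleftrightarrow> absolute_value K a \<and> (\<exists>x\<in>K. x \<noteq> 0 \<and> a x \<noteq> 1)"

definition av_equiv :: "qbar set \<Rightarrow> ((qbar \<Rightarrow> real) \<times> (qbar \<Rightarrow> real)) set" where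
  "av_equiv K = {(a, b). nontrivial_av K a \<and> nontrivial_av K b \<and>
                         (\<exists>s>0. \<forall>x\<in>K. b x = a x powr s)}"

type_synonym place = "(qbar \<Rightarrow> real) set"

definition places :: "qbar set \<Rightarrow> place set" where
  "places K = {a. nontrivial_av K a} // av_equiv K"

text \<open>The image in \<open>places K\<close> of a place of an extension of \<open>K\<close>.\<close>

definition place_restrict :: "qbar set \<Rightarrow> place \<Rightarrow> place" where
  "place_restrict K w = av_equiv K `` ((\<lambda>a. restrict a K) ` w)"

definition padic_abs :: "nat \<Rightarrow> rat \<Rightarrow> real" where
  "padic_abs p q = (if q = 0 then 0 else
     real p powi (int (multiplicity (int p) (snd (quotient_of q))) -
                  int (multiplicity (int p) (fst (quotient_of q)))))"

definition usual_rat_abs :: "(rat \<Rightarrow> real) set" where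
  "usual_rat_abs = insert (\<lambda>q. \<bar>real_of_rat q\<bar>) (padic_abs ` {p. Factorial_Ring.prime p})"

text \<open>The normalised absolute value belonging to a place.\<close>

definition place_norm :: "place \<Rightarrow> qbar \<Rightarrow> real" where
  "place_norm v = (THE a. a \<in> v \<and> (\<lambda>q. a (of_rat q)) \<in> usual_rat_abs)"

definition rat_place_inf :: place where
  "rat_place_inf = av_equiv \<rat> `` {\<lambda>x\<in>\<rat>. \<bar>real_of_rat (of_ac x)\<bar>}"

definition real_place :: "qbar set \<Rightarrow> place \<Rightarrow> bool" where
  "real_place K v \<longleftrightarrow> v \<in> places K \<and>
     (\<exists>\<sigma>\<in>ring_hom (Qbar_ring\<lparr>carrier := K\<rparr>) (ring_of_type_algebra :: real ring).
        \<forall>x\<in>K. place_norm v x = \<bar>\<sigma> x\<bar>)"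

section \<open>Completions and local degrees\<close>

definition cauchy_ring :: "qbar set \<Rightarrow> (qbar \<Rightarrow> real) \<Rightarrow> (nat \<Rightarrow> qbar) ring" where
  "cauchy_ring K a =
     \<lparr>carrier = {s. range s \<subseteq> K \<and> (\<forall>\<epsilon>>0. \<exists>N. \<forall>m\<ge>N. \<forall>n\<ge>N. a (s m - s n) < \<epsilon>)},
      monoid.mult = (\<lambda>s t n. s n * t n), one = (\<lambda>_. 1),
      ring.zero = (\<lambda>_. 0), add = (\<lambda>s t n. s n + t n)\<rparr>"

definition null_sequences :: "qbar set \<Rightarrow> (qbar \<Rightarrow> real) \<Rightarrow> (nat \<Rightarrow> qbar) set" where
  "null_sequences K a = {s. range s \<subseteq> K \<and> (\<lambda>n. a (s n)) \<longlonglongrightarrow> 0}"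

definition place_completion :: "qbar set \<Rightarrow> place \<Rightarrow> (nat \<Rightarrow> qbar) set ring" where
  "place_completion K v = cauchy_ring K (place_norm v) Quot null_sequences K (place_norm v)"

text \<open>The image of the completion of \<open>\<rat>\<close> at the place below \<open>v\<close> under the canonical embedding
  into the completion of \<open>K\<close> at \<open>v\<close>.\<close>

definition rat_completion :: "qbar set \<Rightarrow> place \<Rightarrow> (nat \<Rightarrow> qbar) set set" where
  "rat_completion K v =
     (\<lambda>s. null_sequences K (place_norm v) +>\<^bsub>cauchy_ring K (place_norm v)\<^esub> s) `
       carrier (cauchy_ring \<rat> (place_norm (place_restrict \<rat> v)))"

definition local_degree :: "qbar set \<Rightarrow> place \<Rightarrow> nat" where
  "local_degree K v =
     ring.dim (place_completion K v) (rat_completion K v) (carrier (place_completion K v))"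

section \<open>The space of places of the algebraic closure\<close>

type_synonym qbar_place = "qbar set \<Rightarrow> place"

definition Y_space :: "qbar_place set" where
  "Y_space = {y \<in> (\<Pi>\<^sub>E K\<in>{K. number_field K}. places K).
     \<forall>K L. number_field K \<longrightarrow> number_field L \<longrightarrow> K \<subseteq> L \<longrightarrow> place_restrict K (y L) = y K}"

definition Y_top :: "qbar_place topology" where
  "Y_top = subtopology
     (product_topology (\<lambda>K. discrete_topology (places K)) {K. number_field K}) Y_space"

definition Y_over :: "qbar set \<Rightarrow> place \<Rightarrow> qbar_place set" where
  "Y_over K v = {y \<in> Y_space. y K = v}"

definition defined_over :: "qbar set \<Rightarrow> qbar_place set \<Rightarrow> bool" where
  "defined_over K S \<longleftrightarrow> (\<exists>T\<subseteq>places K. S = (\<Union>v\<in>T. Y_over K v))"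

definition point_norm :: "qbar_place \<Rightarrow> qbar \<Rightarrow> real" where
  "point_norm y \<alpha> = (THE r. \<forall>K. number_field K \<longrightarrow> \<alpha> \<in> K \<longrightarrow> r = place_norm (y K) \<alpha>)"

text \<open>The properties characterising \<open>\<lambda>\<close>. They determine it, since the sets \<open>Y_over K v\<close> form a
  countable base, and the intersection of two of them is a finite disjoint union of such sets.\<close>

definition is_lambda :: "qbar_place measure \<Rightarrow> bool" where
  "is_lambda lam \<longleftrightarrow>
     sets lam = sets (sigma Y_space {U. openin Y_top U}) \<and>
     (\<forall>K v. number_field K \<longrightarrow> v \<in> places K \<longrightarrow>
        emeasure lam (Y_over K v) = ennreal (real (local_degree K v) / real (global_degree K)))"

section \<open>Function spaces\<close>

text \<open>Elements of \<open>L\<^sup>p\<close> are represented by functions rather than by classes of functions, and values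
  outside \<open>Y_space\<close> are irrelevant. The sets \<open>F_space\<close>, \<open>F_space_S0\<close> and \<open>F_S_closure\<close> below are
  unions of full classes, so inclusion and equality between them are inclusion and equality of the
  corresponding sets of classes.\<close>

definition f_log :: "qbar \<Rightarrow> qbar_place \<Rightarrow> real" where
  "f_log \<alpha> = (\<lambda>y. ln (point_norm y \<alpha>))"

definition F_logs :: "(qbar_place \<Rightarrow> real) set" where
  "F_logs = {f_log \<alpha> | \<alpha>. \<alpha> \<noteq> 0}"

definition F_S :: "qbar_place set \<Rightarrow> (qbar_place \<Rightarrow> real) set" where
  "F_S S = {f \<in> F_logs. Abstract_Topology.closure_of Y_top {y \<in> Y_space. f y \<noteq> 0} \<subseteq> S}"

definition Lp_space :: "real \<Rightarrow> qbar_place measure \<Rightarrow> (qbar_place \<Rightarrow> real) set" where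
  "Lp_space p lam = {f \<in> borel_measurable lam. integrable lam (\<lambda>y. \<bar>f y\<bar> powr p)}"

definition C0_space :: "(qbar_place \<Rightarrow> real) set" where
  "C0_space = {f. continuous_map Y_top euclideanreal f \<and>
     (\<forall>\<epsilon>>0. compactin Y_top {y \<in> Y_space. \<epsilon> \<le> \<bar>f y\<bar>})}"

definition p_norm :: "ereal \<Rightarrow> qbar_place measure \<Rightarrow> (qbar_place \<Rightarrow> real) \<Rightarrow> real" where
  "p_norm p lam f =
     (if p = \<infinity> then (SUP y\<in>Y_space. \<bar>f y\<bar>)
      else (LINT y|lam. \<bar>f y\<bar> powr real_of_ereal p) powr (1 / real_of_ereal p))"

text \<open>The completion of \<open>F_logs\<close> in the \<open>L\<^sup>p\<close> norm, as identified by Allcock and Vaaler.\<close>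

definition F_space :: "ereal \<Rightarrow> qbar_place measure \<Rightarrow> (qbar_place \<Rightarrow> real) set" where
  "F_space p lam =
     (if p = \<infinity> then C0_space
      else if p = 1 then {f \<in> Lp_space 1 lam. (LINT y|lam. f y) = 0}
      else Lp_space (real_of_ereal p) lam)"

text \<open>For the continuous functions in the case \<open>p = \<infinity>\<close>, vanishing almost everywhere outside the
  clopen set \<open>S\<close> is replaced by the containment of the topological support.\<close>

definition supp_in ::
  "ereal \<Rightarrow> qbar_place measure \<Rightarrow> (qbar_place \<Rightarrow> real) \<Rightarrow> qbar_place set \<Rightarrow> bool" where
  "supp_in p lam f S \<longleftrightarrow>
     (if p = \<infinity> then Abstract_Topology.closure_of Y_top {y \<in> Y_space. f y \<noteq> 0} \<subseteq> S
      else (AE y in lam. y \<notin> S \<longrightarrow> f y = 0))"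

definition F_space_S0 ::
  "ereal \<Rightarrow> qbar_place measure \<Rightarrow> qbar_place set \<Rightarrow> (qbar_place \<Rightarrow> real) set" where
  "F_space_S0 p lam S = {f \<in> F_space p lam. supp_in p lam f S \<and> (LINT y:S|lam. f y) = 0}"

definition F_S_closure ::
  "ereal \<Rightarrow> qbar_place measure \<Rightarrow> qbar_place set \<Rightarrow> (qbar_place \<Rightarrow> real) set" where
  "F_S_closure p lam S =
     {g \<in> F_space p lam. \<forall>\<epsilon>>0. \<exists>f\<in>F_S S. p_norm p lam (\<lambda>y. g y - f y) < \<epsilon>}"

definition linear_subspace :: "(qbar_place \<Rightarrow> real) set \<Rightarrow> bool" where
  "linear_subspace A \<longleftrightarrow> (\<lambda>_. 0) \<in> A \<and>
     (\<forall>f\<in>A. \<forall>g\<in>A. (\<lambda>y. f y + g y) \<in> A) \<and> (\<forall>c. \<forall>f\<in>A. (\<lambda>y. c * f y) \<in> A)"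

end

(*
  Let alpha be nonzero with f_alpha supported in S, and let v be a place of K with Y(K,v) contained
  in S. Then the integral of f_alpha over Y(K,v) vanishes. Indeed, let beta_1, ..., beta_n be the
  roots of the minimal polynomial of alpha over K. The isomorphism K(alpha) -> K(beta_i) over K
  matches the places above v and preserves their local degrees, so f_alpha and f_{beta_i} have the
  same integral over Y(K,v), and n times this integral is the integral of f_c, where c is the norm
  of alpha. Since S contains no archimedean place, every embedding of K(alpha) into the complex
  numbers maps alpha to the unit circle; hence the given embedding of K into the reals maps c to
  1 or -1, so c is a root of unity and f_c = 0.

  Integration over Y(K,v) is L^p-continuous, so it vanishes on the closure of F(S). It does not
  vanish on the element 1_{Y(K,v)} / lambda(Y(K,v)) - 1_{Y(K,w)} / lambda(Y(K,w)) of F_p(S,0).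
*)
theory Submission
  imports Defs "HOL-Real_Asymp.Real_Asymp"
begin

text \<open>A place is a class of arbitrary nontrivial absolute values, and its norm is singled out
  by a description; Ostrowski's theorem on \<rat> and the uniqueness of its exponent guarantee that
  each class has exactly one member extending a usual absolute value. The measures of the fibres
  involve local degrees, so the comparison of conjugates must go through the completions: they are
  finite-dimensional over the closure of \<rat>, and a field isomorphism that matches two places
  induces an isomorphism of completions. For a complex embedding, modulus 1 would leave the norm c
  undetermined; this is where a real place is essential. Vanishing on the individual fibres also
  yields the condition on the integral over S, because S is a finite disjoint union of fibres over
  places of K. The closure is a real vector space although only rational multiples are available at
  first: these come from roots in the algebraic closure, and the density of \<rat> in the reals does
  the rest.\<close>

section \<open>Absolute values on the rationals\<close>

text \<open>Geometric growth beats polynomial growth: for \<open>A > B > 0\<close> the powers of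
  \<open>A / B\<close> would be bounded by \<open>C * (k + 1) powr t\<close>. Applied to k-th
  powers, it removes the polynomial factor that a binomial or digit expansion costs.\<close>

lemma power_growth_le:
  fixes A B C t :: real
  assumes "0 \<le> A" "0 \<le> B" "\<And>k::nat. A ^ k \<le> C * (real k + 1) powr t * B ^ k"
  shows "A \<le> B"
proof (rule ccontr)
  assume "\<not> A \<le> B"
  hence "B < A" by simp
  have "B \<noteq> 0"
  proof
    assume "B = 0"
    with assms(3)[of 1] \<open>B < A\<close> show False by simp
  qed
  with assms(2) have B: "B > 0" by simp
  define r where "r = A / B"
  have r: "r > 1" using B \<open>B < A\<close> by (simp add: r_def)
  have 1: "1 \<le> C * ((real k + 1) powr t / r ^ k)" for k
  proof -
    have "A ^ k = r ^ k * B ^ k" using B by (simp add: r_def power_divide)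
    with assms(3)[of k] have "r ^ k * B ^ k \<le> (C * (real k + 1) powr t) * B ^ k" by simp
    hence "r ^ k \<le> C * (real k + 1) powr t" using B by (simp only: mult_le_cancel_right) auto
    thus ?thesis using r by (simp add: field_simps)
  qed
  have "(\<lambda>k::nat. (real k + 1) powr t / r ^ k) \<longlonglongrightarrow> 0" using r by real_asymp
  hence "(\<lambda>k::nat. C * ((real k + 1) powr t / r ^ k)) \<longlonglongrightarrow> C * 0" by (intro tendsto_intros)
  from LIMSEQ_le_const[OF this, of 1] 1 show False by auto
qed

section \<open>Arbitrary absolute values on \<rat>: the archimedean and the ultrametric case\<close>

locale rat_absolute_value =
  fixes c :: "rat \<Rightarrow> real"
  assumes nonneg: "0 \<le> c x" and zero_iff: "c x = 0 \<longleftrightarrow> x = 0"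
    and mult: "c (x * y) = c x * c y" and triangle: "c (x + y) \<le> c x + c y"
begin

lemma zero [simp]: "c 0 = 0" by (simp add: zero_iff)

lemma one [simp]: "c 1 = 1"
  using mult[of 1 1] zero_iff[of 1] by simp

lemma minus [simp]: "c (- x) = c x"
proof -
  have "c (-1) * c (-1) = 1" using mult[of "-1" "-1"] by simp
  hence "c (-1) = 1" using nonneg[of "-1"] by (metis abs_of_nonneg abs_square_eq_1 power2_eq_square)
  thus ?thesis using mult[of "-1" x] by simp
qed

lemma power: "c (x ^ n) = c x ^ n"
  by (induction n) (simp_all add: mult)

lemma divide: "c (x / y) = c x / c y"
proof (cases "y = 0")
  case False
  have "c (x / y) * c y = c x" using mult[of "x / y" y] False by simp
  thus ?thesis using False zero_iff[of y] by (simp add: field_simps)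
qed simp

lemma sum_le: "c (\<Sum>i\<in>I. f i) \<le> (\<Sum>i\<in>I. c (f i))"
proof (induction I rule: infinite_finite_induct)
  case (insert x F)
  thus ?case using triangle[of "f x" "sum f F"] by simp
qed auto

lemma of_nat_le: "c (of_nat n) \<le> real n"
proof (induction n)
  case (Suc n)
  thus ?case using triangle[of 1 "of_nat n"] by simp
qed simp

lemma of_int_eq: "c (of_int i) = c (of_nat (nat \<bar>i\<bar>))"
  by (cases "i \<ge> 0") (auto simp: abs_if of_nat_nat)

text \<open>Both sides are multiplicative and insensitive to signs, and every rational is a quotient
  of integers.\<close>

lemma eq_powr_of_nat:
  assumes u: "rat_absolute_value u" and "s > 0"
    and n: "\<And>n::nat. n > 0 \<Longrightarrow> c (of_nat n) = u (of_nat n) powr s"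
  shows "c x = u x powr s"
proof -
  interpret u: rat_absolute_value u by fact
  have n': "c (of_nat n) = u (of_nat n) powr s" for n
    using n[of n] \<open>s > 0\<close> by (cases "n = 0") auto
  obtain a b where ab: "x = of_int a / of_int b" by (metis quotient_of_div surj_pair)
  show ?thesis
    unfolding ab divide u.divide of_int_eq u.of_int_eq n'
    by (rule powr_divide[symmetric])
qed

text \<open>Expand the powers of \<open>m\<close> in base \<open>n\<close>.\<close>

lemma archimedean_of_nat_le:
  assumes "n \<ge> 2" "m \<ge> 1"
  shows "c (of_nat m) \<le> max 1 (c (of_nat n)) powr (log n m)"
proof -
  define M where "M = max 1 (c (of_nat n))"
  have M: "M \<ge> 1" "c (of_nat n) \<le> M" by (auto simp: M_def)
  \<comment> \<open>\<open>j < n ^ d\<close> means at most d digits in base n. Each digit has value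
    at most n by \<open>of_nat_le\<close>, and each power of n has value at most
    \<open>M ^ d\<close> because \<open>M \<ge> 1\<close>.\<close>
  have digits: "c (of_nat j) \<le> real d * n * M ^ d" if "j < n ^ d" for j d
    using that
  proof (induction d arbitrary: j)
    case (Suc d)
    have "j div n < n ^ d" using Suc.prems assms
      by (metis less_mult_imp_div_less power_Suc2)
    note IH = Suc.IH[OF this]
    have "of_nat j = (of_nat (j div n) * of_nat n + of_nat (j mod n) :: rat)"
      by (metis div_mult_mod_eq of_nat_add of_nat_mult)
    hence "c (of_nat j) \<le> c (of_nat (j div n)) * c (of_nat n) + c (of_nat (j mod n))"
      using triangle mult by metis
    also have "\<dots> \<le> (real d * n * M ^ d) * M + n * M ^ Suc d"
    proof (intro add_mono mult_mono)
      have "c (of_nat (j mod n)) \<le> n"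
        using of_nat_le[of "j mod n"] assms mod_less_divisor[of n j] by linarith
      also have "real n * 1 \<le> n * M ^ Suc d" using M(1) by (intro mult_left_mono one_le_power) auto
      finally show "c (of_nat (j mod n)) \<le> n * M ^ Suc d" by simp
    qed (use IH M nonneg in auto)
    also have "\<dots> = real (Suc d) * n * M ^ Suc d" by (simp add: algebra_simps)
    finally show ?case .
  qed simp
  define L where "L = log n m"
  have L: "L \<ge> 0" using assms by (simp add: L_def)
  have "c (of_nat m) \<le> M powr L"
  proof (rule power_growth_le)
    fix k :: nat
    \<comment> \<open>\<open>k * L\<close> is the logarithm of \<open>m ^ k\<close> in base n, so d
      digits suffice for \<open>m ^ k\<close>. As d grows linearly in k, the factor in front of the
      power of M is polynomial in k.\<close>
    define d where "d = nat \<lfloor>k * L\<rfloor> + 1"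
    have "k * L \<ge> 0" using L by simp
    hence d: "k * L < d" "d \<le> k * L + 1" unfolding d_def by linarith+
    have "m ^ k < n ^ d"
    proof -
      have "real (m ^ k) = n powr (k * L)" using assms
        by (simp add: L_def powr_powr[symmetric] mult.commute[of "real k"] powr_realpow)
      also have "\<dots> < n powr d" using assms d by simp
      also have "\<dots> = real (n ^ d)" using assms by (simp add: powr_realpow)
      finally show ?thesis by linarith
    qed
    from digits[OF this] have "c (of_nat m) ^ k \<le> real d * n * M ^ d" by (simp add: power)
    also have "\<dots> \<le> ((L + 1) * (real k + 1)) * n * M powr (k * L + 1)"
    proof (intro mult_mono)
      have "real d \<le> k * L + 1" by fact
      also have "\<dots> \<le> (L + 1) * (real k + 1)" using L by (simp add: algebra_simps)
      finally show "real d \<le> (L + 1) * (real k + 1)" .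
      show "M ^ d \<le> M powr (k * L + 1)"
        using M d by (subst powr_realpow[symmetric]) (auto intro: powr_mono)
    qed (use L M in auto)
    also have "\<dots> = ((L + 1) * n * M) * (real k + 1) powr 1 * (M powr L) ^ k"
      using M by (simp add: powr_add powr_power mult.commute[of L])
    finally show "c (of_nat m) ^ k \<le> ((L + 1) * n * M) * (real k + 1) powr 1 * (M powr L) ^ k" .
  qed (use nonneg in auto)
  thus ?thesis by (simp add: M_def L_def)
qed

text \<open>\<open>archimedean_of_nat_le\<close> can be applied with the roles of m and n exchanged,
  so \<open>ln (c n) / ln n\<close> has the same value for all n \<ge> 2. This value, read off at 2,
  is the exponent s.\<close>

lemma archimedean_case:
  assumes "c (of_nat n0) > 1"
  shows "\<exists>s>0. \<forall>x. c x = \<bar>real_of_rat x\<bar> powr s"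
proof -
  have n0: "n0 \<ge> 2"
  proof (rule ccontr)
    assume "\<not> ?thesis" hence "n0 = 0 \<or> n0 = 1" by auto
    with assms show False by auto
  qed
  \<comment> \<open>A single n \<ge> 2 with value at most 1 would make the base of the bound 1, and
    then every natural number would have value at most 1.\<close>
  have gt1: "c (of_nat n) > 1" if "n \<ge> 2" for n
  proof (rule ccontr)
    assume "\<not> ?thesis"
    hence "max 1 (c (of_nat n)) = 1" by simp
    with archimedean_of_nat_le[OF that, of n0] n0 assms show False by simp
  qed
  have le: "ln (c (of_nat m)) / ln m \<le> ln (c (of_nat n)) / ln n" if "m \<ge> 2" "n \<ge> 2" for m n
  proof -
    have "c (of_nat m) \<le> c (of_nat n) powr (log n m)"
      using archimedean_of_nat_le[of n m] that gt1[of n] by (simp add: max_def)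
    hence "ln (c (of_nat m)) \<le> ln (c (of_nat n) powr (log n m))"
      using gt1[OF that(1)] by (subst ln_le_cancel_iff) (auto intro: order.strict_trans2)
    also have "\<dots> = log n m * ln (c (of_nat n))" using gt1[OF that(2)] by (simp add: ln_powr)
    finally show ?thesis using that by (simp add: log_def field_simps)
  qed
  define s where "s = ln (c 2) / ln 2"
  have s: "s > 0" using gt1[of 2] by (simp add: s_def)
  have "c (of_nat n) = real n powr s" if "n > 0" for n
  proof (cases "n = 1")
    case False
    hence n: "n \<ge> 2" using that by simp
    have "ln (c (of_nat n)) / ln n = s" using le[of n 2] le[of 2 n] n by (simp add: s_def)
    hence "ln (c (of_nat n)) = s * ln n" using n by (simp add: field_simps)
    thus ?thesis using gt1[OF n] n by (metis exp_ln powr_def of_nat_eq_0_iff less_trans zero_less_one not_numeral_le_zero)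
  qed auto
  moreover have "rat_absolute_value (\<lambda>q. \<bar>real_of_rat q\<bar>)"
    by unfold_locales (auto simp: of_rat_mult abs_mult of_rat_less_eq abs_triangle_ineq simp flip: of_rat_add)
  ultimately show ?thesis using eq_powr_of_nat[of "\<lambda>q. \<bar>real_of_rat q\<bar>" s] s by auto
qed

text \<open>In the binomial expansion of \<open>(x + y) ^ k\<close> the coefficients have value at
  most 1, so each of the k + 1 terms is at most \<open>max (c x) (c y) ^ k\<close>. The factor k + 1
  disappears by \<open>power_growth_le\<close>.\<close>

lemma ultrametric:
  assumes "\<And>n::nat. c (of_nat n) \<le> 1"
  shows "c (x + y) \<le> max (c x) (c y)"
proof (rule power_growth_le)
  define M where "M = max (c x) (c y)"
  have M: "c x \<le> M" "c y \<le> M" "M \<ge> 0" using nonneg[of x] by (auto simp: M_def)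
  fix k :: nat
  have "c (x + y) ^ k = c ((x + y) ^ k)" by (simp add: power)
  also have "\<dots> \<le> (\<Sum>i\<le>k. c (of_nat (k choose i) * x ^ i * y ^ (k - i)))"
    unfolding binomial_ring by (rule sum_le)
  also have "\<dots> \<le> (\<Sum>i\<le>k. M ^ k)"
  proof (rule sum_mono)
    fix i assume "i \<in> {..k}"
    have "c (of_nat (k choose i) * x ^ i * y ^ (k - i)) \<le> 1 * M ^ i * M ^ (k - i)"
      unfolding mult power by (intro mult_mono power_mono assms M) (auto simp: nonneg M)
    also have "\<dots> = M ^ k" using \<open>i \<in> {..k}\<close> by (simp flip: power_add)
    finally show "c (of_nat (k choose i) * x ^ i * y ^ (k - i)) \<le> M ^ k" .
  qed
  finally show "c (x + y) ^ k \<le> 1 * (real k + 1) powr 1 * max (c x) (c y) ^ k"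
    by (simp add: M_def add.commute)
qed (use nonneg[of x] nonneg in \<open>auto simp: le_max_iff_disj\<close>)

end

section \<open>The p-adic absolute values\<close>

lemma padic_abs_of_int:
  assumes "Factorial_Ring.prime p" "a \<noteq> 0"
  shows "padic_abs p (of_int a) = real p powr - real (multiplicity (int p) a)"
proof -
  have "p > 0" using assms prime_gt_0_nat by auto
  thus ?thesis using assms(2) by (simp add: padic_abs_def powr_minus powr_realpow power_int_minus)
qed

text \<open>\<open>padic_abs\<close> reads the valuation off the reduced fraction. Cross-multiplying
  with an arbitrary fraction and comparing multiplicities of p shows that every representation gives
  the same value.\<close>

lemma padic_abs_divide:
  assumes p: "Factorial_Ring.prime p" and "a \<noteq> 0" "b \<noteq> 0"
  shows "padic_abs p (of_int a / of_int b) =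
    real p powr (real (multiplicity (int p) b) - real (multiplicity (int p) a))"
proof -
  have p0: "p > 0" and pe: "prime_elem (int p)" using p prime_gt_0_nat by auto
  define q :: rat where "q = of_int a / of_int b"
  obtain c d where cd: "quotient_of q = (c, d)" by (metis surj_pair)
  have d: "d > 0" using quotient_of_denom_pos[OF cd] .
  have q: "q = of_int c / of_int d" using quotient_of_div[OF cd] .
  have "q \<noteq> 0" using assms by (simp add: q_def)
  hence c: "c \<noteq> 0" using q by auto
  have "(of_int (a * d) :: rat) = of_int (c * b)"
    using q assms d by (simp add: q_def field_simps)
  hence "a * d = c * b" by (simp only: of_int_eq_iff)
  hence "multiplicity (int p) (a * d) = multiplicity (int p) (c * b)" by simp
  hence "multiplicity (int p) a + multiplicity (int p) d = multiplicity (int p) c + multiplicity (int p) b"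
    using assms c d pe by (simp add: prime_elem_multiplicity_mult_distrib)
  hence e: "real (multiplicity (int p) d) - real (multiplicity (int p) c) =
    real (multiplicity (int p) b) - real (multiplicity (int p) a)" by linarith
  have "padic_abs p q = real p powi (int (multiplicity (int p) d) - int (multiplicity (int p) c))"
    using \<open>q \<noteq> 0\<close> by (simp add: padic_abs_def cd)
  also have "\<dots> = real p powr (of_int (int (multiplicity (int p) d) - int (multiplicity (int p) c)))"
    using p0 by (subst powr_real_of_int') simp_all
  also have "\<dots> = real p powr (real (multiplicity (int p) b) - real (multiplicity (int p) a))"
    using e by simp
  finally show ?thesis unfolding q_def .
qed

lemma padic_abs_nonneg: "0 \<le> padic_abs p x"
  by (simp add: padic_abs_def)

text \<open>The divisibility form of the estimate also covers \<open>a = 0\<close>, which occurs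
  when a sum cancels.\<close>

lemma padic_abs_of_int_le:
  assumes p: "Factorial_Ring.prime p" and "int p ^ k dvd a"
  shows "padic_abs p (of_int a) \<le> real p powr - real k"
proof (cases "a = 0")
  case False
  have p1: "real p > 1" using p prime_gt_1_nat by auto
  have "\<not> is_unit (int p)" using p1 by simp
  hence "k \<le> multiplicity (int p) a" using assms False by (intro multiplicity_geI) auto
  thus ?thesis unfolding padic_abs_of_int[OF p False] using p1 by simp
qed (simp add: padic_abs_def)

lemma rat_absolute_value_padic_abs:
  assumes p: "Factorial_Ring.prime p"
  shows "rat_absolute_value (padic_abs p)"
proof
  have p1: "real p > 1" and pe: "prime_elem (int p)" using p prime_gt_1_nat by auto
  fix x y :: rat
  show "0 \<le> padic_abs p x" by (rule padic_abs_nonneg)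
  show "(padic_abs p x = 0) = (x = 0)" using p1 by (auto simp: padic_abs_def)
  obtain a b where ab: "x = of_int a / of_int b" "b \<noteq> 0"
    using quotient_of_denom_pos quotient_of_div by (metis less_irrefl surj_pair)
  obtain c d where cd: "y = of_int c / of_int d" "d \<noteq> 0"
    using quotient_of_denom_pos quotient_of_div by (metis less_irrefl surj_pair)
  have mult: "padic_abs p (of_int a / of_int b * (of_int c / of_int d)) =
    padic_abs p (of_int a / of_int b) * padic_abs p (of_int c / of_int d)" if "b \<noteq> 0" "d \<noteq> 0" for a b c d
  proof (cases "a = 0 \<or> c = 0")
    case False
    have *: "of_int a / of_int b * (of_int c / of_int d) = (of_int (a * c) / of_int (b * d) :: rat)" by simp
    show ?thesis
      unfolding * using False that pe p1
      by (subst (1 2 3) padic_abs_divide[OF p])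
        (auto simp: prime_elem_multiplicity_mult_distrib powr_add[symmetric] algebra_simps)
  qed (auto simp: padic_abs_def)
  show "padic_abs p (x * y) = padic_abs p x * padic_abs p y"
    unfolding ab cd by (rule mult) fact+
  show "padic_abs p (x + y) \<le> padic_abs p x + padic_abs p y"
  proof -
    \<comment> \<open>The smaller of the two powers of p divides the sum, which gives even the bound
      by the maximum. Fractions are then brought to the common denominator
      \<open>b * d\<close>.\<close>
    have int: "padic_abs p (of_int i + of_int j) \<le> padic_abs p (of_int i) + padic_abs p (of_int j)" for i j
    proof (cases "i = 0 \<or> j = 0")
      case False
      define k where "k = min (multiplicity (int p) i) (multiplicity (int p) j)"
      have "int p ^ k dvd i" "int p ^ k dvd j"
        by (auto simp: k_def intro: multiplicity_dvd')
      hence "padic_abs p (of_int (i + j)) \<le> real p powr - real k"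
        by (intro padic_abs_of_int_le p) auto
      also have "\<dots> \<le> padic_abs p (of_int i) + padic_abs p (of_int j)"
        using False by (simp add: padic_abs_of_int p k_def min_def)
      finally show ?thesis by simp
    qed (auto simp: padic_abs_def)
    have bd: "padic_abs p (1 / of_int (b * d)) \<ge> 0" by (rule padic_abs_nonneg)
    have split: "padic_abs p (of_int i / of_int (b * d)) =
        padic_abs p (of_int i) * padic_abs p (1 / of_int (b * d))" for i
      using mult[of 1 "b * d" i 1] ab cd by simp
    have "x = of_int (a * d) / of_int (b * d)" "y = of_int (c * b) / of_int (b * d)"
      using ab cd by (simp_all add: field_simps)
    moreover from this have "x + y = of_int (a * d + c * b) / of_int (b * d)"
      by (simp add: add_divide_distrib)
    ultimately show ?thesis
      using mult_right_mono[OF int[of "a * d" "c * b"] bd] split[of "a * d"] split[of "c * b"]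
        split[of "a * d + c * b"] by (simp add: algebra_simps)
  qed
qed

section \<open>Ostrowski's theorem and the uniqueness of its exponent\<close>

lemma rat_absolute_value_usual:
  assumes "u \<in> usual_rat_abs"
  shows "rat_absolute_value u"
proof -
  have "rat_absolute_value (\<lambda>q. \<bar>real_of_rat q\<bar>)"
    by unfold_locales (auto simp: of_rat_mult abs_mult of_rat_less_eq abs_triangle_ineq simp flip: of_rat_add)
  thus ?thesis using assms rat_absolute_value_padic_abs by (auto simp: usual_rat_abs_def)
qed

text \<open>If no natural number has value above 1, the ultrametric inequality holds. The least
  positive n with \<open>c n < 1\<close> is then a prime p, since a proper factorisation would have
  factors of value 1, and integers prime to p have value 1 by a Bezout identity. So c is determined
  by its value at p.\<close>

theorem (in rat_absolute_value) ostrowski: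
  assumes nontrivial: "\<exists>x. x \<noteq> 0 \<and> c x \<noteq> 1"
  shows "\<exists>u\<in>usual_rat_abs. \<exists>s>0. \<forall>x. c x = u x powr s"
proof (cases "\<exists>n::nat. c (of_nat n) > 1")
  case True
  thus ?thesis using archimedean_case by (auto simp: usual_rat_abs_def)
next
  case False
  hence le1: "c (of_nat n) \<le> 1" for n by (meson not_le)
  have le1i: "c (of_int i) \<le> 1" for i using le1[of "nat \<bar>i\<bar>"] of_int_eq[of i] by metis
  have "\<exists>n::nat. n > 0 \<and> c (of_nat n) < 1"
  proof (rule ccontr)
    assume "\<not> ?thesis"
    hence "c (of_nat n) = 1" if "n > 0" for n using le1[of n] that by (meson antisym not_le)
    hence i: "c (of_int i) = 1" if "i \<noteq> 0" for i using that of_int_eq[of i] by (metis zero_less_abs_iff zero_less_nat_eq)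
    obtain x where x: "x \<noteq> 0" "c x \<noteq> 1" using nontrivial by blast
    obtain a b where ab: "x = of_int a / of_int b" "b > 0"
      using quotient_of_denom_pos quotient_of_div by (metis surj_pair)
    with x have "a \<noteq> 0" by auto
    with ab x show False by (simp add: divide i)
  qed
  define p where "p = (LEAST n::nat. n > 0 \<and> c (of_nat n) < 1)"
  have p: "p > 0" "c (of_nat p) < 1"
    using LeastI_ex[OF \<open>\<exists>n::nat. n > 0 \<and> c (of_nat n) < 1\<close>] by (auto simp: p_def)
  have least: "c (of_nat n) = 1" if "0 < n" "n < p" for n
    using not_less_Least[of n "\<lambda>n. n > 0 \<and> c (of_nat n) < 1"] that le1[of n] by (auto simp: p_def)
  have "p \<noteq> 1" using p by auto
  hence p1: "p > 1" using p by simp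
  have prime: "Factorial_Ring.prime p"
    unfolding prime_nat_iff
  proof (intro conjI allI impI)
    fix a assume "a dvd p"
    then obtain b where ab: "p = a * b" by (elim dvdE)
    show "a = 1 \<or> a = p"
    proof (rule ccontr)
      assume *: "\<not> ?thesis"
      have "a \<noteq> 0" "b \<noteq> 0" using ab p(1) by auto
      moreover have "b \<noteq> 1" using * ab by auto
      ultimately have "1 < a" "1 < b" using * by auto
      hence "c (of_nat a) * c (of_nat b) = 1" using ab by (simp add: least)
      hence "c (of_nat p) = 1" using ab mult[of "of_nat a" "of_nat b"] by (metis of_nat_mult)
      thus False using p by simp
    qed
  qed (use p1 in auto)
  have cop: "c (of_nat m) = 1" if "\<not> p dvd m" for m
  proof (rule ccontr)
    assume "c (of_nat m) \<noteq> 1"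
    hence m: "c (of_nat m) < 1" using le1[of m] by simp
    have "coprime (int m) (int p)"
      using prime that by (metis coprime_commute coprime_int_iff prime_imp_coprime)
    then obtain a b where "a * int m + b * int p = 1"
      by (metis bezout_int coprime_imp_gcd_eq_1)
    hence "(of_int (a * int m + b * int p) :: rat) = 1" by simp
    hence "1 = c (of_int a * of_nat m + of_int b * of_nat p)" by simp
    also have "\<dots> \<le> max (c (of_int a) * c (of_nat m)) (c (of_int b) * c (of_nat p))"
      unfolding mult[symmetric] by (rule ultrametric) (rule le1)
    also have "\<dots> < 1"
      using mult_left_le_one_le[OF nonneg[of "of_nat m"] nonneg le1i[of a]]
        mult_left_le_one_le[OF nonneg[of "of_nat p"] nonneg le1i[of b]] m p by simp
    finally show False by simp
  qed
  have cp: "c (of_nat p) > 0" using nonneg[of "of_nat p"] zero_iff[of "of_nat p"] p by simp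
  \<comment> \<open>Chosen so that \<open>c p = p powr - s\<close>, the s-th power of the p-adic
    value of p.\<close>
  define s where "s = - ln (c (of_nat p)) / ln p"
  have s: "s > 0" using p cp p1 by (simp add: s_def divide_neg_pos)
  have "c (of_nat n) = padic_abs p (of_nat n) powr s" if n: "n > 0" for n
  proof -
    define k where "k = multiplicity p n"
    obtain m where m: "n = p ^ k * m" "\<not> p dvd m"
      using multiplicity_decompose'[of n p] n p1 unfolding k_def by auto
    have mult_int: "multiplicity (int p) (int n) = k"
    proof (rule multiplicity_eqI)
      show "int p ^ k dvd int n" using m by simp
      have "\<not> p ^ Suc k dvd n" using m p by simp
      thus "\<not> int p ^ Suc k dvd int n" by (metis of_nat_dvd_iff of_nat_power)
    qed
    have "c (of_nat n) = c (of_nat p) ^ k" using m cop by (simp add: mult power)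
    also have "\<dots> = exp (- (real k * (s * ln p)))"
      using cp p1 by (simp add: s_def exp_of_nat_mult)
    also have "\<dots> = (real p powr - real k) powr s"
      using p1 by (simp add: powr_powr) (simp add: powr_def)
    also have "real p powr - real k = padic_abs p (of_nat n)"
      using padic_abs_of_int[OF prime, of "int n"] n mult_int by simp
    finally show ?thesis .
  qed
  from eq_powr_of_nat[OF rat_absolute_value_padic_abs[OF prime] s this] s prime
  show ?thesis by (auto simp: usual_rat_abs_def)
qed

text \<open>Makes the normalised member of a place unique. Among the usual absolute values only the
  archimedean one exceeds 1 at 2, and only the p-adic one is below 1 at p, so u and u' are of the
  same kind; comparing their values at this number gives s.\<close>

lemma usual_rat_abs_powr_eq:
  assumes "u \<in> usual_rat_abs" "u' \<in> usual_rat_abs" "s > 0" "\<And>x. u' x = u x powr s"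
  shows "s = 1"
proof -
  consider "u = (\<lambda>q. \<bar>real_of_rat q\<bar>)" | p where "Factorial_Ring.prime p" "u = padic_abs p"
    using assms(1) by (auto simp: usual_rat_abs_def)
  thus ?thesis
  proof cases
    case 1
    have "u' 2 = 2 powr s" using assms(4)[of 2] by (simp add: 1)
    moreover have "padic_abs p 2 \<le> 2 powr 0" if "Factorial_Ring.prime p" for p
      using rat_absolute_value.ultrametric padic_abs_of_int_le[OF that, of 0 2] prime_gt_0_nat[OF that] by simp
    moreover have "(2::real) powr s > 1" using assms(3) by simp
    ultimately have "u' \<noteq> padic_abs p" if "Factorial_Ring.prime p" for p
    proof -
      assume 1: "u' 2 = 2 powr s" "\<And>p. Factorial_Ring.prime p \<Longrightarrow> padic_abs p 2 \<le> 2 powr 0"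
        "(2::real) powr s > 1"
      have "padic_abs p 2 < u' 2" using 1(2)[OF that] 1(1,3) by simp
      thus ?thesis by (metis less_irrefl)
    qed
    hence "u' = (\<lambda>q. \<bar>real_of_rat q\<bar>)" using assms(2) unfolding usual_rat_abs_def by blast
    hence "u' 2 = 2" by simp
    with \<open>u' 2 = 2 powr s\<close> show ?thesis using powr_inj[of 2 s 1] by simp
  next
    case 2
    have p1: "real p > 1" using 2 prime_gt_1_nat by auto
    have pp: "padic_abs p (of_nat p) = real p powr - 1"
      using padic_abs_of_int[OF 2(1), of "int p"] p1 multiplicity_self[of "int p"] by simp
    have u': "u' (of_nat p) = real p powr - s" using assms(4)[of "of_nat p"] unfolding 2 pp by (simp only: powr_powr) simp
    have "u' (of_nat p) < 1" unfolding u' using p1 assms(3) by (simp add: powr_less_one)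
    with p1 have "u' \<noteq> (\<lambda>q. \<bar>real_of_rat q\<bar>)" by auto
    then obtain q where q: "Factorial_Ring.prime q" "u' = padic_abs q" using assms(2) by (auto simp: usual_rat_abs_def)
    have "q = p"
    proof (rule ccontr)
      assume "q \<noteq> p"
      hence "\<not> q dvd p" using q 2 primes_dvd_imp_eq by blast
      hence "padic_abs q (of_nat p) = 1"
        using padic_abs_of_int[OF q(1), of "int p"] p1 prime_gt_0_nat[OF q(1)]
        by (simp add: not_dvd_imp_multiplicity_0)
      with \<open>u' (of_nat p) < 1\<close> q show False by simp
    qed
    hence "real p powr - s = real p powr - 1" using u' pp q by simp
    thus ?thesis using p1 powr_inj[of "real p" "- s" "- 1"] by linarith
  qed
qed

lemma usual_rat_abs_of_nat_le:
  assumes "u \<in> usual_rat_abs" 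
  shows "u (of_nat n) \<le> n"
  using rat_absolute_value.of_nat_le[OF rat_absolute_value_usual[OF assms]] .

lemma usual_rat_abs_nontrivial:
  assumes "u \<in> usual_rat_abs" 
  shows "\<exists>x. x \<noteq> 0 \<and> u x \<noteq> 1"
proof -
  consider "u = (\<lambda>q. \<bar>real_of_rat q\<bar>)" | p where "Factorial_Ring.prime p" "u = padic_abs p"
    using assms by (auto simp: usual_rat_abs_def)
  thus ?thesis
  proof cases
    case 1
    thus ?thesis by (intro exI[of _ 2]) simp
  next
    case 2
    have p1: "real p > 1" using 2 prime_gt_1_nat by auto
    have "padic_abs p (of_nat p) = real p powr - 1"
      using padic_abs_of_int[OF 2(1), of "int p"] p1 multiplicity_self[of "int p"] by simp
    also have "\<dots> < 1" using p1 by (simp add: powr_less_one)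
    finally show ?thesis using p1 2 by (intro exI[of _ "of_nat p"]) auto
  qed
qed

section \<open>Number fields inside the algebraic closure\<close>

lemma ring_of_type_algebra_simps [simp]:
  "carrier (ring_of_type_algebra :: 'a::comm_ring_1 ring) = UNIV"
  "x \<otimes>\<^bsub>ring_of_type_algebra\<^esub> y = (x * y :: 'a)"
  "x \<oplus>\<^bsub>ring_of_type_algebra\<^esub> y = (x + y :: 'a)"
  "\<one>\<^bsub>ring_of_type_algebra\<^esub> = (1 :: 'a)"
  "\<zero>\<^bsub>ring_of_type_algebra\<^esub> = (0 :: 'a)"
  by (simp_all add: ring_of_type_algebra_def)

lemma field_Qbar: "field Qbar_ring"
  by (rule field_from_type_algebra)

interpretation Qbar: domain Qbar_ring
  by (rule field.axioms(1)[OF field_Qbar])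

lemma Qbar_a_inv: "\<ominus>\<^bsub>Qbar_ring\<^esub> x = - x"
  by (rule Qbar.minus_equality) simp_all

lemma Qbar_m_inv: "x \<noteq> 0 \<Longrightarrow> inv\<^bsub>Qbar_ring\<^esub> x = inverse x"
  by (rule Qbar.comm_inv_char) simp_all

lemma Qbar_subfieldI:
  assumes "1 \<in> K" "\<And>x. x \<in> K \<Longrightarrow> - x \<in> K" "\<And>x y. x \<in> K \<Longrightarrow> y \<in> K \<Longrightarrow> x + y \<in> K"
    "\<And>x y. x \<in> K \<Longrightarrow> y \<in> K \<Longrightarrow> x * y \<in> K" "\<And>x. x \<in> K \<Longrightarrow> inverse x \<in> K"
  shows "subfield K Qbar_ring"
proof (rule field.subfieldI'[OF field_Qbar])
  show "subring K Qbar_ring"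
    by (rule Qbar.subringI) (use assms in \<open>auto simp: Qbar_a_inv\<close>)
qed (use assms in \<open>auto simp: Qbar_m_inv\<close>)

lemma subfield_Rats: "subfield \<rat> Qbar_ring"
  by (rule Qbar_subfieldI) auto

locale Qbar_subfield =
  fixes K :: "qbar set"
  assumes subfield: "subfield K Qbar_ring"
begin

lemma one_closed [simp]: "1 \<in> K" and zero_closed [simp]: "0 \<in> K"
  and minus_closed [simp]: "x \<in> K \<Longrightarrow> - x \<in> K"
  and add_closed [simp]: "x \<in> K \<Longrightarrow> y \<in> K \<Longrightarrow> x + y \<in> K"
  and mult_closed [simp]: "x \<in> K \<Longrightarrow> y \<in> K \<Longrightarrow> x * y \<in> K"
  using subringE[OF subfieldE(1)[OF subfield]] by (auto simp: Qbar_a_inv)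

lemma diff_closed [simp]: "x \<in> K \<Longrightarrow> y \<in> K \<Longrightarrow> x - y \<in> K"
  using add_closed[of x "- y"] by simp

lemma inverse_closed [simp]: "x \<in> K \<Longrightarrow> inverse x \<in> K"
  using Qbar.subfield_m_inv(1)[OF subfield, of x] by (cases "x = 0") (auto simp: Qbar_m_inv)

lemma divide_closed [simp]: "x \<in> K \<Longrightarrow> y \<in> K \<Longrightarrow> x / y \<in> K"
  by (simp add: divide_inverse)

lemma power_closed [simp]: "x \<in> K \<Longrightarrow> x ^ n \<in> K"
  by (induction n) auto

lemma sum_closed: "(\<And>i. i \<in> I \<Longrightarrow> f i \<in> K) \<Longrightarrow> sum f I \<in> K"
  by (induction I rule: infinite_finite_induct) auto

lemma of_nat_closed [simp]: "of_nat n \<in> K"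
  by (induction n) auto

lemma of_int_closed [simp]: "of_int i \<in> K"
  by (cases i rule: int_cases2) auto

lemma of_rat_closed [simp]: "of_rat q \<in> K"
  by (cases q) (simp add: of_rat_rat)

lemma Rats_subset: "\<rat> \<subseteq> K"
  by (auto elim: Rats_cases)

end

lemma number_fieldD: "number_field K \<Longrightarrow> Qbar_subfield K"
  by (simp add: number_field_def Qbar_subfield_def)

lemma number_field_Rats: "number_field \<rat>"
  using subfield_Rats Qbar.dimension_one[OF subfield_Rats]
  by (auto simp: number_field_def Qbar.finite_dimension_def)

lemma global_degree_pos:
  assumes "number_field K"
  shows "global_degree K > 0"
proof -
  interpret Qbar_subfield K by (rule number_fieldD) fact
  have "Qbar.dimension (global_degree K) \<rat> K"
    using Qbar.finite_dimensionE[OF subfield_Rats, of K] assms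
    by (simp add: number_field_def global_degree_def over_def)
  moreover have "\<not> Qbar.dimension 0 \<rat> K"
  proof
    assume "Qbar.dimension 0 \<rat> K"
    hence "K = {0}" using Qbar.dimension_zero[OF subfield_Rats] by simp
    with one_closed have "(1 :: qbar) \<in> {0}" by metis
    thus False by simp
  qed
  ultimately show ?thesis by (metis neq0_conv)
qed

lemma number_field_Span:
  assumes "number_field K"
  obtains Us where "K = Qbar.Span \<rat> Us"
  using assms Qbar.exists_base[OF subfield_Rats]
  by (auto simp: number_field_def Qbar.finite_dimension_def)

section \<open>Polynomials over a subfield and simple extensions\<close>

definition polys_over :: "'a::zero set \<Rightarrow> 'a poly set" where
  "polys_over K = {p. \<forall>i. poly.coeff p i \<in> K}"

text \<open>For algebraic x the values of polynomials already form the field K(x). In this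
  presentation an embedding of K is extended by evaluating polynomials at another root.\<close>

definition adjoin :: "'a::comm_semiring_0 set \<Rightarrow> 'a \<Rightarrow> 'a set" where
  "adjoin K x = (\<lambda>p. poly p x) ` polys_over K"

context Qbar_subfield
begin

lemma polys_over_pCons [simp]: "pCons a p \<in> polys_over K \<longleftrightarrow> a \<in> K \<and> p \<in> polys_over K"
  by (auto simp: polys_over_def coeff_pCons split: nat.splits)

lemma polys_over_0 [simp]: "0 \<in> polys_over K"
  by (simp add: polys_over_def)

lemma polys_over_add [simp]: "p \<in> polys_over K \<Longrightarrow> q \<in> polys_over K \<Longrightarrow> p + q \<in> polys_over K"
  by (auto simp: polys_over_def)

lemma polys_over_diff [simp]: "p \<in> polys_over K \<Longrightarrow> q \<in> polys_over K \<Longrightarrow> p - q \<in> polys_over K"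
  by (auto simp: polys_over_def)

lemma polys_over_mult [simp]: "p \<in> polys_over K \<Longrightarrow> q \<in> polys_over K \<Longrightarrow> p * q \<in> polys_over K"
  by (auto simp: polys_over_def coeff_mult intro!: sum_closed)

lemma polys_over_smult [simp]: "a \<in> K \<Longrightarrow> q \<in> polys_over K \<Longrightarrow> Polynomial.smult a q \<in> polys_over K"
  by (auto simp: polys_over_def)

lemma polys_over_monom [simp]: "a \<in> K \<Longrightarrow> Polynomial.monom a n \<in> polys_over K"
  by (auto simp: polys_over_def)

text \<open>The bridge to \<open>simple_extension\<close>, whose field property and finite dimension
  for algebraic elements give \<open>number_field_adjoin\<close>.\<close>

lemma adjoin_eq_simple_extension: "adjoin K x = Qbar.simple_extension K x"
proof (intro equalityI subsetI)
  fix y assume "y \<in> adjoin K x"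
  then obtain p where "p \<in> polys_over K" "y = poly p x" by (auto simp: adjoin_def)
  thus "y \<in> Qbar.simple_extension K x"
  proof (induction p arbitrary: y)
    case (pCons a p)
    thus ?case using Qbar.simple_extension.lin[of "poly p x" K x a] by (simp add: mult.commute add.commute)
  next
    case 0
    thus ?case using Qbar.simple_extension.zero[of K x] by simp
  qed
next
  fix y assume "y \<in> Qbar.simple_extension K x"
  thus "y \<in> adjoin K x"
  proof induction
    case zero
    show ?case unfolding adjoin_def by (rule image_eqI[of _ _ 0]) auto
  next
    case (lin k1 k2)
    then obtain p where "p \<in> polys_over K" "k1 = poly p x" by (auto simp: adjoin_def)
    thus ?case unfolding adjoin_def using lin
      by (intro image_eqI[of _ _ "pCons k2 p"]) (auto simp: mult.commute add.commute)
  qed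
qed

lemma subset_adjoin: "K \<subseteq> adjoin K x"
proof
  fix y assume "y \<in> K"
  thus "y \<in> adjoin K x" unfolding adjoin_def by (intro image_eqI[of _ _ "[:y:]"]) auto
qed

lemma mem_adjoin: "x \<in> adjoin K x"
  unfolding adjoin_def by (rule image_eqI[of _ _ "[:0, 1:]"]) auto

end

lemma Qbar_pow: "x [^]\<^bsub>Qbar_ring\<^esub> (n::nat) = x ^ n"
  by (induction n) (simp_all add: mult.commute)

text \<open>\<open>eval\<close> takes coefficient lists with the leading coefficient first, whereas
  \<open>Poly\<close> starts with the constant one; hence the reversal.\<close>

lemma Qbar_eval_rev: "Qbar.eval (rev cs) x = poly (Poly cs) x"
proof (induction cs)
  case (Cons c cs)
  have "Qbar.eval (ds @ [d]) x = Qbar.eval ds x * x + d" for ds d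
    by (induction ds) (simp_all add: Qbar_pow algebra_simps)
  with Cons show ?case by (simp add: algebra_simps)
qed simp

lemma to_ac_eq_of_rat: "to_ac q = (of_rat q :: qbar)"
  by (cases q) (simp add: of_rat_rat Fract_of_int_quotient of_rat_divide)

lemma Qbar_algebraic:
  assumes "subfield K Qbar_ring"
  shows "Qbar.algebraic K x"
proof -
  interpret Qbar_subfield K by (rule Qbar_subfield.intro) fact
  obtain p where p: "p \<noteq> 0" "poly (map_poly to_ac p) x = 0" using alg_closure_algebraic .
  define q where "q = map_poly to_ac p"
  have q: "q \<noteq> 0" "poly q x = 0" "q \<in> polys_over K"
    using p by (auto simp: q_def polys_over_def coeff_map_poly to_ac_eq_of_rat map_poly_eq_0_iff)
  define cs where "cs = rev (coeffs q)"
  have "set cs \<subseteq> K" using q(3) by (auto simp: cs_def polys_over_def coeffs_def)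
  moreover have "cs \<noteq> []" "hd cs \<noteq> 0"
    using q(1) by (auto simp: cs_def hd_rev last_coeffs_eq_coeff_degree)
  ultimately have "cs \<in> carrier (univ_poly Qbar_ring K)"
    by (simp add: univ_poly_def polynomial_def)
  moreover have "Qbar.eval cs x = 0"
    using Qbar_eval_rev[of "coeffs q" x] q by (simp add: cs_def)
  ultimately show ?thesis
    using \<open>cs \<noteq> []\<close> Qbar.algebraicI by (simp add: over_def)
qed

lemma number_field_adjoin:
  assumes "number_field K"
  shows "number_field (adjoin K x)"
proof -
  interpret Qbar_subfield K by (rule number_fieldD) fact
  have alg: "(Qbar.algebraic over K) x"
    using Qbar_algebraic[OF subfield] by (simp add: over_def)
  have "subfield (adjoin K x) Qbar_ring"
    unfolding adjoin_eq_simple_extension using Qbar.simple_extension_is_subfield[OF subfield] alg by simp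
  moreover have "Qbar.finite_dimension K (adjoin K x)"
    unfolding adjoin_eq_simple_extension using Qbar.finite_dimension_simple_extension[OF subfield] alg by simp
  ultimately show ?thesis
    using assms Qbar.telescopic_base_dim(1)[OF subfield_Rats subfield] by (simp add: number_field_def)
qed

section \<open>Minimal polynomials and extension of embeddings\<close>

text \<open>The target field stays generic so as to cover embeddings into \<open>qbar\<close>
  (conjugation) and into the complex numbers (archimedean places). Outside K the function is
  arbitrary.\<close>

definition field_hom_on :: "qbar set \<Rightarrow> (qbar \<Rightarrow> 'b::field) \<Rightarrow> bool" where
  "field_hom_on K f \<longleftrightarrow> f 1 = 1 \<and>
     (\<forall>x\<in>K. \<forall>y\<in>K. f (x + y) = f x + f y \<and> f (x * y) = f x * f y)"

locale Qbar_hom = Qbar_subfield K for K +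
  fixes f :: "qbar \<Rightarrow> 'b::field"
  assumes hom: "field_hom_on K f"
begin

lemma one [simp]: "f 1 = 1"
  and add: "x \<in> K \<Longrightarrow> y \<in> K \<Longrightarrow> f (x + y) = f x + f y"
  and mult: "x \<in> K \<Longrightarrow> y \<in> K \<Longrightarrow> f (x * y) = f x * f y"
  using hom by (auto simp: field_hom_on_def)

lemma zero [simp]: "f 0 = 0"
  using add[OF zero_closed zero_closed] by (metis add_0 add_cancel_right_right)

lemma minus: "x \<in> K \<Longrightarrow> f (- x) = - f x"
  using add[of x "- x"] by (simp add: eq_neg_iff_add_eq_0 add.commute)

lemma diff: "x \<in> K \<Longrightarrow> y \<in> K \<Longrightarrow> f (x - y) = f x - f y"
  using add[of x "- y"] minus[of y] by simp

lemma eq_0_iff: "x \<in> K \<Longrightarrow> f x = 0 \<longleftrightarrow> x = 0"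
  using mult[of x "inverse x"] by (cases "x = 0") auto

lemma inj: "inj_on f K"
  by (rule inj_onI) (metis diff diff_closed eq_0_iff right_minus_eq)

lemma inverse: "x \<in> K \<Longrightarrow> f (inverse x) = inverse (f x)"
  using mult[of x "inverse x"] by (cases "x = 0") (auto simp: eq_0_iff field_simps)

lemma sum: "(\<And>i. i \<in> I \<Longrightarrow> g i \<in> K) \<Longrightarrow> f (\<Sum>i\<in>I. g i) = (\<Sum>i\<in>I. f (g i))"
  by (induction I rule: infinite_finite_induct) (auto simp: add sum_closed)

lemma of_nat: "f (of_nat n) = of_nat n"
  by (induction n) (auto simp: add)

lemma of_int: "f (of_int i) = of_int i"
  by (cases i rule: int_cases2) (auto simp: of_nat minus)

abbreviation map :: "qbar poly \<Rightarrow> 'b poly" where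
  "map \<equiv> map_poly f"

lemma coeff_map [simp]: "poly.coeff (map p) i = f (poly.coeff p i)"
  by (simp add: coeff_map_poly)

lemma map_add: "p \<in> polys_over K \<Longrightarrow> q \<in> polys_over K \<Longrightarrow> map (p + q) = map p + map q"
  by (rule poly_eqI) (auto simp: polys_over_def add)

lemma map_diff: "p \<in> polys_over K \<Longrightarrow> q \<in> polys_over K \<Longrightarrow> map (p - q) = map p - map q"
  by (rule poly_eqI) (auto simp: polys_over_def diff)

lemma map_mult: "p \<in> polys_over K \<Longrightarrow> q \<in> polys_over K \<Longrightarrow> map (p * q) = map p * map q"
  by (rule poly_eqI) (auto simp: polys_over_def coeff_mult sum mult)

lemma map_pCons: "a \<in> K \<Longrightarrow> p \<in> polys_over K \<Longrightarrow> map (pCons a p) = pCons (f a) (map p)"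
  by (rule poly_eqI) (auto simp: coeff_pCons split: nat.splits)

end

context Qbar_subfield
begin

definition min_poly :: "qbar \<Rightarrow> qbar poly" where
  "min_poly x = (ARG_MIN Polynomial.degree m. m \<in> polys_over K \<and> Polynomial.lead_coeff m = 1 \<and> poly m x = 0)"

lemma min_poly:
  shows "min_poly x \<in> polys_over K" "Polynomial.lead_coeff (min_poly x) = 1" "poly (min_poly x) x = 0"
    and min_poly_minimal: "m \<in> polys_over K \<Longrightarrow> Polynomial.lead_coeff m = 1 \<Longrightarrow> poly m x = 0 \<Longrightarrow>
      Polynomial.degree (min_poly x) \<le> Polynomial.degree m"
proof -
  let ?P = "\<lambda>m. m \<in> polys_over K \<and> Polynomial.lead_coeff m = 1 \<and> poly m x = 0"
  obtain p where p: "p \<noteq> 0" "poly (map_poly to_ac p) x = 0" using alg_closure_algebraic .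
  define q where "q = map_poly to_ac p"
  have q: "q \<noteq> 0" "poly q x = 0" "q \<in> polys_over K"
    using p by (auto simp: q_def polys_over_def coeff_map_poly to_ac_eq_of_rat map_poly_eq_0_iff)
  have "Polynomial.lead_coeff q \<in> K" using q(3) by (auto simp: polys_over_def)
  hence ex: "?P (Polynomial.smult (inverse (Polynomial.lead_coeff q)) q)" using q by simp
  have "?P (min_poly x)" and min: "\<forall>m. ?P m \<longrightarrow> Polynomial.degree (min_poly x) \<le> Polynomial.degree m"
    unfolding min_poly_def using arg_min_nat_lemma[of ?P, OF ex] by blast+
  thus "min_poly x \<in> polys_over K" "Polynomial.lead_coeff (min_poly x) = 1" "poly (min_poly x) x = 0"
    "m \<in> polys_over K \<Longrightarrow> Polynomial.lead_coeff m = 1 \<Longrightarrow> poly m x = 0 \<Longrightarrow>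
      Polynomial.degree (min_poly x) \<le> Polynomial.degree m" by blast+
qed

lemma min_poly_neq_0: "min_poly x \<noteq> 0"
  using min_poly(2)[of x] by auto

lemma degree_min_poly_pos: "Polynomial.degree (min_poly x) > 0"
proof (rule ccontr)
  assume "\<not> ?thesis"
  then obtain a where "min_poly x = [:a:]" by (auto elim: degree_eq_zeroE)
  with min_poly(2,3)[of x] show False by simp
qed

end

text \<open>Division by the minimal polynomial m, one leading term at a time: a monomial multiple of
  m vanishes at x, and its image under f vanishes at r, so subtracting it from p lowers the degree
  and changes neither value. Minimality of m guarantees that a nonzero p has degree at least that of
  m.\<close>

lemma (in Qbar_hom) root_of_map_min_poly:
  assumes r: "poly (map (min_poly x)) r = 0"
  shows "p \<in> polys_over K \<Longrightarrow> poly p x = 0 \<Longrightarrow> poly (map p) r = 0"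
proof (induction "Polynomial.degree p" arbitrary: p rule: less_induct)
  case less
  show ?case
  proof (cases "p = 0")
    case False
    define m c d where "m = min_poly x" and "c = Polynomial.lead_coeff p"
      and "d = Polynomial.degree p - Polynomial.degree m"
    note m = min_poly[where x = x, folded m_def]
    have c: "c \<in> K" "c \<noteq> 0" using less.prems False by (auto simp: c_def polys_over_def)
    have "Polynomial.degree m \<le> Polynomial.degree (Polynomial.smult (inverse c) p)"
      using min_poly_minimal[of "Polynomial.smult (inverse c) p" x] less.prems c
      by (simp add: m_def) (simp add: c_def)
    hence deg: "Polynomial.degree m \<le> Polynomial.degree p" using c by simp
    define s where "s = Polynomial.monom c d * m"
    have s: "s \<in> polys_over K" using c m by (simp add: s_def)
    have "m \<noteq> 0" using m(2) by auto
    hence "Polynomial.degree s = Polynomial.degree p"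
      using c deg by (simp add: s_def degree_mult_eq degree_monom_eq monom_eq_0_iff d_def)
    moreover have "Polynomial.lead_coeff s = c"
      using m(2) unfolding s_def lead_coeff_mult by (simp add: degree_monom_eq c)
    ultimately have degs: "Polynomial.degree s = Polynomial.degree p" "Polynomial.lead_coeff s = c"
      by blast+
    have pos: "Polynomial.degree p > 0" using deg degree_min_poly_pos[of x] by (simp add: m_def)
    have "Polynomial.degree (p - s) < Polynomial.degree p"
    proof -
      have "Polynomial.degree (p - s) \<le> Polynomial.degree p" using degs by (intro degree_diff_le) auto
      moreover have "poly.coeff (p - s) (Polynomial.degree p) = 0" using degs by (simp add: c_def)
      ultimately show ?thesis using pos by (metis eq_zero_or_degree_less degree_0)
    qed
    moreover have "poly (p - s) x = 0" using less.prems m by (simp add: s_def)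
    ultimately have "poly (map (p - s)) r = 0" using less.hyps less.prems s by simp
    moreover have "poly (map s) r = 0"
      unfolding s_def using c m r by (subst map_mult) (auto simp: m_def)
    ultimately show ?thesis using map_diff[OF less.prems(1) s] by simp
  qed simp
qed

lemma (in Qbar_hom) extend_to_adjoin:
  assumes r: "poly (map (min_poly x)) r = 0"
  obtains g where "field_hom_on (adjoin K x) g" "\<And>y. y \<in> K \<Longrightarrow> g y = f y" "g x = r"
    "\<And>p. p \<in> polys_over K \<Longrightarrow> g (poly p x) = poly (map p) r"
proof -
  \<comment> \<open>The polynomial representing y is chosen arbitrarily; two choices differ by a
    polynomial vanishing at x, so \<open>root_of_map_min_poly\<close> makes the value at r
    independent of the choice.\<close>
  define g where "g y = poly (map (SOME p. p \<in> polys_over K \<and> poly p x = y)) r" for y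
  have g: "g (poly p x) = poly (map p) r" if p: "p \<in> polys_over K" for p
  proof -
    define q where "q = (SOME q. q \<in> polys_over K \<and> poly q x = poly p x)"
    have "q \<in> polys_over K \<and> poly q x = poly p x" unfolding q_def by (rule someI) (use p in auto)
    hence "poly (map (q - p)) r = 0" by (intro root_of_map_min_poly[OF r]) (use p in auto)
    thus ?thesis using p \<open>q \<in> _ \<and> _\<close> by (simp add: g_def q_def[symmetric] map_diff)
  qed
  show ?thesis
  proof
    show gK: "g y = f y" if "y \<in> K" for y
      using g[of "[:y:]"] that by (simp add: map_pCons)
    show "g x = r" using g[of "[:0, 1:]"] by (simp add: map_pCons)
    show "field_hom_on (adjoin K x) g"
      unfolding field_hom_on_def
    proof (intro conjI ballI)
      show "g 1 = 1" using gK by simp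
      fix y z assume "y \<in> adjoin K x" "z \<in> adjoin K x"
      then obtain p q where pq: "p \<in> polys_over K" "q \<in> polys_over K" "y = poly p x" "z = poly q x"
        by (auto simp: adjoin_def)
      show "g (y + z) = g y + g z" "g (y * z) = g y * g z"
        using pq g[of "p + q"] g[of "p * q"] by (simp_all add: g map_add map_mult)
    qed
  qed (rule g)
qed

section \<open>Places and normalised absolute values\<close>

lemma power_powr_commute:
  fixes z s :: real
  assumes "z \<ge> 0"
  shows "(z powr s) ^ n = (z ^ n) powr s"
  using assms by (induction n) (simp_all add: powr_mult)

locale field_absolute_value = Qbar_subfield K for K +
  fixes a :: "qbar \<Rightarrow> real"
  assumes av: "absolute_value K a"
begin

lemma nonneg: "x \<in> K \<Longrightarrow> 0 \<le> a x"
  and eq_0_iff: "x \<in> K \<Longrightarrow> a x = 0 \<longleftrightarrow> x = 0"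
  and mult: "x \<in> K \<Longrightarrow> y \<in> K \<Longrightarrow> a (x * y) = a x * a y"
  and triangle: "x \<in> K \<Longrightarrow> y \<in> K \<Longrightarrow> a (x + y) \<le> a x + a y"
  using av by (auto simp: absolute_value_def)

lemma zero [simp]: "a 0 = 0" by (simp add: eq_0_iff)

lemma pos: "x \<in> K \<Longrightarrow> x \<noteq> 0 \<Longrightarrow> 0 < a x"
  using nonneg[of x] eq_0_iff[of x] by linarith

lemma rat: "rat_absolute_value (\<lambda>q. a (of_rat q))"
  by unfold_locales (auto simp: nonneg eq_0_iff of_rat_mult mult of_rat_add triangle)

lemma one [simp]: "a 1 = 1"
  using mult[of 1 1] eq_0_iff[of 1] by simp

lemma minus [simp]: "x \<in> K \<Longrightarrow> a (- x) = a x"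
proof -
  assume x: "x \<in> K"
  have "a (-1) * a (-1) = 1" using mult[of "-1" "-1"] by simp
  hence "a (-1) = 1" using nonneg[of "-1"] by (simp add: square_eq_1_iff)
  thus ?thesis using mult[of "-1" x] x by simp
qed

lemma diff_le: "x \<in> K \<Longrightarrow> y \<in> K \<Longrightarrow> a (x - y) \<le> a x + a y"
  using triangle[of x "- y"] by simp

lemma power: "x \<in> K \<Longrightarrow> a (x ^ n) = a x ^ n"
  by (induction n) (auto simp: mult)

lemma inverse: "x \<in> K \<Longrightarrow> a (inverse x) = inverse (a x)"
  using mult[of x "inverse x"] by (cases "x = 0") (auto simp: eq_0_iff field_simps)

lemma sum_le: "(\<And>i. i \<in> I \<Longrightarrow> f i \<in> K) \<Longrightarrow> a (\<Sum>i\<in>I. f i) \<le> (\<Sum>i\<in>I. a (f i))"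
proof (induction I rule: infinite_finite_induct)
  case (insert x F)
  thus ?case using triangle[of "f x" "sum f F"] by (simp add: sum_closed)
qed auto

text \<open>The triangle inequality for the power follows by expanding \<open>(x + y)\<^sup>k\<close> binomially and letting
  \<open>k\<close> tend to infinity.\<close>

lemma powr_triangle:
  assumes s: "s > 0" and nat: "\<And>n::nat. a (of_nat n) \<le> real n powr s" and xy: "x \<in> K" "y \<in> K"
  shows "a (x + y) powr (1 / s) \<le> a x powr (1 / s) + a y powr (1 / s)"
proof (rule power_growth_le)
  define b where "b z = a z powr (1 / s)" for z
  have ab: "a z = b z powr s" if "z \<in> K" for z using s nonneg[OF that] by (simp add: b_def powr_powr)
  have b0: "b z \<ge> 0" for z by (simp add: b_def)
  fix k :: nat
  have "a (x + y) ^ k = a ((x + y) ^ k)" using xy by (simp add: power)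
  also have "\<dots> \<le> (\<Sum>i\<le>k. a (of_nat (k choose i) * x ^ i * y ^ (k - i)))"
    unfolding binomial_ring using xy by (intro sum_le) auto
  also have "\<dots> \<le> (\<Sum>i\<le>k. ((b x + b y) ^ k) powr s)"
  proof (rule sum_mono)
    fix i assume i: "i \<in> {..k}"
    have "a (of_nat (k choose i) * x ^ i * y ^ (k - i)) \<le> real (k choose i) powr s * a x ^ i * a y ^ (k - i)"
      using xy nonneg nat by (auto simp: mult power intro!: mult_right_mono)
    also have "\<dots> = (real (k choose i) * b x ^ i * b y ^ (k - i)) powr s"
      using b0 by (simp add: powr_mult ab[OF xy(1)] ab[OF xy(2)] power_powr_commute)
    \<comment> \<open>A single term of the expansion of \<open>(b x + b y) ^ k\<close> is at most
      the whole sum, as all terms are nonnegative.\<close>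
    also have "\<dots> \<le> ((b x + b y) ^ k) powr s"
    proof (rule powr_mono2)
      show "real (k choose i) * b x ^ i * b y ^ (k - i) \<le> (b x + b y) ^ k"
        unfolding binomial_ring using i b0
        by (intro member_le_sum[of i _ "\<lambda>i. real (k choose i) * b x ^ i * b y ^ (k - i)"]) auto
    qed (use s b0 in auto)
    finally show "a (of_nat (k choose i) * x ^ i * y ^ (k - i)) \<le> ((b x + b y) ^ k) powr s" .
  qed
  also have "\<dots> = (real k + 1) * ((b x + b y) ^ k) powr s" by simp
  \<comment> \<open>After taking the power \<open>1 / s\<close>, the number k + 1 of terms
    contributes only \<open>(k + 1) powr (1 / s)\<close>, which \<open>power_growth_le\<close>
    removes.\<close>
  finally have "(a (x + y) ^ k) powr (1 / s) \<le> ((real k + 1) * ((b x + b y) ^ k) powr s) powr (1 / s)"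
    using s xy nonneg by (intro powr_mono2) auto
  also have "\<dots> = (real k + 1) powr (1 / s) * (b x + b y) ^ k"
    using s b0 by (simp add: powr_mult powr_powr)
  also have "(a (x + y) ^ k) powr (1 / s) = b (x + y) ^ k"
    using nonneg[of "x + y"] xy by (simp add: b_def power_powr_commute)
  finally show "(a (x + y) powr (1 / s)) ^ k \<le>
      1 * (real k + 1) powr (1 / s) * (a x powr (1 / s) + a y powr (1 / s)) ^ k"
    by (simp add: b_def)
qed auto

lemma absolute_value_powr:
  assumes s: "s > 0" and nat: "\<And>n::nat. a (of_nat n) \<le> real n powr s"
  shows "absolute_value K (\<lambda>x\<in>K. a x powr (1 / s))"
  using powr_triangle[OF assms]
  by (auto simp: absolute_value_def mult powr_mult eq_0_iff)

end

section \<open>Normalised members of places\<close>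

text \<open>Every place contains exactly one normalised absolute value, namely its \<open>place_norm\<close>.\<close>

definition normalized_avs :: "qbar set \<Rightarrow> (qbar \<Rightarrow> real) set" where
  "normalized_avs K = {a. absolute_value K a \<and> (\<lambda>q. a (of_rat q)) \<in> usual_rat_abs}"

lemma absolute_value_restrict:
  assumes "absolute_value L a" "K \<subseteq> L" "Qbar_subfield K"
  shows "absolute_value K (restrict a K)"
proof -
  interpret Qbar_subfield K by fact
  show ?thesis using assms(1,2) unfolding absolute_value_def by (auto simp: subset_iff)
qed

lemma normalized_avs_restrict:
  assumes "a \<in> normalized_avs L" "K \<subseteq> L" "Qbar_subfield K"
  shows "restrict a K \<in> normalized_avs K"
proof -
  interpret Qbar_subfield K by fact
  show ?thesis using assms absolute_value_restrict by (auto simp: normalized_avs_def)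
qed

text \<open>An absolute value trivial on \<open>\<rat>\<close> is bounded on the finite-dimensional space \<open>K\<close>, in
  particular on the powers of each element.\<close>

lemma trivial_on_Rats:
  assumes K: "number_field K" and av: "absolute_value K a" and triv: "\<And>q. q \<noteq> 0 \<Longrightarrow> a (of_rat q) = 1"
    and x: "x \<in> K" "x \<noteq> 0"
  shows "a x = 1"
proof -
  interpret field_absolute_value K a
    using number_fieldD[OF K] av by (simp add: field_absolute_value_def field_absolute_value_axioms_def)
  obtain Us where Us: "K = Qbar.Span \<rat> Us" "set Us \<subseteq> K"
    using number_field_Span[OF K] Qbar.Span_base_incl[OF subfield_Rats] by (metis ring_of_type_algebra_simps(1) subset_UNIV)
  have bound: "y \<in> Qbar.Span \<rat> Vs \<Longrightarrow> set Vs \<subseteq> K \<Longrightarrow> a y \<le> (\<Sum>v\<leftarrow>Vs. a v) \<and> y \<in> K" for y Vs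
  proof (induction Vs arbitrary: y)
    case (Cons v Vs)
    then obtain q z where qz: "y = of_rat q * v + z" "z \<in> Qbar.Span \<rat> Vs"
      by (auto simp: Qbar.line_extension_mem_iff elim!: Rats_cases)
    from Cons.IH[OF qz(2)] Cons.prems have z: "a z \<le> (\<Sum>v\<leftarrow>Vs. a v)" "z \<in> K" by auto
    have "a (of_rat q) \<le> 1" using triv[of q] by (cases "q = 0") auto
    hence "a (of_rat q * v) \<le> a v" using Cons.prems nonneg[of v] nonneg[of "of_rat q"]
      by (auto simp: mult intro: mult_left_le_one_le)
    thus ?case using qz z Cons.prems triangle[of "of_rat q * v" z] by auto
  qed auto
  define C where "C = (\<Sum>v\<leftarrow>Us. a v)"
  have le1: "a y \<le> 1" if y: "y \<in> K" for y
  proof (rule power_growth_le)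
    fix k :: nat
    have "a (y ^ k) \<le> C" unfolding C_def using bound[of "y ^ k" Us] Us power_closed[OF y, of k] by metis
    thus "a y ^ k \<le> C * (real k + 1) powr 0 * 1 ^ k" using y by (simp add: power)
  qed (use y nonneg in auto)
  \<comment> \<open>The bound for the inverse of x gives the reverse inequality.\<close>
  have "inverse (a x) \<le> 1" using le1[of "inverse x"] x by (simp add: inverse)
  moreover have "a x > 0" using x by (rule pos)
  ultimately show ?thesis using le1[OF x(1)] by (simp add: field_simps)
qed

text \<open>\<open>trivial_on_Rats\<close> shows that nontriviality on K is already visible on
  \<rat>, so Ostrowski's theorem applies to the restriction.\<close>

lemma nontrivial_av_powr:
  assumes K: "number_field K" and a: "nontrivial_av K a"
  obtains u s where "u \<in> usual_rat_abs" "s > 0" "\<And>q. a (of_rat q) = u q powr s"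
proof -
  interpret field_absolute_value K a
    using number_fieldD[OF K] a
    by (simp add: field_absolute_value_def field_absolute_value_axioms_def nontrivial_av_def)
  interpret r: rat_absolute_value "\<lambda>q. a (of_rat q)" by (rule rat)
  have "\<exists>q. q \<noteq> 0 \<and> a (of_rat q) \<noteq> 1"
    using trivial_on_Rats[OF K av] a unfolding nontrivial_av_def by blast
  from r.ostrowski[OF this] that show ?thesis by blast
qed

lemma equiv_av_equiv: "equiv {a. nontrivial_av K a} (av_equiv K)"
proof (rule equivI)
  show "av_equiv K \<subseteq> {a. nontrivial_av K a} \<times> {a. nontrivial_av K a}" by (auto simp: av_equiv_def)
  show "refl_on {a. nontrivial_av K a} (av_equiv K)"
  proof (rule refl_onI)
    fix a assume "a \<in> {a. nontrivial_av K a}"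
    thus "(a, a) \<in> av_equiv K"
      by (auto simp: av_equiv_def nontrivial_av_def absolute_value_def intro!: exI[of _ 1])
  qed
  show "sym (av_equiv K)"
  proof (rule symI)
    fix a b assume "(a, b) \<in> av_equiv K"
    then obtain s where s: "nontrivial_av K a" "nontrivial_av K b" "s > 0" "\<forall>x\<in>K. b x = a x powr s"
      by (auto simp: av_equiv_def)
    hence "\<forall>x\<in>K. a x = b x powr (1 / s)"
      by (auto simp: powr_powr nontrivial_av_def absolute_value_def)
    with s show "(b, a) \<in> av_equiv K" by (auto simp: av_equiv_def intro!: exI[of _ "1 / s"])
  qed
  show "trans (av_equiv K)"
  proof (rule transI)
    fix a b c assume "(a, b) \<in> av_equiv K" "(b, c) \<in> av_equiv K"
    then obtain s t where "nontrivial_av K a" "nontrivial_av K c" "s > 0" "\<forall>x\<in>K. b x = a x powr s"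
      "t > 0" "\<forall>x\<in>K. c x = b x powr t"
      by (auto simp: av_equiv_def)
    thus "(a, c) \<in> av_equiv K" by (auto simp: av_equiv_def powr_powr intro!: exI[of _ "s * t"])
  qed
qed

definition place_of :: "qbar set \<Rightarrow> (qbar \<Rightarrow> real) \<Rightarrow> place" where
  "place_of K a = av_equiv K `` {a}"

lemma normalized_avs_nontrivial:
  assumes "Qbar_subfield K" "a \<in> normalized_avs K"
  shows "nontrivial_av K a"
proof -
  interpret Qbar_subfield K by fact
  obtain x where "x \<noteq> 0" "a (of_rat x) \<noteq> 1"
    using usual_rat_abs_nontrivial assms(2) by (auto simp: normalized_avs_def)
  thus ?thesis using assms(2) by (auto simp: nontrivial_av_def normalized_avs_def intro!: bexI[of _ "of_rat x"])
qed

text \<open>Equivalent absolute values differ by an exponent; restricted to \<rat> both are usual,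
  so \<open>usual_rat_abs_powr_eq\<close> forces the exponent 1.\<close>

lemma normalized_avs_equiv_eq:
  assumes "Qbar_subfield K" "a \<in> normalized_avs K" "b \<in> normalized_avs K" "(a, b) \<in> av_equiv K"
  shows "a = b"
proof -
  interpret Qbar_subfield K by fact
  obtain s where s: "s > 0" "\<forall>x\<in>K. b x = a x powr s" using assms(4) by (auto simp: av_equiv_def)
  have "s = 1"
    by (rule usual_rat_abs_powr_eq[of "\<lambda>q. a (of_rat q)" "\<lambda>q. b (of_rat q)"])
      (use assms s in \<open>auto simp: normalized_avs_def\<close>)
  thus ?thesis using s assms(2,3)
    by (intro extensionalityI[of a K b]) (auto simp: normalized_avs_def absolute_value_def)
qed

lemma place_norm_place_of:
  assumes K: "Qbar_subfield K" and a: "a \<in> normalized_avs K"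
  shows "place_norm (place_of K a) = a"
proof -
  have "(a, a) \<in> av_equiv K" using equiv_av_equiv[of K] normalized_avs_nontrivial[OF assms]
    by (auto simp: equiv_def refl_on_def)
  show ?thesis unfolding place_norm_def
  proof (rule the_equality)
    show "a \<in> place_of K a \<and> (\<lambda>q. a (of_rat q)) \<in> usual_rat_abs"
      using \<open>(a, a) \<in> _\<close> a by (auto simp: place_of_def normalized_avs_def)
    fix b assume b: "b \<in> place_of K a \<and> (\<lambda>q. b (of_rat q)) \<in> usual_rat_abs"
    hence "(a, b) \<in> av_equiv K" by (auto simp: place_of_def)
    moreover from this b have "b \<in> normalized_avs K"
      by (auto simp: normalized_avs_def av_equiv_def nontrivial_av_def)
    ultimately show "b = a" using normalized_avs_equiv_eq[OF K a] by blast
  qed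
qed

lemma place_of_in_places:
  assumes "Qbar_subfield K" "a \<in> normalized_avs K"
  shows "place_of K a \<in> places K"
  using normalized_avs_nontrivial[OF assms] unfolding places_def place_of_def by (auto intro: quotientI)

text \<open>A member a of the place agrees on \<rat> with \<open>u powr s\<close> for a usual u, so
  its power with exponent \<open>1 / s\<close> restricts to u. The bound \<open>u n \<le> n\<close>
  is what makes this power satisfy the triangle inequality, for any s > 0.\<close>

lemma place_norm_normalized:
  assumes K: "number_field K" and v: "v \<in> places K"
  shows "place_norm v \<in> normalized_avs K" "place_of K (place_norm v) = v"
proof -
  note K' = number_fieldD[OF K]
  obtain a where a: "nontrivial_av K a" "v = place_of K a"
    using v by (auto simp: places_def place_of_def elim: quotientE)
  interpret field_absolute_value K a
    using K' a by (simp add: field_absolute_value_def field_absolute_value_axioms_def nontrivial_av_def)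
  obtain u s where u: "u \<in> usual_rat_abs" "s > 0" "\<And>q. a (of_rat q) = u q powr s"
    using nontrivial_av_powr[OF K a(1)] by blast
  interpret u: rat_absolute_value u by (rule rat_absolute_value_usual) fact
  define b where "b = (\<lambda>x\<in>K. a x powr (1 / s))"
  have "a (of_nat n) \<le> real n powr s" for n
    using u(3)[of "of_nat n"] usual_rat_abs_of_nat_le[OF u(1), of n] u.nonneg u(2)
    by (simp add: powr_mono2)
  from absolute_value_powr[OF u(2) this] have "absolute_value K b" by (simp add: b_def)
  moreover have "b (of_rat q) = u q" for q using u u.nonneg by (simp add: b_def powr_powr)
  ultimately have b: "b \<in> normalized_avs K" using u(1) by (simp add: normalized_avs_def)
  have "(a, b) \<in> av_equiv K"
    using a(1) normalized_avs_nontrivial[OF K' b] u(2)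
    by (auto simp: av_equiv_def b_def intro!: exI[of _ "1 / s"])
  hence "v = place_of K b" unfolding a place_of_def by (rule equiv_class_eq[OF equiv_av_equiv])
  thus "place_norm v \<in> normalized_avs K" "place_of K (place_norm v) = v"
    using b place_norm_place_of[OF K' b] by auto
qed

text \<open>\<open>place_restrict\<close> is a union over all members of the place. Their
  restrictions are related by the same exponents, and they stay nontrivial because the normalised
  member is nontrivial on K, so all contribute one class.\<close>

lemma place_restrict_place_of:
  assumes K: "Qbar_subfield K" and L: "Qbar_subfield L" and KL: "K \<subseteq> L" and a: "a \<in> normalized_avs L"
  shows "place_restrict K (place_of L a) = place_of K (restrict a K)"
proof -
  interpret Qbar_subfield K by fact
  interpret A: field_absolute_value L a
    using L a by (simp add: field_absolute_value_def field_absolute_value_axioms_def normalized_avs_def)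
  note aK = normalized_avs_restrict[OF a KL K]
  have *: "av_equiv K `` {restrict b K} = place_of K (restrict a K)" if ab: "(a, b) \<in> av_equiv L" for b
  proof -
    obtain s where s: "s > 0" "\<forall>x\<in>L. b x = a x powr s" "absolute_value L b"
      using ab by (auto simp: av_equiv_def nontrivial_av_def)
    obtain x where x: "x \<in> K" "x \<noteq> 0" "a x \<noteq> 1"
      using normalized_avs_nontrivial[OF K aK] by (auto simp: nontrivial_av_def)
    have "a x > 0" using A.pos[of x] x KL by auto
    hence "b x \<noteq> 1" using s x KL by (auto simp: powr_eq_one_iff_gen)
    hence "nontrivial_av K (restrict b K)"
      using absolute_value_restrict[OF s(3) KL K] x by (auto simp: nontrivial_av_def)
    hence "(restrict a K, restrict b K) \<in> av_equiv K"
      using normalized_avs_nontrivial[OF K aK] s KL by (auto simp: av_equiv_def)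
    thus ?thesis unfolding place_of_def by (intro equiv_class_eq[OF equiv_av_equiv, symmetric])
  qed
  have "(a, a) \<in> av_equiv L" using equiv_av_equiv[of L] normalized_avs_nontrivial[OF L a]
    by (auto simp: equiv_def refl_on_def)
  have "place_restrict K (place_of L a) = (\<Union>b\<in>{b. (a, b) \<in> av_equiv L}. av_equiv K `` {restrict b K})"
    by (auto simp: place_restrict_def place_of_def)
  also have "\<dots> = place_of K (restrict a K)" using * \<open>(a, a) \<in> _\<close> by blast
  finally show ?thesis .
qed

lemma place_restrict_norm:
  assumes K: "number_field K" and L: "number_field L" and KL: "K \<subseteq> L" and w: "w \<in> places L"
  shows "place_restrict K w \<in> places K" "place_norm (place_restrict K w) = restrict (place_norm w) K"
proof -
  note K' = number_fieldD[OF K] and L' = number_fieldD[OF L]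
  note w' = place_norm_normalized[OF L w]
  note r = normalized_avs_restrict[OF w'(1) KL K']
  have "place_restrict K w = place_of K (restrict (place_norm w) K)"
    using place_restrict_place_of[OF K' L' KL w'(1)] w'(2) by simp
  thus "place_restrict K w \<in> places K" "place_norm (place_restrict K w) = restrict (place_norm w) K"
    using place_of_in_places[OF K' r] place_norm_place_of[OF K' r] by auto
qed

lemma place_eqI:
  assumes "number_field K" "v \<in> places K" "w \<in> places K" "\<And>x. x \<in> K \<Longrightarrow> place_norm v x = place_norm w x"
  shows "v = w"
proof -
  have "place_norm v = place_norm w"
    using place_norm_normalized(1)[OF assms(1,2)] place_norm_normalized(1)[OF assms(1,3)] assms(4)
    by (intro extensionalityI[of _ K]) (auto simp: normalized_avs_def absolute_value_def)
  thus ?thesis using place_norm_normalized(2)[OF assms(1,2)] place_norm_normalized(2)[OF assms(1,3)] by metis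
qed

section \<open>Completions\<close>

context field_absolute_value
begin

definition cauchy :: "(nat \<Rightarrow> qbar) \<Rightarrow> bool" where
  "cauchy s \<longleftrightarrow> range s \<subseteq> K \<and> (\<forall>\<epsilon>>0. \<exists>N. \<forall>m\<ge>N. \<forall>n\<ge>N. a (s m - s n) < \<epsilon>)"

definition null :: "(nat \<Rightarrow> qbar) \<Rightarrow> bool" where
  "null s \<longleftrightarrow> range s \<subseteq> K \<and> (\<lambda>n. a (s n)) \<longlonglongrightarrow> 0"

lemma cauchy_in [simp]: "cauchy s \<Longrightarrow> s n \<in> K" and null_in [simp]: "null s \<Longrightarrow> s n \<in> K"
  by (auto simp: cauchy_def null_def)

lemma cauchyD:
  assumes "cauchy s" "\<epsilon> > 0"
  obtains N where "\<And>m n. m \<ge> N \<Longrightarrow> n \<ge> N \<Longrightarrow> a (s m - s n) < \<epsilon>"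
proof -
  have "\<exists>N. \<forall>m\<ge>N. \<forall>n\<ge>N. a (s m - s n) < \<epsilon>" using assms by (simp add: cauchy_def)
  thus ?thesis using that by metis
qed

lemma nullD:
  assumes "null s" "\<epsilon> > 0"
  obtains N where "\<And>n. n \<ge> N \<Longrightarrow> a (s n) < \<epsilon>"
proof -
  have "eventually (\<lambda>n. a (s n) < \<epsilon>) sequentially"
    using assms by (intro order_tendstoD(2)[of _ 0]) (auto simp: null_def)
  thus ?thesis using that by (auto simp: eventually_sequentially)
qed

lemma nullI_le:
  assumes "\<And>n. s n \<in> K" "\<And>n. a (s n) \<le> f n" "f \<longlonglongrightarrow> 0"
  shows "null s"
  unfolding null_def using assms nonneg
  by (auto intro!: tendsto_sandwich[of "\<lambda>_. 0" "\<lambda>n. a (s n)" sequentially f 0])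

lemma cauchy_bounded:
  assumes "cauchy s"
  obtains B where "B > 0" "\<And>n. a (s n) \<le> B"
proof -
  obtain N where N: "\<And>m n. m \<ge> N \<Longrightarrow> n \<ge> N \<Longrightarrow> a (s m - s n) < 1"
    using cauchyD[OF assms, of 1] by auto
  define B where "B = (\<Sum>i\<le>N. a (s i)) + 1"
  have pos: "0 \<le> a (s i)" for i using assms nonneg by simp
  have le: "a (s i) \<le> (\<Sum>i\<le>N. a (s i))" if "i \<le> N" for i
    using that pos by (intro member_le_sum) auto
  show ?thesis
  proof
    show "B > 0" using pos by (auto simp: B_def intro!: add_nonneg_pos sum_nonneg)
    fix n show "a (s n) \<le> B"
    proof (cases "n \<le> N")
      case False
      have "a (s N + (s n - s N)) \<le> a (s N) + a (s n - s N)" using assms by (intro triangle) auto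
      thus ?thesis using N[of n N] False le[of N] by (simp add: B_def)
    qed (use le in \<open>fastforce simp: B_def\<close>)
  qed
qed

lemma cauchy_const [simp]: "x \<in> K \<Longrightarrow> cauchy (\<lambda>_. x)"
  by (auto simp: cauchy_def)

lemma null_0 [simp]: "null (\<lambda>_. 0)"
  by (auto simp: null_def)

lemma cauchy_add: assumes s: "cauchy s" and t: "cauchy t" shows "cauchy (\<lambda>n. s n + t n)"
  unfolding cauchy_def
proof (intro conjI allI impI)
  show "range (\<lambda>n. s n + t n) \<subseteq> K" using assms by auto
  fix \<epsilon> :: real assume "\<epsilon> > 0"
  obtain N1 where N1: "\<And>m n. m \<ge> N1 \<Longrightarrow> n \<ge> N1 \<Longrightarrow> a (s m - s n) < \<epsilon> / 2"
    using cauchyD[OF s, of "\<epsilon> / 2"] \<open>\<epsilon> > 0\<close> by auto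
  obtain N2 where N2: "\<And>m n. m \<ge> N2 \<Longrightarrow> n \<ge> N2 \<Longrightarrow> a (t m - t n) < \<epsilon> / 2"
    using cauchyD[OF t, of "\<epsilon> / 2"] \<open>\<epsilon> > 0\<close> by auto
  show "\<exists>N. \<forall>m\<ge>N. \<forall>n\<ge>N. a (s m + t m - (s n + t n)) < \<epsilon>"
  proof (intro exI allI impI)
    fix m n assume "m \<ge> max N1 N2" "n \<ge> max N1 N2"
    hence "a (s m - s n) + a (t m - t n) < \<epsilon>" using N1[of m n] N2[of m n] by simp
    moreover have "a (s m - s n + (t m - t n)) \<le> a (s m - s n) + a (t m - t n)"
      using s t by (intro triangle) auto
    ultimately show "a (s m + t m - (s n + t n)) < \<epsilon>" by (simp add: algebra_simps)
  qed
qed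

lemma cauchy_mult: assumes s: "cauchy s" and t: "cauchy t" shows "cauchy (\<lambda>n. s n * t n)"
  unfolding cauchy_def
proof (intro conjI allI impI)
  show "range (\<lambda>n. s n * t n) \<subseteq> K" using assms by auto
  fix \<epsilon> :: real assume \<epsilon>: "\<epsilon> > 0"
  obtain B where B: "B > 0" "\<And>n. a (s n) \<le> B" using cauchy_bounded[OF s] by blast
  obtain C where C: "C > 0" "\<And>n. a (t n) \<le> C" using cauchy_bounded[OF t] by blast
  obtain N1 where N1: "\<And>m n. m \<ge> N1 \<Longrightarrow> n \<ge> N1 \<Longrightarrow> a (s m - s n) < \<epsilon> / (2 * C)"
    using cauchyD[OF s, of "\<epsilon> / (2 * C)"] \<epsilon> C by auto
  obtain N2 where N2: "\<And>m n. m \<ge> N2 \<Longrightarrow> n \<ge> N2 \<Longrightarrow> a (t m - t n) < \<epsilon> / (2 * B)"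
    using cauchyD[OF t, of "\<epsilon> / (2 * B)"] \<epsilon> B by auto
  show "\<exists>N. \<forall>m\<ge>N. \<forall>n\<ge>N. a (s m * t m - s n * t n) < \<epsilon>"
  proof (intro exI allI impI)
    fix m n assume mn: "m \<ge> max N1 N2" "n \<ge> max N1 N2"
    have "s m * t m - s n * t n = s m * (t m - t n) + (s m - s n) * t n" by (simp add: algebra_simps)
    hence "a (s m * t m - s n * t n) \<le> a (s m * (t m - t n)) + a ((s m - s n) * t n)"
      using s t triangle[of "s m * (t m - t n)" "(s m - s n) * t n"] by simp
    also have "\<dots> = a (s m) * a (t m - t n) + a (s m - s n) * a (t n)" using s t by (simp add: mult)
    also have "\<dots> \<le> B * a (t m - t n) + a (s m - s n) * C"
      using B C s t nonneg by (intro add_mono mult_mono) auto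
    also have "\<dots> < B * (\<epsilon> / (2 * B)) + \<epsilon> / (2 * C) * C"
      using N1[of m n] N2[of m n] mn B C by (intro add_strict_mono mult_strict_left_mono mult_strict_right_mono) auto
    also have "\<dots> = \<epsilon>" using B C by simp
    finally show "a (s m * t m - s n * t n) < \<epsilon>" .
  qed
qed

lemma cauchy_minus: "cauchy s \<Longrightarrow> cauchy (\<lambda>n. - s n)"
  using cauchy_mult[of "\<lambda>_. - 1" s] by simp

lemma null_cauchy: assumes "null s" shows "cauchy s"
  unfolding cauchy_def
proof (intro conjI allI impI)
  show "range s \<subseteq> K" using assms by (auto simp: null_def)
  fix \<epsilon> :: real assume "\<epsilon> > 0"
  then obtain N where N: "\<And>n. n \<ge> N \<Longrightarrow> a (s n) < \<epsilon> / 2" using nullD[OF assms, of "\<epsilon> / 2"] by auto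
  show "\<exists>N. \<forall>m\<ge>N. \<forall>n\<ge>N. a (s m - s n) < \<epsilon>"
  proof (intro exI allI impI)
    fix m n assume "m \<ge> N" "n \<ge> N"
    thus "a (s m - s n) < \<epsilon>" using N[of m] N[of n] diff_le[of "s m" "s n"] assms by simp
  qed
qed

lemma null_add: assumes "null s" "null t" shows "null (\<lambda>n. s n + t n)"
proof (rule nullI_le)
  show "(\<lambda>n. a (s n) + a (t n)) \<longlonglongrightarrow> 0"
    using tendsto_add[of "\<lambda>n. a (s n)" 0 sequentially "\<lambda>n. a (t n)" 0] assms by (simp add: null_def)
qed (use assms triangle in auto)

lemma null_mult: assumes s: "cauchy s" and t: "null t" shows "null (\<lambda>n. s n * t n)"
proof -
  obtain B where B: "B > 0" "\<And>n. a (s n) \<le> B" using cauchy_bounded[OF s] by blast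
  show ?thesis
  proof (rule nullI_le)
    show "(\<lambda>n. B * a (t n)) \<longlonglongrightarrow> 0"
      using tendsto_mult_left[of "\<lambda>n. a (t n)" 0 sequentially B] t by (simp add: null_def)
    show "a (s n * t n) \<le> B * a (t n)" for n
      using s t B nonneg by (simp add: mult mult_right_mono)
  qed (use s t in auto)
qed

lemma null_mult_right: "null s \<Longrightarrow> cauchy t \<Longrightarrow> null (\<lambda>n. s n * t n)"
  using null_mult[of t s] by (simp add: mult.commute)

lemma null_minus: "null s \<Longrightarrow> null (\<lambda>n. - s n)"
  using null_mult[of "\<lambda>_. - 1" s] by simp

lemma cauchy_null_cong:
  assumes "cauchy s" "null (\<lambda>n. t n - s n)"
  shows "cauchy t"
  using cauchy_add[OF assms(1) null_cauchy[OF assms(2)]] by simp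

text \<open>A Cauchy sequence that is not null stays away from 0 from some index on. Earlier terms
  may be 0, and \<open>inverse 0 = 0\<close> there, so the product with the inverse sequence is 1
  only up to a null sequence.\<close>

lemma cauchy_inverse:
  assumes s: "cauchy s" and "\<not> null s"
  shows "cauchy (\<lambda>n. inverse (s n))" "null (\<lambda>n. s n * inverse (s n) - 1)"
proof -
  obtain \<delta> where \<delta>: "\<delta> > 0" "\<And>N. \<exists>n\<ge>N. a (s n) \<ge> \<delta>"
  proof -
    have "\<not> (\<lambda>n. a (s n)) \<longlonglongrightarrow> 0" using assms by (auto simp: null_def cauchy_def)
    then obtain r where "r > 0" "\<And>N. \<exists>n\<ge>N. \<not> norm (a (s n) - 0) < r"
      unfolding LIMSEQ_iff by blast
    thus ?thesis using that[of r] s nonneg by (simp add: not_less)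
  qed
  obtain N where N: "\<And>m n. m \<ge> N \<Longrightarrow> n \<ge> N \<Longrightarrow> a (s m - s n) < \<delta> / 2"
    using cauchyD[OF s, of "\<delta> / 2"] \<delta> by auto
  obtain k where k: "k \<ge> N" "a (s k) \<ge> \<delta>" using \<delta>(2) by blast
  have ge: "a (s n) \<ge> \<delta> / 2" if "n \<ge> N" for n
  proof -
    have "a (s n + (s k - s n)) \<le> a (s n) + a (s k - s n)" using s by (intro triangle) auto
    thus ?thesis using N[OF k(1) that] k(2) by simp
  qed
  hence nz: "s n \<noteq> 0" if "n \<ge> N" for n using that[THEN ge] \<delta> by auto
  show "null (\<lambda>n. s n * inverse (s n) - 1)"
    unfolding null_def
  proof
    show "(\<lambda>n. a (s n * inverse (s n) - 1)) \<longlonglongrightarrow> 0"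
      by (rule tendsto_eventually) (use nz in \<open>auto simp: eventually_sequentially intro!: exI[of _ N]\<close>)
  qed (use s in auto)
  show "cauchy (\<lambda>n. inverse (s n))"
    unfolding cauchy_def
  proof (intro conjI allI impI)
    show "range (\<lambda>n. inverse (s n)) \<subseteq> K" using s by auto
    fix \<epsilon> :: real assume \<epsilon>: "\<epsilon> > 0"
    obtain M where M: "\<And>m n. m \<ge> M \<Longrightarrow> n \<ge> M \<Longrightarrow> a (s m - s n) < \<epsilon> * (\<delta> / 2) ^ 2"
      using cauchyD[OF s, of "\<epsilon> * (\<delta> / 2) ^ 2"] \<epsilon> \<delta> by auto
    show "\<exists>N. \<forall>m\<ge>N. \<forall>n\<ge>N. a (inverse (s m) - inverse (s n)) < \<epsilon>"
    proof (intro exI allI impI)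
      fix m n assume mn: "m \<ge> max M N" "n \<ge> max M N"
      have "(inverse (s m) - inverse (s n)) * (s m * s n) = s n - s m"
        using nz[of m] nz[of n] mn by (simp add: field_simps)
      hence "a (inverse (s m) - inverse (s n)) * (a (s m) * a (s n)) = a (s n - s m)"
        using s mult[of "inverse (s m) - inverse (s n)" "s m * s n"] by (simp add: mult)
      also have "\<dots> < \<epsilon> * (\<delta> / 2) ^ 2" using M mn by simp
      also have "\<dots> \<le> \<epsilon> * (a (s m) * a (s n))"
        unfolding power2_eq_square using \<epsilon> \<delta> ge[of m] ge[of n] mn by (intro mult_left_mono mult_mono) auto
      finally show "a (inverse (s m) - inverse (s n)) < \<epsilon>"
        using nz[of m] nz[of n] mn s by (subst (asm) mult_less_cancel_right) (auto simp: pos less_imp_le not_less)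
    qed
  qed
qed

abbreviation "C \<equiv> cauchy_ring K a"
abbreviation "N \<equiv> null_sequences K a"

lemma C_simps [simp]:
  "s \<in> carrier C \<longleftrightarrow> cauchy s" "s \<otimes>\<^bsub>C\<^esub> t = (\<lambda>n. s n * t n)" "s \<oplus>\<^bsub>C\<^esub> t = (\<lambda>n. s n + t n)"
  "\<one>\<^bsub>C\<^esub> = (\<lambda>_. 1)" "\<zero>\<^bsub>C\<^esub> = (\<lambda>_. 0)"
  by (simp_all add: cauchy_ring_def cauchy_def)

lemma N_iff: "s \<in> N \<longleftrightarrow> null s"
  by (simp add: null_sequences_def null_def)

lemma cring_C: "cring C"
proof (rule cringI)
  show "abelian_group C"
  proof (rule abelian_groupI)
    fix s assume "s \<in> carrier C"
    thus "\<exists>t\<in>carrier C. t \<oplus>\<^bsub>C\<^esub> s = \<zero>\<^bsub>C\<^esub>"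
      by (intro bexI[of _ "\<lambda>n. - s n"]) (auto simp: cauchy_minus)
  qed (auto simp: cauchy_add algebra_simps)
  show "Group.comm_monoid C"
    by (rule comm_monoidI) (auto simp: cauchy_mult algebra_simps)
qed (auto simp: algebra_simps)

sublocale C: cring C by (rule cring_C)

lemma C_a_inv: "cauchy s \<Longrightarrow> \<ominus>\<^bsub>C\<^esub> s = (\<lambda>n. - s n)"
  by (rule C.minus_equality) (auto simp: cauchy_minus)

lemma ideal_N: "ideal N C"
proof (rule idealI[OF C.ring_axioms])
  show "subgroup N (add_monoid C)"
  proof (rule subgroup.intro)
    fix s assume s: "s \<in> N"
    hence "inv\<^bsub>add_monoid C\<^esub> s = (\<lambda>n. - s n)"
      using C_a_inv[OF null_cauchy] by (simp add: a_inv_def N_iff)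
    thus "inv\<^bsub>add_monoid C\<^esub> s \<in> N" using s by (simp add: N_iff null_minus)
  qed (auto simp: N_iff null_cauchy null_add)
qed (auto simp: N_iff null_mult null_mult_right)

end

section \<open>The completion: field structure and finite dimension\<close>

context field_absolute_value
begin

lemma Span_Rats_subset: "set Us \<subseteq> K \<Longrightarrow> Qbar.Span \<rat> Us \<subseteq> K"
proof (induction Us)
  case (Cons u Us)
  thus ?case using Rats_subset by (auto simp: Qbar.line_extension_mem_iff subset_iff)
qed auto

abbreviation "R \<equiv> C Quot N"

lemma cring_R: "cring R"
  by (rule ideal.quotient_is_cring[OF ideal_N cring_C])

sublocale R: cring R by (rule cring_R)

definition proj :: "(nat \<Rightarrow> qbar) \<Rightarrow> (nat \<Rightarrow> qbar) set" where
  "proj s = N +>\<^bsub>C\<^esub> s"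

lemma ring_hom_proj: "ring_hom_ring C R proj"
  using ideal.rcos_ring_hom_ring[OF ideal_N] by (simp add: proj_def[abs_def])

sublocale proj: ring_hom_ring C R proj by (rule ring_hom_proj)

lemma carrier_R: "carrier R = proj ` {s. cauchy s}"
  by (auto simp: FactRing_def A_RCOSETS_def' proj_def)

lemma proj_closed [simp]: "cauchy s \<Longrightarrow> proj s \<in> carrier R"
  by (auto simp: carrier_R)

lemma proj_add: "cauchy s \<Longrightarrow> cauchy t \<Longrightarrow> proj (\<lambda>n. s n + t n) = proj s \<oplus>\<^bsub>R\<^esub> proj t"
  and proj_mult: "cauchy s \<Longrightarrow> cauchy t \<Longrightarrow> proj (\<lambda>n. s n * t n) = proj s \<otimes>\<^bsub>R\<^esub> proj t"
  and proj_one: "proj (\<lambda>_. 1) = \<one>\<^bsub>R\<^esub>" and proj_zero: "proj (\<lambda>_. 0) = \<zero>\<^bsub>R\<^esub>"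
  using proj.hom_add[of s t] proj.hom_mult[of s t] proj.hom_one proj.hom_zero by simp_all

lemma proj_minus: "cauchy s \<Longrightarrow> proj (\<lambda>n. - s n) = \<ominus>\<^bsub>R\<^esub> proj s"
  using proj.hom_a_inv[of s] by (simp add: C_a_inv)

lemma proj_eq_zero_iff: "cauchy s \<Longrightarrow> proj s = \<zero>\<^bsub>R\<^esub> \<longleftrightarrow> null s"
proof -
  assume s: "cauchy s"
  interpret N: ideal N C by (rule ideal_N)
  have z: "\<zero>\<^bsub>R\<^esub> = N" by (simp add: FactRing_def)
  have "s \<in> N" if "N +>\<^bsub>C\<^esub> s = N"
    by (rule C.a_coset_join1[OF that _ N.a_subgroup]) (simp add: s)
  thus ?thesis unfolding proj_def z using N.a_rcos_const[of s] N_iff[of s] by blast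
qed

lemma proj_eq_iff:
  assumes "cauchy s" "cauchy t"
  shows "proj s = proj t \<longleftrightarrow> null (\<lambda>n. s n - t n)"
proof -
  have d: "cauchy (\<lambda>n. s n + - t n)" using assms by (intro cauchy_add cauchy_minus)
  have "proj s = proj t \<longleftrightarrow> proj s \<oplus>\<^bsub>R\<^esub> (\<ominus>\<^bsub>R\<^esub> proj t) = \<zero>\<^bsub>R\<^esub>"
    using assms by (metis R.minus_eq R.r_right_minus_eq proj_closed)
  also have "\<dots> \<longleftrightarrow> proj (\<lambda>n. s n + - t n) = \<zero>\<^bsub>R\<^esub>"
    using assms by (subst proj_add) (auto simp: proj_minus cauchy_minus)
  also have "\<dots> \<longleftrightarrow> null (\<lambda>n. s n + - t n)" by (rule proj_eq_zero_iff[OF d])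
  finally show ?thesis by simp
qed

lemma proj_inverse:
  assumes "cauchy s" "\<not> null s"
  shows "proj s \<otimes>\<^bsub>R\<^esub> proj (\<lambda>n. inverse (s n)) = \<one>\<^bsub>R\<^esub>"
proof -
  note i = cauchy_inverse[OF assms]
  have "proj (\<lambda>n. s n * inverse (s n)) = proj (\<lambda>_. 1)"
    using assms i by (subst proj_eq_iff) (auto intro: cauchy_mult)
  thus ?thesis using assms i by (simp add: proj_mult proj_one)
qed

lemma zero_neq_one_R: "\<zero>\<^bsub>R\<^esub> \<noteq> \<one>\<^bsub>R\<^esub>"
  using proj_eq_zero_iff[of "\<lambda>_. 1"] by (auto simp: proj_one null_def LIMSEQ_const_iff)

lemma field_R: "field R"
proof (rule R.cring_fieldI2[OF zero_neq_one_R])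
  fix x assume "x \<in> carrier R" "x \<noteq> \<zero>\<^bsub>R\<^esub>"
  then obtain s where s: "cauchy s" "x = proj s" "\<not> null s" using proj_eq_zero_iff by (auto simp: carrier_R)
  show "\<exists>y\<in>carrier R. x \<otimes>\<^bsub>R\<^esub> y = \<one>\<^bsub>R\<^esub>"
    using proj_inverse[OF s(1,3)] cauchy_inverse[OF s(1,3)] s by auto
qed

text \<open>The copy of the completion of \<rat> inside the completion of K;
  \<open>rat_completion_eq\<close> identifies it with \<open>rat_completion\<close>.\<close>

definition rat_part :: "(nat \<Rightarrow> qbar) set set" where
  "rat_part = proj ` {s. cauchy s \<and> range s \<subseteq> \<rat>}"

lemma rat_partI: "cauchy s \<Longrightarrow> (\<And>n. s n \<in> \<rat>) \<Longrightarrow> proj s \<in> rat_part"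
  by (auto simp: rat_part_def)

lemma subfield_rat_part: "subfield rat_part R"
proof (rule field.subfieldI'[OF field_R])
  show "subring rat_part R"
  proof (rule R.subringI)
    show "rat_part \<subseteq> carrier R" by (auto simp: rat_part_def)
    show "\<one>\<^bsub>R\<^esub> \<in> rat_part" by (auto simp flip: proj_one intro!: rat_partI)
    show "\<ominus>\<^bsub>R\<^esub> x \<in> rat_part" if "x \<in> rat_part" for x
      using that by (auto simp: rat_part_def image_subset_iff simp flip: proj_minus intro!: rat_partI[unfolded rat_part_def] cauchy_minus)
    fix x y assume "x \<in> rat_part" "y \<in> rat_part"
    then obtain s t where st: "cauchy s" "cauchy t" "\<And>n. s n \<in> \<rat>" "\<And>n. t n \<in> \<rat>" "x = proj s" "y = proj t"
      by (auto simp: rat_part_def image_subset_iff)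
    show "x \<otimes>\<^bsub>R\<^esub> y \<in> rat_part" "x \<oplus>\<^bsub>R\<^esub> y \<in> rat_part"
      using st by (auto simp flip: proj_mult proj_add intro!: rat_partI cauchy_mult cauchy_add)
  qed
  fix x assume x: "x \<in> rat_part - {\<zero>\<^bsub>R\<^esub>}"
  then obtain s where s: "cauchy s" "\<And>n. s n \<in> \<rat>" "x = proj s" "\<not> null s"
    using proj_eq_zero_iff by (auto simp: rat_part_def image_subset_iff)
  have "inv\<^bsub>R\<^esub> x = proj (\<lambda>n. inverse (s n))"
    using proj_inverse[OF s(1,4)] s cauchy_inverse[OF s(1,4)] by (intro R.comm_inv_char) auto
  thus "inv\<^bsub>R\<^esub> x \<in> rat_part" using s cauchy_inverse[OF s(1,4)] by (auto intro!: rat_partI)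
qed

lemma Span_insert: "z \<in> R.Span rat_part us \<Longrightarrow> u \<in> carrier R \<Longrightarrow> set us \<subseteq> carrier R \<Longrightarrow> z \<in> R.Span rat_part (u # us)"
proof -
  assume z: "z \<in> R.Span rat_part us" "u \<in> carrier R" "set us \<subseteq> carrier R"
  have "z \<in> carrier R" using z R.Span_in_carrier[OF subfieldE(3)[OF subfield_rat_part] z(3)] by blast
  hence "z = \<zero>\<^bsub>R\<^esub> \<otimes>\<^bsub>R\<^esub> u \<oplus>\<^bsub>R\<^esub> z" using z by simp
  moreover have "\<zero>\<^bsub>R\<^esub> \<in> rat_part" by (auto simp flip: proj_zero intro!: rat_partI)
  ultimately show ?thesis using z(1) by (auto simp: R.line_extension_mem_iff)
qed

text \<open>In the induction step the element \<open>u\<close> has either positive distance from the span of the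
  remaining elements, and then the coefficients of \<open>u\<close> form a Cauchy sequence, or distance zero,
  and then \<open>u\<close> can be replaced by elements of that span up to a null sequence.\<close>

lemma proj_in_Span:
  assumes "set Us \<subseteq> K" "cauchy s" "\<And>n. s n \<in> Qbar.Span \<rat> Us"
  shows "proj s \<in> R.Span rat_part (map (\<lambda>u. proj (\<lambda>_. u)) Us)"
  using assms
proof (induction Us arbitrary: s)
  case Nil
  hence "s = (\<lambda>_. 0)" by auto
  thus ?case by (simp add: proj_zero)
next
  case (Cons u Us)
  let ?V = "Qbar.Span \<rat> Us" and ?W = "R.Span rat_part (map (\<lambda>u. proj (\<lambda>_. u)) Us)"
  have u: "u \<in> K" and Us: "set Us \<subseteq> K" using Cons.prems by auto
  have VK: "?V \<subseteq> K" by (rule Span_Rats_subset[OF Us])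
  have Vadd: "x + y \<in> ?V" "c \<in> \<rat> \<Longrightarrow> c * x \<in> ?V" if "x \<in> ?V" "y \<in> ?V" for x y c
    using that Qbar.Span_subgroup_props(3)[OF subfield_Rats, of Us x y]
      Qbar.Span_smult_closed[OF subfield_Rats, of Us c x] by simp_all
  have "\<exists>q\<in>\<rat>. \<exists>w\<in>?V. s n = q * u + w" for n
    using Cons.prems(3)[of n] by (auto simp: Qbar.line_extension_mem_iff)
  then obtain q w where q: "\<And>n. q n \<in> \<rat>" and w: "\<And>n. w n \<in> ?V" and s: "\<And>n. s n = q n * u + w n"
    by metis
  have qK: "q n \<in> K" and wK: "w n \<in> K" for n using q w Rats_subset VK by auto
  show ?case
  proof (cases "\<exists>\<delta>>0. \<forall>x\<in>?V. \<delta> \<le> a (u + x)")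
    case True
    then obtain \<delta> where \<delta>: "\<delta> > 0" "\<And>x. x \<in> ?V \<Longrightarrow> \<delta> \<le> a (u + x)" by blast
    \<comment> \<open>If c = q m - q n is nonzero, \<open>s m - s n\<close> is c times an element u
      + x with x in the span of the remaining elements, and such an element has value at least
      \<delta>.\<close>
    have le: "a (q m - q n) * \<delta> \<le> a (s m - s n)" for m n
    proof (cases "q m = q n")
      case True
      thus ?thesis using nonneg Cons.prems(2) by simp
    next
      case False
      define c where "c = q m - q n"
      have c: "c \<in> \<rat>" "c \<noteq> 0" "c \<in> K" using False q qK by (auto simp: c_def)
      have "inverse c * (w m + (- 1) * w n) \<in> ?V" using c w by (intro Vadd) auto
      from \<delta>(2)[OF this] have "a c * \<delta> \<le> a c * a (u + inverse c * (w m + (- 1) * w n))"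
        using c nonneg by (intro mult_left_mono) auto
      also have "\<dots> = a (c * (u + inverse c * (w m + (- 1) * w n)))"
        using c u wK by (simp add: mult)
      also have "c * (u + inverse c * (w m + (- 1) * w n)) = s m - s n"
      proof -
        have "c * (u + inverse c * (w m + (- 1) * w n)) = c * u + (w m - w n)"
          using c by (simp add: distrib_left mult.assoc[symmetric])
        also have "\<dots> = s m - s n" by (simp add: s c_def algebra_simps)
        finally show ?thesis .
      qed
      finally show ?thesis by (simp add: c_def)
    qed
    have cq: "cauchy q"
      unfolding cauchy_def
    proof (intro conjI allI impI)
      show "range q \<subseteq> K" using qK by auto
      fix \<epsilon> :: real assume "\<epsilon> > 0"
      then obtain N where N: "\<And>m n. m \<ge> N \<Longrightarrow> n \<ge> N \<Longrightarrow> a (s m - s n) < \<epsilon> * \<delta>"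
        using cauchyD[OF Cons.prems(2), of "\<epsilon> * \<delta>"] \<delta> by auto
      show "\<exists>N. \<forall>m\<ge>N. \<forall>n\<ge>N. a (q m - q n) < \<epsilon>"
      proof (intro exI allI impI)
        fix m n assume "m \<ge> N" "n \<ge> N"
        hence "a (q m - q n) * \<delta> < \<epsilon> * \<delta>" using N le by (meson le_less_trans)
        thus "a (q m - q n) < \<epsilon>" using \<delta> by simp
      qed
    qed
    have cqu: "cauchy (\<lambda>n. q n * u)" using cq u cauchy_mult[of q "\<lambda>_. u"] by simp
    have cw: "cauchy w"
      using cauchy_add[OF Cons.prems(2) cauchy_minus[OF cqu]] by (simp add: s)
    have "s = (\<lambda>n. q n * u + w n)" using s by auto
    hence "proj s = proj q \<otimes>\<^bsub>R\<^esub> proj (\<lambda>_. u) \<oplus>\<^bsub>R\<^esub> proj w"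
      using cqu cw cq u by (simp add: proj_add proj_mult)
    moreover have "proj w \<in> ?W" by (rule Cons.IH[OF Us cw w])
    ultimately show ?thesis using rat_partI[OF cq q] by (auto simp: R.line_extension_mem_iff)
  next
    case False
    have "\<exists>x\<in>?V. a (q n) * a (u + x) < inverse (real (Suc n))" for n
    proof -
      \<comment> \<open>The summand 1 keeps the denominator positive when
        \<open>q n = 0\<close>.\<close>
      define \<delta> where "\<delta> = inverse (real (Suc n)) / (a (q n) + 1)"
      have aq: "a (q n) \<ge> 0" using nonneg qK by simp
      hence "\<delta> > 0" by (simp add: \<delta>_def)
      with False obtain x where x: "x \<in> ?V" "a (u + x) < \<delta>" by (meson not_le)
      have "a (q n) * a (u + x) \<le> (a (q n) + 1) * a (u + x)"
        using x VK u nonneg by (intro mult_right_mono) auto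
      also have "\<dots> < (a (q n) + 1) * \<delta>" using x aq by (intro mult_strict_left_mono) auto
      also have "\<dots> = inverse (real (Suc n))" using aq by (simp add: \<delta>_def)
      finally show ?thesis using x by blast
    qed
    then obtain x where x: "\<And>n. x n \<in> ?V" "\<And>n. a (q n) * a (u + x n) < inverse (real (Suc n))"
      by metis
    \<comment> \<open>Replaces the multiple \<open>q n * u\<close> by \<open>- q n * x n\<close>,
      which lies in the smaller span; the difference \<open>q n * (u + x n)\<close> tends to 0 by
      the choice of x.\<close>
    define t where "t n = w n + (- q n) * x n" for n
    have tV: "t n \<in> ?V" for n unfolding t_def using x(1) w q by (intro Vadd) auto
    have xK: "x n \<in> K" for n using x VK by auto
    have st: "t n - s n = - (q n * (u + x n))" for n by (simp add: t_def s algebra_simps)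
    have "null (\<lambda>n. t n - s n)"
    proof (rule nullI_le)
      show "(\<lambda>n. inverse (real (Suc n))) \<longlonglongrightarrow> 0" by (rule LIMSEQ_inverse_real_of_nat)
      show "a (t n - s n) \<le> inverse (real (Suc n))" for n
        using x(2)[of n] qK u xK unfolding st by (simp add: mult)
      show "t n - s n \<in> K" for n using VK tV[of n] Cons.prems(2) by (intro diff_closed) auto
    qed
    moreover from this have ct: "cauchy t" by (rule cauchy_null_cong[OF Cons.prems(2)])
    ultimately have "proj t = proj s" using proj_eq_iff[OF ct Cons.prems(2)] by simp
    moreover have "proj t \<in> ?W" by (rule Cons.IH[OF Us ct tV])
    moreover have "set (map (\<lambda>u. proj (\<lambda>_. u)) Us) \<subseteq> carrier R" using Us by auto
    ultimately show ?thesis using Span_insert[of "proj s" "map (\<lambda>u. proj (\<lambda>_. u)) Us" "proj (\<lambda>_. u)"] u by simp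
  qed
qed

text \<open>Constant sequences formed from a spanning list of K over \<rat> span the completion over
  the copy of the completion of \<rat>. As \<open>dim\<close> is an actual dimension only for a
  finite-dimensional space, this gives \<open>local_degree\<close> its meaning.\<close>

lemma finite_dimension_R:
  assumes "number_field K"
  shows "R.finite_dimension rat_part (carrier R)"
proof -
  obtain Us where Us: "K = Qbar.Span \<rat> Us" "set Us \<subseteq> K"
    using number_field_Span[OF assms] Qbar.Span_base_incl[OF subfield_Rats] by (metis ring_of_type_algebra_simps(1) subset_UNIV)
  define us where "us = map (\<lambda>u. proj (\<lambda>_. u)) Us"
  have us: "set us \<subseteq> carrier R" using Us(2) by (auto simp: us_def)
  have "carrier R \<subseteq> R.Span rat_part us"
  proof
    fix x assume "x \<in> carrier R"
    then obtain s where s: "cauchy s" "x = proj s" by (auto simp: carrier_R)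
    have "s n \<in> Qbar.Span \<rat> Us" for n using cauchy_in[OF s(1), of n] Us(1) by metis
    thus "x \<in> R.Span rat_part us" unfolding us_def s(2) by (intro proj_in_Span Us s)
  qed
  hence "carrier R = R.Span rat_part us"
    using R.Span_in_carrier[OF subfieldE(3)[OF subfield_rat_part] us] by blast
  thus ?thesis using R.Span_finite_dimension[OF subfield_rat_part us] by simp
qed

end

section \<open>Local degrees\<close>

lemma field_absolute_value_place_norm:
  assumes "number_field K" "v \<in> places K"
  shows "field_absolute_value K (place_norm v)"
  using place_norm_normalized(1)[OF assms] number_fieldD[OF assms(1)]
  by (simp add: field_absolute_value_def field_absolute_value_axioms_def normalized_avs_def)

text \<open>Normalised absolute values restrict to normalised ones, so the Cauchy sequences of the
  place below v are exactly the rational Cauchy sequences for v.\<close>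

lemma rat_completion_eq:
  assumes K: "number_field K" and v: "v \<in> places K"
  shows "rat_completion K v = field_absolute_value.rat_part K (place_norm v)"
proof -
  interpret field_absolute_value K "place_norm v" by (rule field_absolute_value_place_norm) fact+
  have "place_norm (place_restrict \<rat> v) = restrict (place_norm v) \<rat>"
    by (rule place_restrict_norm[OF number_field_Rats K Rats_subset v])
  moreover have "carrier (cauchy_ring \<rat> (restrict (place_norm v) \<rat>)) = {s. cauchy s \<and> range s \<subseteq> \<rat>}"
  proof -
    have "range s \<subseteq> \<rat> \<Longrightarrow> s m - s n \<in> \<rat>" for s :: "nat \<Rightarrow> qbar" and m n by (auto intro!: Rats_diff)
    thus ?thesis using Rats_subset by (auto simp: cauchy_ring_def cauchy_def)
  qed
  ultimately show ?thesis
    by (simp add: rat_completion_def rat_part_def proj_def[abs_def])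
qed

lemma local_degree_dimension:
  assumes K: "number_field K" and v: "v \<in> places K"
  shows "ring.dimension (place_completion K v) (local_degree K v) (rat_completion K v)
    (carrier (place_completion K v))"
proof -
  interpret field_absolute_value K "place_norm v" by (rule field_absolute_value_place_norm) fact+
  have "place_completion K v = R" by (simp add: place_completion_def)
  thus ?thesis
    using R.finite_dimensionE[OF subfield_rat_part finite_dimension_R[OF K]]
    by (simp add: local_degree_def rat_completion_eq[OF K v] over_def)
qed

text \<open>The completion is a field, hence not the zero space. The positive measure of the fibres
  rests on this.\<close>

lemma local_degree_pos:
  assumes K: "number_field K" and v: "v \<in> places K"
  shows "local_degree K v > 0"
proof (rule ccontr)
  interpret field_absolute_value K "place_norm v" by (rule field_absolute_value_place_norm) fact+
  assume "\<not> local_degree K v > 0"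
  hence "R.dimension 0 rat_part (carrier R)"
    using local_degree_dimension[OF K v] by (simp add: place_completion_def rat_completion_eq[OF K v])
  hence "carrier R = {\<zero>\<^bsub>R\<^esub>}" by (rule R.dimension_zero[OF subfield_rat_part])
  thus False using zero_neq_one_R R.one_closed by (metis singletonD)
qed

lemma Qbar_hom_of_rat:
  assumes "Qbar_hom K (f :: qbar \<Rightarrow> 'b::field_char_0)"
  shows "f (of_rat q) = of_rat q"
proof -
  interpret Qbar_hom K f by fact
  obtain i j where "quotient_of q = (i, j)" by (metis surj_pair)
  hence q: "q = of_int i / of_int j" "j > 0" using quotient_of_div quotient_of_denom_pos by auto
  have "f (of_rat q * of_int j) = f (of_int i)" using q by (simp add: of_rat_divide)
  hence "f (of_rat q) * of_int j = of_int i" by (simp add: mult of_int)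
  moreover have "(of_rat q :: 'b) * of_int j = of_int i" using q by (simp add: of_rat_divide)
  ultimately have "f (of_rat q) * of_int j = of_rat q * of_int j" by simp
  thus ?thesis using q(2) by simp
qed

section \<open>Transport of places and degrees along an isomorphism\<close>

locale Qbar_iso = Qbar_hom L g for L and g :: "qbar \<Rightarrow> qbar" +
  fixes L' assumes image: "g ` L = L'"
begin

lemma closed: "x \<in> L \<Longrightarrow> g x \<in> L'"
  using image by auto

definition ginv :: "qbar \<Rightarrow> qbar" where "ginv = inv_into L g"

lemma ginv: "y \<in> L' \<Longrightarrow> ginv y \<in> L" "y \<in> L' \<Longrightarrow> g (ginv y) = y" "x \<in> L \<Longrightarrow> ginv (g x) = x"
  using image by (auto simp: ginv_def inv_into_into f_inv_into_f inv_into_f_f[OF inj])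

lemma rat_fixed: "x \<in> \<rat> \<Longrightarrow> g x = x"
  using Qbar_hom_of_rat[OF Qbar_hom_axioms] by (auto elim: Rats_cases)

lemma dimension_image:
  "Qbar.dimension n \<rat> E \<Longrightarrow> E \<subseteq> L \<Longrightarrow> Qbar.dimension n \<rat> (g ` E)"
proof (induction n "\<rat> :: qbar set" E rule: Qbar.dimension.induct)
  case zero_dim
  show ?case using Qbar.zero_dim[of "\<rat>"] by simp
next
  case (Suc_dim v E n)
  have zero: "0 \<in> E"
    using Qbar.space_subgroup_props(2)[OF subfield_Rats Suc_dim(3)] by simp
  have "x * v + e \<in> L" if "x \<in> \<rat>" "e \<in> E" for x e
    using that by (intro subsetD[OF Suc_dim.prems]) (auto simp: Qbar.line_extension_mem_iff)
  \<comment> \<open>The line extension contains \<open>1 * v + 0\<close> and every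
    \<open>0 * v + e\<close>.\<close>
  from this[of 1 0] this[of 0] zero have v: "v \<in> L" and E: "E \<subseteq> L" by auto
  have "g v \<notin> g ` E" using inj v E Suc_dim(2) by (auto dest: inj_onD)
  have hom: "g (x * v + e) = x * g v + g e" if "x \<in> \<rat>" "e \<in> E" for x e
    using that v E Rats_subset by (subst add) (auto simp: mult rat_fixed)
  have "Qbar.line_extension \<rat> (g v) (g ` E) = g ` Qbar.line_extension \<rat> v E"
  proof (intro Set.set_eqI iffI)
    fix y assume "y \<in> Qbar.line_extension \<rat> (g v) (g ` E)"
    then obtain x e where "x \<in> \<rat>" "e \<in> E" "y = g (x * v + e)"
      using hom by (auto simp: Qbar.line_extension_mem_iff)
    thus "y \<in> g ` Qbar.line_extension \<rat> v E"
      by (intro image_eqI[of _ _ "x * v + e"]) (auto simp: Qbar.line_extension_mem_iff)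
  next
    fix y assume "y \<in> g ` Qbar.line_extension \<rat> v E"
    then obtain x e where "x \<in> \<rat>" "e \<in> E" "y = g (x * v + e)"
      by (auto simp: Qbar.line_extension_mem_iff)
    thus "y \<in> Qbar.line_extension \<rat> (g v) (g ` E)"
      using hom by (auto simp: Qbar.line_extension_mem_iff)
  qed
  moreover from \<open>g v \<notin> g ` E\<close> have "Qbar.dimension (Suc n) \<rat> (Qbar.line_extension \<rat> (g v) (g ` E))"
    using Suc_dim E by (intro Qbar.Suc_dim) auto
  ultimately show ?case by simp
qed

lemma global_degree_eq:
  assumes "number_field L" "number_field L'"
  shows "global_degree L' = global_degree L"
proof -
  have "Qbar.dimension (global_degree L) \<rat> L"
    using Qbar.finite_dimensionE[OF subfield_Rats, of L] assms
    by (simp add: number_field_def global_degree_def over_def)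
  hence "Qbar.dimension (global_degree L) \<rat> L'" using dimension_image[of _ L] image by simp
  from Qbar.dimI[OF subfield_Rats this] show ?thesis by (simp add: global_degree_def over_def)
qed

text \<open>Applying g to the terms of sequences preserves absolute values, so Cauchy sequences go
  to Cauchy sequences and null sequences to null sequences. The first isomorphism theorem yields an
  isomorphism of completions; as g fixes \<rat>, it matches the two copies of the completion of
  \<rat> and so preserves the dimension.\<close>

lemma local_degree_eq:
  assumes L: "number_field L" and L': "number_field L'" and w: "w \<in> places L" and w': "w' \<in> places L'"
    and norm: "\<And>x. x \<in> L \<Longrightarrow> place_norm w' (g x) = place_norm w x"
  shows "local_degree L' w' = local_degree L w"
proof -
  interpret A: field_absolute_value L "place_norm w" by (rule field_absolute_value_place_norm) fact+
  interpret B: field_absolute_value L' "place_norm w'" by (rule field_absolute_value_place_norm) fact+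
  define h where "h s = B.proj (\<lambda>n. g (s n))" for s
  have cauchy: "B.cauchy (\<lambda>n. g (s n))" if s: "A.cauchy s" for s
  proof -
    have "place_norm w' (g (s m) - g (s n)) = place_norm w (s m - s n)" for m n
      using norm[of "s m - s n"] A.cauchy_in[OF s] by (simp add: diff)
    moreover have "range (\<lambda>n. g (s n)) \<subseteq> L'" using A.cauchy_in[OF s] closed by blast
    ultimately show ?thesis using s unfolding A.cauchy_def B.cauchy_def by simp
  qed
  have cauchy': "A.cauchy (\<lambda>n. ginv (s n))" if s: "B.cauchy s" for s
  proof -
    have "place_norm w (ginv (s m) - ginv (s n)) = place_norm w' (s m - s n)" for m n
      using norm[of "ginv (s m) - ginv (s n)"] B.cauchy_in[OF s] by (simp add: diff ginv)
    moreover have "range (\<lambda>n. ginv (s n)) \<subseteq> L" using B.cauchy_in[OF s] ginv by blast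
    ultimately show ?thesis using s unfolding A.cauchy_def B.cauchy_def by simp
  qed
  have "h \<in> ring_hom A.C B.R"
  proof (rule ring_hom_memI)
    fix s t assume st: "s \<in> carrier A.C" "t \<in> carrier A.C"
    show "h s \<in> carrier B.R" using st cauchy by (simp add: h_def)
    show "h (s \<otimes>\<^bsub>A.C\<^esub> t) = h s \<otimes>\<^bsub>B.R\<^esub> h t" "h (s \<oplus>\<^bsub>A.C\<^esub> t) = h s \<oplus>\<^bsub>B.R\<^esub> h t"
      using st cauchy by (simp_all add: h_def mult add flip: B.proj_mult B.proj_add)
  qed (simp add: h_def B.proj_one)
  then interpret h: ring_hom_ring A.C B.R h
    by (intro ring_hom_ringI2 A.C.ring_axioms B.R.ring_axioms)
  have surj: "h ` carrier A.C = carrier B.R"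
  proof
    show "carrier B.R \<subseteq> h ` carrier A.C"
    proof
      fix x assume "x \<in> carrier B.R"
      then obtain s where s: "B.cauchy s" "x = B.proj s" by (auto simp: B.carrier_R)
      hence "h (\<lambda>n. ginv (s n)) = x" by (simp add: h_def ginv)
      thus "x \<in> h ` carrier A.C" using cauchy'[OF s(1)] by auto
    qed
  qed (use h.hom_closed in blast)
  have ker: "a_kernel A.C B.R h = A.N"
  proof -
    have "B.null (\<lambda>n. g (s n)) \<longleftrightarrow> A.null s" if s: "A.cauchy s" for s
    proof -
      have "place_norm w' (g (s n)) = place_norm w (s n)" for n using norm A.cauchy_in[OF s] by simp
      moreover have "range (\<lambda>n. g (s n)) \<subseteq> L'" "range s \<subseteq> L" using A.cauchy_in[OF s] closed by auto
      ultimately show ?thesis unfolding A.null_def B.null_def by simp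
    qed
    hence "h s = \<zero>\<^bsub>B.R\<^esub> \<longleftrightarrow> A.null s" if "A.cauchy s" for s
      using that cauchy by (simp add: h_def B.proj_eq_zero_iff)
    moreover have "s \<in> a_kernel A.C B.R h \<longleftrightarrow> A.cauchy s \<and> h s = \<zero>\<^bsub>B.R\<^esub>" for s
      unfolding a_kernel_def' by (simp only: mem_Collect_eq A.C_simps)
    ultimately have "s \<in> a_kernel A.C B.R h \<longleftrightarrow> s \<in> A.N" for s
      using A.null_cauchy[of s] A.N_iff[of s] by metis
    thus ?thesis by blast
  qed
  define ker_iso where "ker_iso Z = the_elem (h ` Z)" for Z
  have iso: "ker_iso \<in> ring_iso A.R B.R" using h.FactRing_iso_set[OF surj] unfolding ker ker_iso_def[abs_def] .
  have ker_iso: "ker_iso (A.proj s) = h s" if "A.cauchy s" for s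
    using h.the_elem_simp[of s] that by (simp add: ker_iso_def ker A.proj_def)
  interpret ker_iso: ring_hom_ring A.R B.R ker_iso
    using iso by (intro ring_hom_ringI2 A.R.ring_axioms B.R.ring_axioms) (auto simp: ring_iso_def)
  have bij: "bij_betw ker_iso (carrier A.R) (carrier B.R)" using iso by (simp add: ring_iso_def)
  have rat: "ker_iso ` A.rat_part = B.rat_part"
  proof
    show "ker_iso ` A.rat_part \<subseteq> B.rat_part"
    proof
      fix y assume "y \<in> ker_iso ` A.rat_part"
      then obtain s where s: "A.cauchy s" "range s \<subseteq> \<rat>" "y = h s" using ker_iso by (auto simp: A.rat_part_def)
      hence "(\<lambda>n. g (s n)) = s" using rat_fixed by (intro ext) auto
      thus "y \<in> B.rat_part" using s cauchy[OF s(1)] by (auto simp: B.rat_part_def h_def)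
    qed
    show "B.rat_part \<subseteq> ker_iso ` A.rat_part"
    proof
      fix y assume "y \<in> B.rat_part"
      then obtain s where s: "B.cauchy s" "range s \<subseteq> \<rat>" "y = B.proj s" by (auto simp: B.rat_part_def)
      have gs: "(\<lambda>n. g (s n)) = s" using s(2) rat_fixed by (intro ext) auto
      have "ginv x = x" if "x \<in> \<rat>" for x using ginv(3)[of x] rat_fixed[OF that] that Rats_subset by auto
      hence "(\<lambda>n. ginv (s n)) = s" using s(2) by (intro ext) auto
      hence s': "A.cauchy s" using cauchy'[OF s(1)] by simp
      hence "A.proj s \<in> A.rat_part" using s(2) by (auto simp: A.rat_part_def)
      moreover have "ker_iso (A.proj s) = y" using ker_iso[OF s'] s(3) gs by (simp add: h_def)
      ultimately show "y \<in> ker_iso ` A.rat_part" by blast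
    qed
  qed
  have "A.R.dimension (local_degree L w) A.rat_part (carrier A.R)"
    using local_degree_dimension[OF L w] by (simp add: place_completion_def rat_completion_eq[OF L w])
  hence "B.R.dimension (local_degree L w) (ker_iso ` A.rat_part) (ker_iso ` carrier A.R)"
    using bij B.zero_neq_one_R by (intro ker_iso.inj_hom_dimension[OF A.subfield_rat_part]) (auto simp: bij_betw_def)
  hence "B.R.dimension (local_degree L w) B.rat_part (carrier B.R)"
    using bij rat by (simp add: bij_betw_def)
  from B.R.dimI[OF B.subfield_rat_part this] show ?thesis
    by (simp add: local_degree_def place_completion_def rat_completion_eq[OF L' w'] over_def)
qed

text \<open>The norm of w is carried over along the inverse of g; it remains normalised because g
  fixes \<rat>.\<close>

lemma transport_place:
  assumes L: "number_field L" and L': "number_field L'" and w: "w \<in> places L"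
  obtains w' where "w' \<in> places L'" "\<And>x. x \<in> L \<Longrightarrow> place_norm w' (g x) = place_norm w x"
proof -
  interpret A: field_absolute_value L "place_norm w" by (rule field_absolute_value_place_norm) fact+
  interpret L': Qbar_subfield L' by (rule number_fieldD) fact
  define b where "b = (\<lambda>y\<in>L'. place_norm w (ginv y))"
  have bg: "b (g x) = place_norm w x" if "x \<in> L" for x using that by (simp add: b_def closed ginv)
  have "absolute_value L' b"
    unfolding absolute_value_def
  proof (intro conjI ballI)
    show "b \<in> extensional L'" by (simp add: b_def)
    fix y assume "y \<in> L'"
    then obtain x where x: "x \<in> L" "y = g x" using image by auto
    show "0 \<le> b y" "(b y = 0) = (y = 0)" using x bg A.nonneg A.eq_0_iff eq_0_iff by auto
    fix z assume "z \<in> L'"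
    then obtain t where t: "t \<in> L" "z = g t" using image by auto
    have "y * z = g (x * t)" "y + z = g (x + t)" using x t by (auto simp: mult add)
    thus "b (y * z) = b y * b z" "b (y + z) \<le> b y + b z"
      using x t bg A.mult A.triangle by auto
  qed
  moreover have "b (of_rat q) = place_norm w (of_rat q)" for q
    using bg[of "of_rat q"] rat_fixed[of "of_rat q"] by simp
  ultimately have b: "b \<in> normalized_avs L'"
    using place_norm_normalized(1)[OF L w] by (simp add: normalized_avs_def)
  show ?thesis
    by (rule that[of "place_of L' b"])
      (use place_of_in_places[OF number_fieldD[OF L'] b] place_norm_place_of[OF number_fieldD[OF L'] b] bg in auto)
qed

end

section \<open>The space of places\<close>

lemma adjoin_subset:
  assumes "Qbar_subfield L" "K \<subseteq> L" "x \<in> L"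
  shows "adjoin K x \<subseteq> L"
proof -
  interpret Qbar_subfield L by fact
  have "p \<in> polys_over L \<Longrightarrow> poly p x \<in> L" for p
    by (induction p) (use assms(3) in auto)
  thus ?thesis using assms(2) by (auto simp: adjoin_def polys_over_def)
qed

lemma ex_number_field:
  assumes "number_field K"
  obtains L where "number_field L" "K \<subseteq> L" "x \<in> L"
  using that[of "adjoin K x"] number_field_adjoin[OF assms]
    Qbar_subfield.subset_adjoin[OF number_fieldD[OF assms]] Qbar_subfield.mem_adjoin[OF number_fieldD[OF assms]]
  by blast

section \<open>Topology of Y and values at its points\<close>

lemma topspace_Y_top [simp]: "topspace Y_top = Y_space"
  by (auto simp: Y_top_def Y_space_def)

lemma Hausdorff_Y_top: "Hausdorff_space Y_top"
  unfolding Y_top_def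
  by (intro Hausdorff_space_subtopology) (simp add: Hausdorff_space_product_topology)

lemma Y_space_places: "y \<in> Y_space \<Longrightarrow> number_field K \<Longrightarrow> y K \<in> places K"
  and Y_space_restrict: "y \<in> Y_space \<Longrightarrow> number_field K \<Longrightarrow> number_field L \<Longrightarrow> K \<subseteq> L \<Longrightarrow>
    place_restrict K (y L) = y K"
  by (auto simp: Y_space_def)

lemma Y_over_iff: "y \<in> Y_over K v \<longleftrightarrow> y \<in> Y_space \<and> y K = v"
  by (simp add: Y_over_def)

lemma Y_over_Int_Y_space [simp]: "Y_over K v \<inter> Y_space = Y_over K v"
  by (auto simp: Y_over_iff)

lemma continuous_map_component:
  assumes "number_field K"
  shows "continuous_map Y_top (discrete_topology (places K)) (\<lambda>y. y K)"
  unfolding Y_top_def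
  by (intro continuous_map_from_subtopology continuous_map_product_projection) (use assms in auto)

lemma openin_Y_over:
  assumes "number_field K" "v \<in> places K"
  shows "openin Y_top (Y_over K v)"
proof -
  have "openin (discrete_topology (places K)) {v}" using assms by simp
  from openin_continuous_map_preimage[OF continuous_map_component[OF assms(1)] this]
  show ?thesis by (simp add: Y_over_def)
qed

lemma closedin_Y_over:
  assumes "number_field K" "v \<in> places K"
  shows "closedin Y_top (Y_over K v)"
proof -
  have "closedin (discrete_topology (places K)) {v}" using assms by simp
  from closedin_continuous_map_preimage[OF continuous_map_component[OF assms(1)] this]
  show ?thesis by (simp add: Y_over_def)
qed

lemma Y_over_eq_Union:
  assumes "number_field K" "number_field L" "K \<subseteq> L"
  shows "Y_over K v = (\<Union>w\<in>{w \<in> places L. place_restrict K w = v}. Y_over L w)"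
  using assms Y_space_places[OF _ assms(2)] Y_space_restrict[OF _ assms] by (auto simp: Y_over_iff)

text \<open>The description in \<open>point_norm\<close> ranges over all number fields containing
  \<alpha>. Each contains \<rat>(\<alpha>), and the norms at one point of Y restrict to each other,
  so they all give the value there.\<close>

lemma point_norm_eq:
  assumes y: "y \<in> Y_space" and K: "number_field K" "\<alpha> \<in> K"
  shows "point_norm y \<alpha> = place_norm (y K) \<alpha>"
proof -
  define F where "F = adjoin \<rat> \<alpha>"
  have F: "number_field F" unfolding F_def by (rule number_field_adjoin[OF number_field_Rats])
  have \<alpha>F: "\<alpha> \<in> F" unfolding F_def by (rule Qbar_subfield.mem_adjoin[OF number_fieldD[OF number_field_Rats]])
  have *: "place_norm (y L) \<alpha> = place_norm (y F) \<alpha>" if L: "number_field L" "\<alpha> \<in> L" for L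
  proof -
    have "F \<subseteq> L" unfolding F_def
      by (intro adjoin_subset number_fieldD Qbar_subfield.Rats_subset L)
    from place_restrict_norm(2)[OF F L(1) this Y_space_places[OF y L(1)]]
    show ?thesis using Y_space_restrict[OF y F L(1) \<open>F \<subseteq> L\<close>] \<alpha>F by simp
  qed
  show ?thesis
    unfolding point_norm_def
  proof (rule the_equality)
    show "\<forall>L. number_field L \<longrightarrow> \<alpha> \<in> L \<longrightarrow> place_norm (y K) \<alpha> = place_norm (y L) \<alpha>"
      using * K by simp
  qed (use K in blast)
qed

lemma point_norm_mult:
  assumes y: "y \<in> Y_space"
  shows "point_norm y (\<alpha> * \<beta>) = point_norm y \<alpha> * point_norm y \<beta>"
proof -
  obtain K1 where K1: "number_field K1" "\<alpha> \<in> K1" using ex_number_field[OF number_field_Rats] by blast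
  obtain K where K: "number_field K" "K1 \<subseteq> K" "\<beta> \<in> K" using ex_number_field[OF K1(1)] by blast
  interpret field_absolute_value K "place_norm (y K)"
    by (rule field_absolute_value_place_norm[OF K(1) Y_space_places[OF y K(1)]])
  show ?thesis using K K1 by (auto simp: point_norm_eq[OF y K(1)] mult)
qed

lemma point_norm_pos:
  assumes y: "y \<in> Y_space" and "\<alpha> \<noteq> 0"
  shows "point_norm y \<alpha> > 0"
proof -
  obtain K where K: "number_field K" "\<alpha> \<in> K" using ex_number_field[OF number_field_Rats] by blast
  interpret field_absolute_value K "place_norm (y K)"
    by (rule field_absolute_value_place_norm[OF K(1) Y_space_places[OF y K(1)]])
  show ?thesis using K assms(2) pos by (simp add: point_norm_eq[OF y K])
qed

lemma point_norm_1 [simp]: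
  assumes y: "y \<in> Y_space"
  shows "point_norm y 1 = 1"
  using point_norm_mult[OF y, of 1 1] point_norm_pos[OF y, of 1] by simp

lemma point_norm_minus [simp]:
  assumes y: "y \<in> Y_space"
  shows "point_norm y (- \<alpha>) = point_norm y \<alpha>"
proof -
  have "point_norm y (-1) * point_norm y (-1) = 1" using point_norm_mult[OF y, of "-1" "-1"] y by simp
  hence "point_norm y (-1) = 1" using point_norm_pos[OF y, of "-1"] by (simp add: square_eq_1_iff)
  thus ?thesis using point_norm_mult[OF y, of "-1" \<alpha>] by simp
qed

lemma f_log_mult:
  assumes "y \<in> Y_space" "\<alpha> \<noteq> 0" "\<beta> \<noteq> 0"
  shows "f_log (\<alpha> * \<beta>) y = f_log \<alpha> y + f_log \<beta> y"
  using assms(1) point_norm_pos[OF assms(1,2)] point_norm_pos[OF assms(1,3)]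
  by (simp add: f_log_def point_norm_mult ln_mult)

lemma f_log_1 [simp]: "y \<in> Y_space \<Longrightarrow> f_log 1 y = 0"
  and f_log_minus [simp]: "y \<in> Y_space \<Longrightarrow> f_log (- \<alpha>) y = f_log \<alpha> y"
  by (simp_all add: f_log_def)

lemma f_log_power:
  assumes "y \<in> Y_space" "\<alpha> \<noteq> 0"
  shows "f_log (\<alpha> ^ n) y = real n * f_log \<alpha> y"
  by (induction n) (use assms in \<open>auto simp: f_log_mult algebra_simps\<close>)

lemma f_log_inverse:
  assumes "y \<in> Y_space" "\<alpha> \<noteq> 0"
  shows "f_log (inverse \<alpha>) y = - f_log \<alpha> y"
  using f_log_mult[of y \<alpha> "inverse \<alpha>"] assms by simp

lemma f_log_prod_mset:
  assumes "y \<in> Y_space" "0 \<notin># A"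
  shows "f_log (prod_mset A) y = (\<Sum>\<alpha>\<in>#A. f_log \<alpha> y)"
  using assms(2) by (induction A) (use assms(1) in \<open>auto simp: f_log_mult\<close>)

lemma f_log_eq:
  assumes "y \<in> Y_over K v" "number_field K" "\<alpha> \<in> K"
  shows "f_log \<alpha> y = ln (place_norm v \<alpha>)"
  using assms by (auto simp: f_log_def Y_over_iff point_norm_eq)

text \<open>The value at y depends only on the place \<open>y K\<close> of one number field K
  containing \<alpha>, so the function factors through a discrete space.\<close>

lemma continuous_f_log: "continuous_map Y_top euclideanreal (f_log \<alpha>)"
proof -
  obtain K where K: "number_field K" "\<alpha> \<in> K" using ex_number_field[OF number_field_Rats] by blast
  have "continuous_map Y_top euclideanreal ((\<lambda>v. ln (place_norm v \<alpha>)) \<circ> (\<lambda>y. y K))"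
    by (rule continuous_map_compose[OF continuous_map_component[OF K(1)]]) simp
  thus ?thesis
    by (rule continuous_map_eq) (use K in \<open>auto simp: f_log_def point_norm_eq\<close>)
qed

lemma finite_places_meeting_compact:
  assumes S: "compactin Y_top S" and K: "number_field K"
  shows "finite {v \<in> places K. Y_over K v \<inter> S \<noteq> {}}"
proof -
  have "compactin (discrete_topology (places K)) ((\<lambda>y. y K) ` S)"
    by (rule image_compactin[OF S continuous_map_component[OF K]])
  hence "finite ((\<lambda>y. y K) ` S)" by (simp add: compactin_discrete_topology)
  moreover have "{v \<in> places K. Y_over K v \<inter> S \<noteq> {}} \<subseteq> (\<lambda>y. y K) ` S"
    by (auto simp: Y_over_iff)
  ultimately show ?thesis by (rule finite_subset[rotated])
qed

section \<open>The measure of fibres and compact sets\<close>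

locale lambda_measure =
  fixes lam :: "qbar_place measure"
  assumes lam: "is_lambda lam"
begin

lemma space_lam [simp]: "space lam = Y_space"
proof -
  have "sets lam = sets (sigma Y_space {U. openin Y_top U})" using lam by (simp add: is_lambda_def)
  hence "space lam = space (sigma Y_space {U. openin Y_top U})" by (rule sets_eq_imp_space_eq)
  moreover have "{U. openin Y_top U} \<subseteq> Pow Y_space" using openin_subset[of Y_top] by auto
  ultimately show ?thesis by (simp add: space_measure_of)
qed

lemma openin_sets: "openin Y_top U \<Longrightarrow> U \<in> sets lam"
proof -
  have "{U. openin Y_top U} \<subseteq> Pow Y_space" using openin_subset[of Y_top] by auto
  hence "sets lam = sigma_sets Y_space {U. openin Y_top U}"
    using lam by (simp add: is_lambda_def)
  thus "openin Y_top U \<Longrightarrow> U \<in> sets lam" by auto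
qed

lemma closedin_sets: "closedin Y_top U \<Longrightarrow> U \<in> sets lam"
proof -
  assume "closedin Y_top U"
  hence "Y_space - U \<in> sets lam" "U \<subseteq> Y_space" using openin_sets by (auto simp: closedin_def)
  thus ?thesis using sets.Diff[OF sets.top[of lam], of "Y_space - U"] by (simp add: double_diff)
qed

lemma Y_over_sets [measurable]: "number_field K \<Longrightarrow> v \<in> places K \<Longrightarrow> Y_over K v \<in> sets lam"
  by (intro openin_sets openin_Y_over)

lemma continuous_measurable:
  assumes "continuous_map Y_top euclideanreal f"
  shows "f \<in> borel_measurable lam"
proof (rule borel_measurableI)
  fix U :: "real set" assume "open U"
  hence "openin Y_top {y \<in> Y_space. f y \<in> U}"
    using openin_continuous_map_preimage[OF assms] by simp
  moreover have "{y \<in> Y_space. f y \<in> U} = f -` U \<inter> space lam" by auto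
  ultimately show "f -` U \<inter> space lam \<in> sets lam" using openin_sets by metis
qed

lemma emeasure_Y_over:
  assumes "number_field K" "v \<in> places K"
  shows "emeasure lam (Y_over K v) = ennreal (real (local_degree K v) / real (global_degree K))"
  using lam assms by (simp add: is_lambda_def)

lemma measure_Y_over:
  assumes "number_field K" "v \<in> places K"
  shows "measure lam (Y_over K v) = real (local_degree K v) / real (global_degree K)"
  by (rule measure_eq_emeasure_eq_ennreal[OF _ emeasure_Y_over[OF assms]]) simp

lemma measure_Y_over_pos:
  assumes "number_field K" "v \<in> places K"
  shows "measure lam (Y_over K v) > 0"
  unfolding measure_Y_over[OF assms] using local_degree_pos[OF assms] global_degree_pos[OF assms(1)] by simp

text \<open>Since \<open>\<lambda>\<close> is given, this needs no extension theorem for absolute values.\<close>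

lemma Y_over_nonempty:
  assumes "number_field K" "v \<in> places K"
  shows "Y_over K v \<noteq> {}"
  using measure_Y_over_pos[OF assms] by auto

lemma emeasure_Y_over_finite:
  assumes "number_field K" "v \<in> places K"
  shows "emeasure lam (Y_over K v) < \<infinity>"
  by (simp add: emeasure_Y_over[OF assms])

lemma compact_sets: "compactin Y_top S \<Longrightarrow> S \<in> sets lam"
  by (intro closedin_sets compactin_imp_closedin Hausdorff_Y_top)

text \<open>A compact set meets finitely many fibres over places of \<rat>, and each fibre has
  finite measure.\<close>

lemma emeasure_compact_finite:
  assumes "compactin Y_top S"
  shows "emeasure lam S < \<infinity>"
proof -
  define V where "V = {v \<in> places \<rat>. Y_over \<rat> v \<inter> S \<noteq> {}}"
  have fin: "finite V" unfolding V_def by (rule finite_places_meeting_compact[OF assms number_field_Rats])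
  have "S \<subseteq> (\<Union>v\<in>V. Y_over \<rat> v)"
  proof
    fix y assume "y \<in> S"
    moreover from this have "y \<in> Y_space" using compactin_subset_topspace[OF assms] by auto
    ultimately show "y \<in> (\<Union>v\<in>V. Y_over \<rat> v)"
      using Y_space_places[OF _ number_field_Rats] by (auto simp: V_def Y_over_iff)
  qed
  hence "emeasure lam S \<le> emeasure lam (\<Union>v\<in>V. Y_over \<rat> v)"
    using fin by (intro emeasure_mono sets.finite_UN) (auto simp: V_def intro!: Y_over_sets number_field_Rats)
  also have "\<dots> \<le> (\<Sum>v\<in>V. emeasure lam (Y_over \<rat> v))"
    using fin by (intro emeasure_subadditive_finite) (auto simp: V_def intro!: Y_over_sets number_field_Rats)
  also have "\<dots> < \<infinity>"
    using fin emeasure_Y_over_finite[OF number_field_Rats] by (auto simp: V_def less_top)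
  finally show ?thesis .
qed

end

section \<open>Integrals over the fibres of the space of places\<close>

lemma rat_place_inf_eq: "rat_place_inf = place_of \<rat> (\<lambda>x\<in>\<rat>. \<bar>real_of_rat (of_ac x)\<bar>)"
  by (simp add: rat_place_inf_def place_of_def)

context Qbar_iso
begin

lemma inverse_iso: "Qbar_iso L' ginv L"
proof -
  have "subfield L' Qbar_ring"
  proof (rule Qbar_subfieldI)
    show "1 \<in> L'" using closed[of 1] by simp
    fix x assume "x \<in> L'"
    then obtain u where u: "u \<in> L" "x = g u" using image by auto
    show "- x \<in> L'" "inverse x \<in> L'" 
      using u closed[of "- u"] closed[of "inverse u"] by (simp_all add: minus inverse)
    fix y assume "y \<in> L'"
    then obtain v where v: "v \<in> L" "y = g v" using image by auto
    show "x + y \<in> L'" "x * y \<in> L'" 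
      using u v closed[of "u + v"] closed[of "u * v"] by (simp_all add: add mult)
  qed
  moreover have "field_hom_on L' ginv"
    unfolding field_hom_on_def
  proof (intro conjI ballI)
    show "ginv 1 = 1" using ginv(3)[of 1] by simp
    fix x y assume "x \<in> L'" "y \<in> L'"
    then obtain u v where "u \<in> L" "x = g u" "v \<in> L" "y = g v" using image by auto
    thus "ginv (x + y) = ginv x + ginv y" "ginv (x * y) = ginv x * ginv y"
      using ginv(3)[of "u + v"] ginv(3)[of "u * v"] ginv(3) by (simp_all add: add mult)
  qed
  moreover have "ginv ` L' = L" using ginv(1,3) closed by force
  ultimately show ?thesis
    by (simp add: Qbar_iso_def Qbar_iso_axioms_def Qbar_hom_def Qbar_hom_axioms_def Qbar_subfield_def)
qed

end

context lambda_measure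
begin

text \<open>On each fibre over a place of L the function is constant. Only finitely many places lie
  above v because their fibres are nonempty and contained in the compact fibre over v.\<close>

lemma integral_Y_over:
  assumes K: "number_field K" and L: "number_field L" and KL: "K \<subseteq> L" and \<alpha>: "\<alpha> \<in> L"
    and v: "v \<in> places K" and compact: "compactin Y_top (Y_over K v)"
  shows "finite {w \<in> places L. place_restrict K w = v}"
    and "set_integrable lam (Y_over K v) (f_log \<alpha>)"
    and "(LINT y:Y_over K v|lam. f_log \<alpha> y) =
      (\<Sum>w\<in>{w \<in> places L. place_restrict K w = v}. measure lam (Y_over L w) * ln (place_norm w \<alpha>))"
proof -
  define W where "W = {w \<in> places L. place_restrict K w = v}"
  note U = Y_over_eq_Union[OF K L KL, of v, folded W_def]
  have "W \<subseteq> {w \<in> places L. Y_over L w \<inter> Y_over K v \<noteq> {}}"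
    using Y_over_nonempty[OF L] U by (fastforce simp: W_def)
  hence fin: "finite W" using finite_places_meeting_compact[OF compact L] by (rule finite_subset)
  thus "finite {w \<in> places L. place_restrict K w = v}" by (simp add: W_def)
  have eq: "indicator (Y_over K v) y *\<^sub>R f_log \<alpha> y =
      (\<Sum>w\<in>W. indicator (Y_over L w) y * ln (place_norm w \<alpha>))" if y: "y \<in> Y_space" for y
  proof (cases "y \<in> Y_over K v")
    case True
    then obtain w0 where w0: "w0 \<in> W" "y \<in> Y_over L w0" using U by auto
    have "(\<Sum>w\<in>W. indicator (Y_over L w) y * ln (place_norm w \<alpha>)) =
        (\<Sum>w\<in>{w0}. indicator (Y_over L w) y * ln (place_norm w \<alpha>))"
      using fin w0 by (intro sum.mono_neutral_right) (auto simp: Y_over_iff indicator_def)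
    also have "\<dots> = f_log \<alpha> y" using w0 f_log_eq[OF w0(2) L \<alpha>] by simp
    finally show ?thesis using True by simp
  next
    case False
    hence "y \<notin> Y_over L w" if "w \<in> W" for w using U that by auto
    thus ?thesis using False by simp
  qed
  have int: "integrable lam (\<lambda>y. indicator (Y_over L w) y * ln (place_norm w \<alpha>))" if "w \<in> W" for w
    using that emeasure_Y_over_finite[OF L, of w]
    by (intro integrable_mult_left) (auto simp: W_def integrable_indicator_iff Y_over_sets[OF L])
  hence "integrable lam (\<lambda>y. \<Sum>w\<in>W. indicator (Y_over L w) y * ln (place_norm w \<alpha>))"
    by (intro Bochner_Integration.integrable_sum)
  thus "set_integrable lam (Y_over K v) (f_log \<alpha>)"
    unfolding set_integrable_def
    by (subst Bochner_Integration.integrable_cong[OF refl eq]) auto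
  have "(LINT y:Y_over K v|lam. f_log \<alpha> y) =
      (LINT y|lam. (\<Sum>w\<in>W. indicator (Y_over L w) y * ln (place_norm w \<alpha>)))"
    unfolding set_lebesgue_integral_def by (rule Bochner_Integration.integral_cong[OF refl eq]) simp
  also have "\<dots> = (\<Sum>w\<in>W. measure lam (Y_over L w) * ln (place_norm w \<alpha>))"
    using int Y_over_sets[OF L]
    by (subst Bochner_Integration.integral_sum) (auto simp: W_def intro!: sum.cong)
  finally show "(LINT y:Y_over K v|lam. f_log \<alpha> y) =
      (\<Sum>w\<in>{w \<in> places L. place_restrict K w = v}. measure lam (Y_over L w) * ln (place_norm w \<alpha>))"
    by (simp add: W_def)
qed

text \<open>The isomorphism from \<open>K(\<alpha>)\<close> to \<open>K(\<beta>)\<close> matches the places above \<open>v\<close> and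
  preserves the measures of the corresponding sets.\<close>

lemma integral_Y_over_conjugate:
  assumes K: "number_field K" and v: "v \<in> places K" and compact: "compactin Y_top (Y_over K v)"
    and root: "poly (Qbar_subfield.min_poly K \<alpha>) \<beta> = 0"
  shows "(LINT y:Y_over K v|lam. f_log \<beta> y) = (LINT y:Y_over K v|lam. f_log \<alpha> y)"
proof -
  \<comment> \<open>The inclusion of K as an embedding into \<open>qbar\<close>; extending it by
    sending \<alpha> to \<beta> produces the isomorphism g.\<close>
  interpret id: Qbar_hom K "\<lambda>x. x"
    using number_fieldD[OF K] by (simp add: Qbar_hom_def Qbar_hom_axioms_def field_hom_on_def)
  have map_id: "id.map p = p" for p by (rule poly_eqI) simp
  define L L' where "L = adjoin K \<alpha>" and "L' = adjoin K \<beta>"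
  have L: "number_field L" "K \<subseteq> L" "\<alpha> \<in> L" and L': "number_field L'" "K \<subseteq> L'" "\<beta> \<in> L'"
    by (auto simp: L_def L'_def number_field_adjoin K id.mem_adjoin intro: subsetD[OF id.subset_adjoin])
  obtain g where g: "field_hom_on L g" "\<And>y. y \<in> K \<Longrightarrow> g y = y" "g \<alpha> = \<beta>"
    "\<And>p. p \<in> polys_over K \<Longrightarrow> g (poly p \<alpha>) = poly p \<beta>"
    using id.extend_to_adjoin[of \<alpha> \<beta>] root unfolding map_id L_def by metis
  have "g ` L = L'" unfolding L_def L'_def adjoin_def image_image using g(4) by simp
  then interpret g: Qbar_iso L g L'
    by (intro Qbar_iso.intro Qbar_hom.intro Qbar_hom_axioms.intro Qbar_iso_axioms.intro number_fieldD L(1) g(1))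
  interpret h: Qbar_iso L' g.ginv L by (rule g.inverse_iso)
  define W W' where "W = {w \<in> places L. place_restrict K w = v}"
    and "W' = {w \<in> places L'. place_restrict K w = v}"
  have "\<exists>w'. w' \<in> places L' \<and> (\<forall>x\<in>L. place_norm w' (g x) = place_norm w x)" if "w \<in> W" for w
  proof -
    have "w \<in> places L" using that by (simp add: W_def)
    from g.transport_place[OF L(1) L'(1) this] show ?thesis by metis
  qed
  then obtain T where T: "\<And>w. w \<in> W \<Longrightarrow> T w \<in> places L'"
    "\<And>w x. w \<in> W \<Longrightarrow> x \<in> L \<Longrightarrow> place_norm (T w) (g x) = place_norm w x" by metis
  \<comment> \<open>As g fixes K, places that correspond under g have the same restriction to
    K.\<close>
  have restr: "place_restrict K w' = place_restrict K w"
    if "w \<in> places L" "w' \<in> places L'" "\<And>x. x \<in> L \<Longrightarrow> place_norm w' (g x) = place_norm w x" for w w'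
  proof (rule place_eqI[OF K])
    show "place_restrict K w' \<in> places K" "place_restrict K w \<in> places K"
      by (rule place_restrict_norm(1)[OF K L'(1,2) that(2)], rule place_restrict_norm(1)[OF K L(1,2) that(1)])
    fix x assume "x \<in> K"
    thus "place_norm (place_restrict K w') x = place_norm (place_restrict K w) x"
      using place_restrict_norm(2)[OF K L(1,2) that(1)] place_restrict_norm(2)[OF K L'(1,2) that(2)]
        that(3)[of x] g(2)[of x] L(2) by auto
  qed
  have "bij_betw T W W'"
    unfolding bij_betw_def
  proof
    show "inj_on T W"
    proof (rule inj_onI)
      fix w1 w2 assume w: "w1 \<in> W" "w2 \<in> W" "T w1 = T w2"
      have "place_norm w1 x = place_norm w2 x" if "x \<in> L" for x
        using T(2)[OF w(1) that] T(2)[OF w(2) that] w(3) by simp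
      thus "w1 = w2" using w by (intro place_eqI[OF L(1)]) (auto simp: W_def)
    qed
    show "T ` W = W'"
    proof
      show "T ` W \<subseteq> W'"
      proof
        fix w' assume "w' \<in> T ` W"
        then obtain w where w: "w \<in> W" "w' = T w" by auto
        have "place_restrict K (T w) = place_restrict K w"
          using w T by (intro restr) (auto simp: W_def)
        thus "w' \<in> W'" using w T(1)[of w] by (auto simp: W_def W'_def)
      qed
      show "W' \<subseteq> T ` W"
      proof
        fix w' assume w': "w' \<in> W'"
        hence w'p: "w' \<in> places L'" by (simp add: W'_def)
        \<comment> \<open>The preimage is found by transporting w' back along the inverse
          isomorphism.\<close>
        obtain w where w: "w \<in> places L" "\<And>x. x \<in> L' \<Longrightarrow> place_norm w (g.ginv x) = place_norm w' x"
          using h.transport_place[OF L'(1) L(1) w'p] by blast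
        have norm: "place_norm w' (g x) = place_norm w x" if "x \<in> L" for x
          using w(2)[of "g x"] that by (simp add: g.closed g.ginv)
        have "place_restrict K w' = place_restrict K w" by (rule restr[OF w(1) w'p norm])
        hence wW: "w \<in> W" using w' w by (simp add: W_def W'_def)
        have "T w = w'"
        proof (rule place_eqI[OF L'(1) T(1)[OF wW] w'p])
          fix y assume "y \<in> L'"
          then obtain x where "x \<in> L" "y = g x" using g.image by auto
          thus "place_norm (T w) y = place_norm w' y" using T(2)[OF wW, of x] norm[of x] by simp
        qed
        thus "w' \<in> T ` W" using wW by auto
      qed
    qed
  qed
  hence "(\<Sum>w\<in>W'. measure lam (Y_over L' w) * ln (place_norm w \<beta>)) =
      (\<Sum>w\<in>W. measure lam (Y_over L' (T w)) * ln (place_norm (T w) \<beta>))"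
    by (rule sum.reindex_bij_betw[symmetric])
  also have "\<dots> = (\<Sum>w\<in>W. measure lam (Y_over L w) * ln (place_norm w \<alpha>))"
  proof (rule sum.cong)
    fix w assume w: "w \<in> W"
    hence wp: "w \<in> places L" by (simp add: W_def)
    have "measure lam (Y_over L' (T w)) = measure lam (Y_over L w)"
      using measure_Y_over[OF L(1) wp] measure_Y_over[OF L'(1) T(1)[OF w]]
        g.local_degree_eq[OF L(1) L'(1) wp T(1)[OF w] T(2)[OF w]] g.global_degree_eq[OF L(1) L'(1)] by simp
    moreover have "place_norm (T w) \<beta> = place_norm w \<alpha>" using T(2)[OF w L(3)] g(3) by simp
    ultimately show "measure lam (Y_over L' (T w)) * ln (place_norm (T w) \<beta>) =
      measure lam (Y_over L w) * ln (place_norm w \<alpha>)" by simp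
  qed simp
  finally show ?thesis
    using integral_Y_over(3)[OF K L v compact] integral_Y_over(3)[OF K L' v compact]
    by (simp add: W_def W'_def)
qed

text \<open>The root r determines an embedding of K(\<alpha>) into the complex numbers that maps
  \<alpha> to r. Its modulus is a normalised absolute value, hence gives a place above \<infinity>;
  the fibre over this place is nonempty, and at its points \<open>f_log \<alpha>\<close> is
  \<open>ln (cmod r)\<close>.\<close>

lemma archimedean_conjugate_norm:
  assumes K: "number_field K" and \<sigma>: "field_hom_on K (\<sigma> :: qbar \<Rightarrow> complex)" and \<alpha>: "\<alpha> \<noteq> 0"
    and arch: "\<And>y. y \<in> Y_over \<rat> rat_place_inf \<Longrightarrow> f_log \<alpha> y = 0"
    and r: "poly (map_poly \<sigma> (Qbar_subfield.min_poly K \<alpha>)) r = 0"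
  shows "cmod r = 1"
proof -
  interpret s: Qbar_hom K \<sigma>
    using number_fieldD[OF K] \<sigma> by (simp add: Qbar_hom_def Qbar_hom_axioms_def)
  define L where "L = adjoin K \<alpha>"
  have L: "number_field L" "\<alpha> \<in> L" by (simp_all add: L_def number_field_adjoin K s.mem_adjoin)
  obtain \<tau> where \<tau>: "field_hom_on L \<tau>" "\<tau> \<alpha> = r" using s.extend_to_adjoin[OF r] unfolding L_def by metis
  interpret t: Qbar_hom L \<tau>
    using number_fieldD[OF L(1)] \<tau> by (simp add: Qbar_hom_def Qbar_hom_axioms_def)
  have rat: "\<tau> (of_rat q) = of_rat q" for q by (rule Qbar_hom_of_rat[OF t.Qbar_hom_axioms])
  have cmod_rat: "cmod (of_rat q) = \<bar>real_of_rat q\<bar>" for q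
  proof -
    have "(of_rat q :: complex) = of_real (of_rat q)"
      by (cases q) (simp add: of_rat_rat)
    thus ?thesis by simp
  qed
  define a where "a = (\<lambda>x\<in>L. cmod (\<tau> x))"
  have "absolute_value L a"
    by (auto simp: absolute_value_def a_def t.eq_0_iff t.mult norm_mult t.add norm_triangle_ineq)
  moreover have arat: "a (of_rat q) = \<bar>real_of_rat q\<bar>" for q by (simp add: a_def rat cmod_rat)
  ultimately have a: "a \<in> normalized_avs L" by (simp add: normalized_avs_def usual_rat_abs_def)
  define w where "w = place_of L a"
  have w: "w \<in> places L" "place_norm w = a"
    using place_of_in_places[OF number_fieldD[OF L(1)] a] place_norm_place_of[OF number_fieldD[OF L(1)] a]
    by (simp_all add: w_def)
  have "restrict a \<rat> = (\<lambda>x\<in>\<rat>. \<bar>real_of_rat (of_ac x)\<bar>)"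
  proof (rule restrict_ext)
    fix x :: qbar assume "x \<in> \<rat>"
    then obtain q where q: "x = of_rat q" by (elim Rats_cases)
    have "of_ac x = q" unfolding q by (metis of_ac_to_ac to_ac_eq_of_rat)
    thus "a x = \<bar>real_of_rat (of_ac x)\<bar>" using arat[of q] by (simp add: q)
  qed
  hence "place_restrict \<rat> w = rat_place_inf"
    using place_restrict_place_of[OF number_fieldD[OF number_field_Rats] number_fieldD[OF L(1)] t.Rats_subset a]
    by (simp add: w_def rat_place_inf_eq)
  moreover obtain y where y: "y \<in> Y_over L w" using Y_over_nonempty[OF L(1) w(1)] by blast
  ultimately have "y \<in> Y_over \<rat> rat_place_inf"
    using Y_space_restrict[OF _ number_field_Rats L(1) t.Rats_subset, of y] by (simp add: Y_over_iff)
  from arch[OF this] have "ln (a \<alpha>) = 0" using f_log_eq[OF y L] w by simp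
  moreover have "a \<alpha> > 0" using \<alpha> L(2) t.eq_0_iff[of \<alpha>] by (simp add: a_def)
  ultimately show ?thesis using L(2) \<tau>(2) by (simp add: a_def)
qed

lemma integral_Y_over_eq_0:
  assumes K: "number_field K" and real: "real_place K u" and \<alpha>: "\<alpha> \<noteq> 0"
    and arch: "\<And>y. y \<in> Y_over \<rat> rat_place_inf \<Longrightarrow> f_log \<alpha> y = 0"
    and v: "v \<in> places K" and compact: "compactin Y_top (Y_over K v)"
  shows "(LINT y:Y_over K v|lam. f_log \<alpha> y) = 0"
proof -
  interpret Qbar_subfield K by (rule number_fieldD) fact
  obtain \<rho> where \<rho>: "\<rho> \<in> ring_hom (Qbar_ring\<lparr>carrier := K\<rparr>) (ring_of_type_algebra :: real ring)"
    using real by (auto simp: real_place_def)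
  \<comment> \<open>The real embedding is viewed as a complex one, so that the image of the minimal
    polynomial splits into linear factors.\<close>
  define \<sigma> where "\<sigma> x = complex_of_real (\<rho> x)" for x
  have \<sigma>: "field_hom_on K \<sigma>"
    using ring_hom_mult[OF \<rho>] ring_hom_add[OF \<rho>] ring_hom_one[OF \<rho>]
    by (simp add: field_hom_on_def \<sigma>_def)
  interpret s: Qbar_hom K \<sigma> by unfold_locales fact
  define m where "m = min_poly \<alpha>"
  \<comment> \<open>The constant coefficient is the product of the negatives of the roots, so the
    norm of \<alpha> up to sign; the sign does not affect \<open>f_log\<close>.\<close>
  define c where "c = poly.coeff m 0"
  have m: "m \<in> polys_over K" "Polynomial.lead_coeff m = 1" "m \<noteq> 0"
    using min_poly[where x = \<alpha>] min_poly_neq_0 by (auto simp: m_def)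
  have c: "c \<in> K" using m(1) by (simp add: polys_over_def c_def)
  have const: "poly (\<Prod>x\<in>#A. [:- x, 1:]) 0 = (\<Prod>x\<in>#A. - x)" for A :: "'b::field multiset"
    by (induction A) simp_all
  have "cmod (\<sigma> c) = 1"
  proof -
    have dm: "Polynomial.degree (s.map m) = Polynomial.degree m"
      using m(2) by (intro map_poly_degree_eq) simp
    hence lc: "Polynomial.lead_coeff (s.map m) = 1" using m(2) by simp
    hence "s.map m \<noteq> 0" by (metis leading_coeff_0_iff zero_neq_one)
    then obtain B where B: "s.map m = (\<Prod>x\<in>#B. [:- x, 1:])"
      using alg_closed_imp_factorization[of "s.map m"] lc by auto
    have "cmod r = 1" if "r \<in># B" for r
    proof (rule archimedean_conjugate_norm[OF K \<sigma> \<alpha> arch])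
      have "[:- r, 1:] dvd s.map m" unfolding B using that by (intro dvd_prod_mset) auto
      thus "poly (s.map (min_poly \<alpha>)) r = 0" by (simp add: poly_eq_0_iff_dvd m_def)
    qed
    hence "cmod (\<Prod>x\<in>#B. - x) = 1" by (induction B) (simp_all add: norm_mult)
    moreover have "\<sigma> c = poly (s.map m) 0" by (simp add: c_def poly_0_coeff_0)
    ultimately show ?thesis by (simp add: B const)
  qed
  hence "\<bar>\<rho> c\<bar> = 1" by (simp add: \<sigma>_def)
  hence "\<rho> c = 1 \<or> \<rho> c = - 1" by linarith
  hence "\<sigma> c = 1 \<or> \<sigma> c = - 1" by (auto simp: \<sigma>_def)
  hence "\<sigma> c = \<sigma> 1 \<or> \<sigma> c = \<sigma> (- 1)" using s.minus[of 1] s.one by simp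
  hence c1: "c = 1 \<or> c = - 1" using inj_onD[OF s.inj] c by auto
  obtain A where A: "m = (\<Prod>x\<in>#A. [:- x, 1:])" "size A = Polynomial.degree m"
    using alg_closed_imp_factorization[OF m(3)] m(2) by auto
  have cA: "c = (\<Prod>x\<in>#A. - x)"
    using const[of A] by (simp add: c_def A(1) poly_0_coeff_0[symmetric])
  have "c \<noteq> 0" using c1 by auto
  hence A0: "0 \<notin># A" using cA by auto
  \<comment> \<open>The sum is \<open>f_log\<close> of the product of the negated roots, that is of
    c, and c is 1 or -1.\<close>
  have zero: "(\<Sum>x\<in>#A. f_log x y) = 0" if y: "y \<in> Y_space" for y
  proof -
    have "(\<Sum>x\<in>#A. f_log x y) = (\<Sum>x\<in>#image_mset uminus A. f_log x y)"
      using y by (simp add: image_mset.compositionality comp_def)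
    also have "\<dots> = f_log (prod_mset (image_mset uminus A)) y"
      using A0 by (intro f_log_prod_mset[symmetric] y) auto
    also have "\<dots> = 0" using c1 y cA by auto
    finally show ?thesis .
  qed
  \<comment> \<open>Exchanging sum and integral requires integrability for every root, and each root
    x lies in some number field containing K.\<close>
  have int: "set_integrable lam (Y_over K v) (f_log x)" for x
    using ex_number_field[OF K, of x] integral_Y_over(2)[OF K _ _ _ v compact] by metis
  have "set_integrable lam (Y_over K v) (\<lambda>y. \<Sum>x\<in>#B. f_log x y) \<and>
      (LINT y:Y_over K v|lam. (\<Sum>x\<in>#B. f_log x y)) = (\<Sum>x\<in>#B. LINT y:Y_over K v|lam. f_log x y)" for B
  proof (induction B)
    case empty
    show ?case by (simp add: set_integrable_def set_lebesgue_integral_def)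
  next
    case (add x B)
    thus ?case using set_integral_add[OF int[of x], of "\<lambda>y. \<Sum>x\<in>#B. f_log x y"] by simp
  qed
  hence "(\<Sum>x\<in>#A. LINT y:Y_over K v|lam. f_log x y) = (LINT y:Y_over K v|lam. (\<Sum>x\<in>#A. f_log x y))"
    by simp
  also have "\<dots> = (LINT y:Y_over K v|lam. 0)"
    unfolding set_lebesgue_integral_def by (rule Bochner_Integration.integral_cong) (use zero in auto)
  finally have "(\<Sum>x\<in>#A. LINT y:Y_over K v|lam. f_log x y) = 0" by simp
  moreover have "(\<Sum>x\<in>#A. LINT y:Y_over K v|lam. f_log x y) = (\<Sum>x\<in>#A. LINT y:Y_over K v|lam. f_log \<alpha> y)"
  proof (rule arg_cong[of _ _ sum_mset], rule image_mset_cong)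
    fix x assume "x \<in># A"
    hence "[:- x, 1:] dvd m" unfolding A by (intro dvd_prod_mset) auto
    thus "(LINT y:Y_over K v|lam. f_log x y) = (LINT y:Y_over K v|lam. f_log \<alpha> y)"
      by (intro integral_Y_over_conjugate[OF K v compact]) (simp add: poly_eq_0_iff_dvd m_def)
  qed
  ultimately have "real (Polynomial.degree m) * (LINT y:Y_over K v|lam. f_log \<alpha> y) = 0"
    using A(2) by simp
  thus ?thesis using degree_min_poly_pos[of \<alpha>] by (simp add: m_def)
qed

end

section \<open>Function spaces\<close>

text \<open>\<open>F_space\<close> with the mean-zero condition at \<open>p = 1\<close> dropped: the
  norm estimates hold here, and membership of an element of \<open>F_S S\<close> follows from
  continuity and compact support alone.\<close>

definition Lp_C0_space :: "ereal \<Rightarrow> qbar_place measure \<Rightarrow> (qbar_place \<Rightarrow> real) set" where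
  "Lp_C0_space p lam = (if p = \<infinity> then C0_space else Lp_space (real_of_ereal p) lam)"

lemma F_space_subset_Lp_C0: "F_space p lam \<subseteq> Lp_C0_space p lam"
  by (auto simp: F_space_def Lp_C0_space_def)

lemma abs_add_powr_le:
  fixes x y :: real
  assumes "P \<ge> 0"
  shows "\<bar>x + y\<bar> powr P \<le> 2 powr P * (\<bar>x\<bar> powr P + \<bar>y\<bar> powr P)"
proof -
  have "\<bar>x + y\<bar> powr P \<le> (2 * max \<bar>x\<bar> \<bar>y\<bar>) powr P"
    using assms by (intro powr_mono2) auto
  also have "\<dots> = 2 powr P * max \<bar>x\<bar> \<bar>y\<bar> powr P" by (simp add: powr_mult)
  also have "\<dots> \<le> 2 powr P * (\<bar>x\<bar> powr P + \<bar>y\<bar> powr P)"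
    by (intro mult_left_mono) (auto simp: max_def)
  finally show ?thesis .
qed

text \<open>Used in place of the Hoelder inequality to show that integration over a set of finite measure
  is continuous in the \<open>L\<^sup>p\<close> norm.\<close>

lemma le_add_powr:
  fixes t \<delta> P :: real
  assumes "t \<ge> 0" "\<delta> > 0" "P \<ge> 1"
  shows "t \<le> \<delta> + \<delta> powr (1 - P) * t powr P"
proof (cases "t \<le> \<delta>")
  case False
  hence t: "t > \<delta>" "t > 0" using assms by auto
  have "t = t powr (1 - P) * t powr P" using t by (simp flip: powr_add)
  also have "\<dots> \<le> \<delta> powr (1 - P) * t powr P"
    using t assms by (intro mult_right_mono powr_mono2') auto
  finally show ?thesis using assms by simp
qed (use assms in \<open>auto intro: add_increasing2\<close>)

section \<open>Functions vanishing at infinity\<close>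

lemma C0_bounded:
  assumes "f \<in> C0_space"
  obtains B where "B > 0" "\<And>y. y \<in> Y_space \<Longrightarrow> \<bar>f y\<bar> \<le> B"
proof -
  have f: "continuous_map Y_top euclideanreal f" "compactin Y_top {y \<in> Y_space. 1 \<le> \<bar>f y\<bar>}"
    using assms by (auto simp: C0_space_def)
  have "compact (f ` {y \<in> Y_space. 1 \<le> \<bar>f y\<bar>})" using image_compactin[OF f(2,1)] by simp
  then obtain B where B: "\<And>y. y \<in> Y_space \<Longrightarrow> 1 \<le> \<bar>f y\<bar> \<Longrightarrow> \<bar>f y\<bar> \<le> B"
    using compact_imp_bounded by (fastforce simp: bounded_iff)
  show ?thesis
  proof (rule that[of "max B 1"])
    fix y assume "y \<in> Y_space"
    thus "\<bar>f y\<bar> \<le> max B 1" using B[of y] by (cases "1 \<le> \<bar>f y\<bar>") auto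
  qed simp
qed

text \<open>The superlevel sets are closed by continuity, so it suffices to place each inside some
  compact set.\<close>

lemma C0_subset_compact:
  assumes cont: "continuous_map Y_top euclideanreal f"
    and sub: "\<And>\<epsilon>. \<epsilon> > 0 \<Longrightarrow> \<exists>C. compactin Y_top C \<and> {y \<in> Y_space. \<epsilon> \<le> \<bar>f y\<bar>} \<subseteq> C"
  shows "f \<in> C0_space"
  unfolding C0_space_def
proof (safe intro!: cont)
  fix \<epsilon> :: real assume "\<epsilon> > 0"
  then obtain C where C: "compactin Y_top C" "{y \<in> Y_space. \<epsilon> \<le> \<bar>f y\<bar>} \<subseteq> C" using sub by blast
  have "closed {x :: real. \<epsilon> \<le> \<bar>x\<bar>}" by (intro closed_Collect_le continuous_intros)
  hence "closedin Y_top {y \<in> Y_space. \<epsilon> \<le> \<bar>f y\<bar>}"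
    using closedin_continuous_map_preimage[OF cont, of "{x. \<epsilon> \<le> \<bar>x\<bar>}"] by simp
  thus "compactin Y_top {y \<in> Y_space. \<epsilon> \<le> \<bar>f y\<bar>}" using closed_compactin[OF C(1,2)] by blast
qed

lemma C0_compact: "f \<in> C0_space \<Longrightarrow> \<epsilon> > 0 \<Longrightarrow> compactin Y_top {y \<in> Y_space. \<epsilon> \<le> \<bar>f y\<bar>}"
  by (simp add: C0_space_def)

lemma C0_add:
  assumes "f \<in> C0_space" "g \<in> C0_space"
  shows "(\<lambda>y. f y + g y) \<in> C0_space"
proof (rule C0_subset_compact)
  show "continuous_map Y_top euclideanreal (\<lambda>y. f y + g y)"
    using assms by (intro continuous_map_add) (auto simp: C0_space_def)
  fix \<epsilon> :: real assume \<epsilon>: "\<epsilon> > 0"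
  hence "compactin Y_top ({y \<in> Y_space. \<epsilon> / 2 \<le> \<bar>f y\<bar>} \<union> {y \<in> Y_space. \<epsilon> / 2 \<le> \<bar>g y\<bar>})"
    using C0_compact[OF assms(1), of "\<epsilon> / 2"] C0_compact[OF assms(2), of "\<epsilon> / 2"] by (intro compactin_Un) auto
  moreover have "{y \<in> Y_space. \<epsilon> \<le> \<bar>f y + g y\<bar>} \<subseteq>
      {y \<in> Y_space. \<epsilon> / 2 \<le> \<bar>f y\<bar>} \<union> {y \<in> Y_space. \<epsilon> / 2 \<le> \<bar>g y\<bar>}"
    by auto
  ultimately show "\<exists>C. compactin Y_top C \<and> {y \<in> Y_space. \<epsilon> \<le> \<bar>f y + g y\<bar>} \<subseteq> C" by blast
qed

lemma C0_mult:
  assumes "f \<in> C0_space"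
  shows "(\<lambda>y. c * f y) \<in> C0_space"
proof (rule C0_subset_compact)
  show "continuous_map Y_top euclideanreal (\<lambda>y. c * f y)"
    using assms by (intro continuous_map_real_mult) (auto simp: C0_space_def)
  fix \<epsilon> :: real assume \<epsilon>: "\<epsilon> > 0"
  \<comment> \<open>The summand 1 avoids a division by 0 for \<open>c = 0\<close>.\<close>
  have "{y \<in> Y_space. \<epsilon> \<le> \<bar>c * f y\<bar>} \<subseteq> {y \<in> Y_space. \<epsilon> / (\<bar>c\<bar> + 1) \<le> \<bar>f y\<bar>}"
  proof safe
    fix y assume "\<epsilon> \<le> \<bar>c * f y\<bar>"
    also have "\<dots> \<le> (\<bar>c\<bar> + 1) * \<bar>f y\<bar>" by (simp add: abs_mult algebra_simps)
    finally show "\<epsilon> / (\<bar>c\<bar> + 1) \<le> \<bar>f y\<bar>" by (simp add: field_simps add_nonneg_pos)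
  qed
  moreover have "compactin Y_top {y \<in> Y_space. \<epsilon> / (\<bar>c\<bar> + 1) \<le> \<bar>f y\<bar>}"
  proof -
    have "\<epsilon> / (\<bar>c\<bar> + 1) > 0" using \<epsilon> by (simp add: add_nonneg_pos)
    thus ?thesis using assms by (auto simp: C0_space_def)
  qed
  ultimately show "\<exists>C. compactin Y_top C \<and> {y \<in> Y_space. \<epsilon> \<le> \<bar>c * f y\<bar>} \<subseteq> C" by blast
qed

section \<open>Integrals over sets of finite measure, and functions of compact support\<close>

context lambda_measure
begin

lemma Lp_add:
  assumes "P \<ge> 1" "f \<in> Lp_space P lam" "g \<in> Lp_space P lam"
  shows "(\<lambda>y. f y + g y) \<in> Lp_space P lam"
proof -
  have [measurable]: "f \<in> borel_measurable lam" "g \<in> borel_measurable lam"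
    using assms by (auto simp: Lp_space_def)
  have "integrable lam (\<lambda>y. \<bar>f y + g y\<bar> powr P)"
  proof (rule Bochner_Integration.integrable_bound)
    show "integrable lam (\<lambda>y. 2 powr P * (\<bar>f y\<bar> powr P + \<bar>g y\<bar> powr P))"
      using assms by (auto simp: Lp_space_def)
  qed (use assms abs_add_powr_le[of P] in auto)
  thus ?thesis by (simp add: Lp_space_def)
qed

lemma Lp_mult:
  assumes "f \<in> Lp_space P lam"
  shows "(\<lambda>y. c * f y) \<in> Lp_space P lam"
  using assms by (auto simp: Lp_space_def abs_mult powr_mult)

text \<open>Integrates the pointwise bound \<open>le_add_powr\<close> over A. The parameter \<delta>
  stays free, so that the two terms can be balanced in \<open>integral_continuous\<close>.\<close>

lemma Lp_set_integrable:
  assumes P: "P \<ge> 1" and f: "f \<in> Lp_space P lam" and A: "A \<in> sets lam" "emeasure lam A < \<infinity>"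
  shows "set_integrable lam A f"
    and "\<delta> > 0 \<Longrightarrow> \<bar>LINT y:A|lam. f y\<bar> \<le> \<delta> * measure lam A + \<delta> powr (1 - P) * (LINT y|lam. \<bar>f y\<bar> powr P)"
proof -
  have [measurable]: "f \<in> borel_measurable lam" "A \<in> sets lam" using f A by (auto simp: Lp_space_def)
  have int: "integrable lam (\<lambda>y. \<delta> * indicator A y + \<delta> powr (1 - P) * \<bar>f y\<bar> powr P)" for \<delta>
    using f A by (auto simp: Lp_space_def intro!: integrable_mult_right)
  have le: "norm (indicator A y *\<^sub>R f y) \<le> \<delta> * indicator A y + \<delta> powr (1 - P) * \<bar>f y\<bar> powr P"
    if "\<delta> > 0" for y \<delta>
    using le_add_powr[OF _ that P, of "\<bar>f y\<bar>"] by (auto simp: indicator_def)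
  show i: "set_integrable lam A f"
    unfolding set_integrable_def
  proof (rule Bochner_Integration.integrable_bound[OF int[of 1]])
    show "AE x in lam. norm (indicat_real A x *\<^sub>R f x) \<le> norm (1 * indicat_real A x + 1 powr (1 - P) * \<bar>f x\<bar> powr P)"
      using le[of 1] by (intro AE_I2) (simp add: order_trans[OF _ abs_ge_self])
  qed measurable
  show "\<bar>LINT y:A|lam. f y\<bar> \<le> \<delta> * measure lam A + \<delta> powr (1 - P) * (LINT y|lam. \<bar>f y\<bar> powr P)"
    if "\<delta> > 0"
  proof -
    have "\<bar>LINT y:A|lam. f y\<bar> \<le> (LINT y|lam. norm (indicator A y *\<^sub>R f y))"
      unfolding set_lebesgue_integral_def real_norm_def[symmetric] by (rule integral_norm_bound)
    also have "\<dots> \<le> (LINT y|lam. \<delta> * indicator A y + \<delta> powr (1 - P) * \<bar>f y\<bar> powr P)"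
      using i le[OF that] by (intro integral_mono int) (auto simp: set_integrable_def)
    also have "\<dots> = \<delta> * measure lam A + \<delta> powr (1 - P) * (LINT y|lam. \<bar>f y\<bar> powr P)"
      using f A sets.sets_into_space[OF A(1)] by (subst Bochner_Integration.integral_add)
        (auto simp: Lp_space_def less_top Int_absorb2 intro!: integrable_mult_right)
    finally show ?thesis .
  qed
qed

lemma C0_set_integrable:
  assumes f: "f \<in> C0_space" and A: "A \<in> sets lam" "emeasure lam A < \<infinity>"
  shows "set_integrable lam A f"
    and "\<bar>LINT y:A|lam. f y\<bar> \<le> p_norm \<infinity> lam f * measure lam A"
proof -
  have [measurable]: "f \<in> borel_measurable lam" "A \<in> sets lam"
    using f A continuous_measurable by (auto simp: C0_space_def)
  obtain B where B: "\<And>y. y \<in> Y_space \<Longrightarrow> \<bar>f y\<bar> \<le> B" using C0_bounded[OF f] by blast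
  define C where "C = p_norm \<infinity> lam f"
  have C: "\<bar>f y\<bar> \<le> C" if "y \<in> Y_space" for y
    unfolding C_def p_norm_def using B that by (auto intro!: cSUP_upper bdd_aboveI2[of _ _ B])
  have int: "integrable lam (\<lambda>y. C * indicator A y)" using A by (auto intro!: integrable_mult_right)
  have le: "norm (indicator A y *\<^sub>R f y) \<le> C * indicator A y" if "y \<in> space lam" for y
    using C that by (auto simp: indicator_def)
  show i: "set_integrable lam A f"
    unfolding set_integrable_def
  proof (rule Bochner_Integration.integrable_bound[OF int])
    show "AE x in lam. norm (indicat_real A x *\<^sub>R f x) \<le> norm (C * indicat_real A x)"
      using le by (intro AE_I2) (simp add: order_trans[OF _ abs_ge_self])
  qed measurable
  have "\<bar>LINT y:A|lam. f y\<bar> \<le> (LINT y|lam. norm (indicator A y *\<^sub>R f y))"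
    unfolding set_lebesgue_integral_def real_norm_def[symmetric] by (rule integral_norm_bound)
  also have "\<dots> \<le> (LINT y|lam. C * indicator A y)"
    using i le by (intro integral_mono int) (auto simp: set_integrable_def)
  also have "\<dots> = C * measure lam A" using A sets.sets_into_space[OF A(1)] by (simp add: Int_absorb2)
  finally show "\<bar>LINT y:A|lam. f y\<bar> \<le> p_norm \<infinity> lam f * measure lam A" by (simp add: C_def)
qed

lemma compact_support_C0:
  assumes "continuous_map Y_top euclideanreal f" "compactin Y_top S" "\<And>y. y \<in> Y_space \<Longrightarrow> y \<notin> S \<Longrightarrow> f y = 0"
  shows "f \<in> C0_space"
proof (rule C0_subset_compact[OF assms(1)])
  fix \<epsilon> :: real assume "\<epsilon> > 0"
  hence "{y \<in> Y_space. \<epsilon> \<le> \<bar>f y\<bar>} \<subseteq> S" using assms(3) by force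
  thus "\<exists>C. compactin Y_top C \<and> {y \<in> Y_space. \<epsilon> \<le> \<bar>f y\<bar>} \<subseteq> C" using assms(2) by blast
qed

lemma compact_support_Lp:
  assumes cont: "continuous_map Y_top euclideanreal f" and S: "compactin Y_top S"
    and zero: "\<And>y. y \<in> Y_space \<Longrightarrow> y \<notin> S \<Longrightarrow> f y = 0" and P: "P \<ge> 1"
  shows "f \<in> Lp_space P lam"
proof -
  have [measurable]: "f \<in> borel_measurable lam" "S \<in> sets lam"
    using continuous_measurable[OF cont] compact_sets[OF S] by auto
  obtain B where B: "B > 0" "\<And>y. y \<in> Y_space \<Longrightarrow> \<bar>f y\<bar> \<le> B"
    using C0_bounded[OF compact_support_C0[OF cont S zero]] by blast
  have "integrable lam (\<lambda>y. \<bar>f y\<bar> powr P)"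
  proof (rule Bochner_Integration.integrable_bound)
    show "integrable lam (\<lambda>y. B powr P * indicator S y)"
      using emeasure_compact_finite[OF S] by (auto intro!: integrable_mult_right)
    have "norm (\<bar>f y\<bar> powr P) \<le> norm (B powr P * indicator S y)" if "y \<in> space lam" for y
      using that B zero[of y] P by (cases "y \<in> S") (auto intro!: powr_mono2)
    thus "AE y in lam. norm (\<bar>f y\<bar> powr P) \<le> norm (B powr P * indicator S y)" by (intro AE_I2)
  qed measurable
  thus ?thesis by (simp add: Lp_space_def)
qed

lemma p_norm_cong:
  assumes "\<And>y. y \<in> Y_space \<Longrightarrow> f y = g y"
  shows "p_norm p lam f = p_norm p lam g"
proof -
  have "(SUP y\<in>Y_space. \<bar>f y\<bar>) = (SUP y\<in>Y_space. \<bar>g y\<bar>)" using assms by (intro SUP_cong) auto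
  moreover have "(LINT y|lam. \<bar>f y\<bar> powr P) = (LINT y|lam. \<bar>g y\<bar> powr P)" for P
    using assms by (intro Bochner_Integration.integral_cong) auto
  ultimately show ?thesis by (simp add: p_norm_def)
qed

end

text \<open>A supremum over the empty set carries no information, so the norm for
  \<open>p = \<infinity>\<close> calls for \<open>Y_space \<noteq> {}\<close>.\<close>

locale Lp_setting = lambda_measure +
  fixes p :: ereal and S :: "qbar_place set"
  assumes p: "1 \<le> p" and compact: "compactin Y_top S" and Y_nonempty: "Y_space \<noteq> {}"
begin

lemma p_cases: obtains "p = \<infinity>" | P where "p = ereal P" "P \<ge> 1"
  using p by (cases p) auto

lemma Lp_C0_simps: "Lp_C0_space \<infinity> lam = C0_space" "Lp_C0_space (ereal P) lam = Lp_space P lam"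
  by (simp_all add: Lp_C0_space_def)

lemma Lp_C0_add: "f \<in> Lp_C0_space p lam \<Longrightarrow> g \<in> Lp_C0_space p lam \<Longrightarrow> (\<lambda>y. f y + g y) \<in> Lp_C0_space p lam"
  by (cases rule: p_cases) (auto simp: Lp_C0_simps C0_add Lp_add)

lemma Lp_C0_mult: "f \<in> Lp_C0_space p lam \<Longrightarrow> (\<lambda>y. c * f y) \<in> Lp_C0_space p lam"
  by (cases rule: p_cases) (auto simp: Lp_C0_simps C0_mult Lp_mult)

lemma Lp_C0_diff: "f \<in> Lp_C0_space p lam \<Longrightarrow> g \<in> Lp_C0_space p lam \<Longrightarrow> (\<lambda>y. f y - g y) \<in> Lp_C0_space p lam"
  using Lp_C0_add[of f "\<lambda>y. -1 * g y"] Lp_C0_mult[of g "-1"] by simp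

lemma compact_support_Lp_C0:
  assumes "continuous_map Y_top euclideanreal f" "\<And>y. y \<in> Y_space \<Longrightarrow> y \<notin> S \<Longrightarrow> f y = 0"
  shows "f \<in> Lp_C0_space p lam"
  using compact_support_C0[OF assms(1) compact assms(2)] compact_support_Lp[OF assms(1) compact assms(2)]
  by (cases rule: p_cases) (auto simp: Lp_C0_simps)

lemma p_norm_nonneg: "f \<in> Lp_C0_space p lam \<Longrightarrow> 0 \<le> p_norm p lam f"
proof (cases rule: p_cases)
  case 1
  assume "f \<in> Lp_C0_space p lam"
  then obtain B where B: "\<And>y. y \<in> Y_space \<Longrightarrow> \<bar>f y\<bar> \<le> B" using C0_bounded 1 by (metis Lp_C0_simps(1))
  obtain y where y: "y \<in> Y_space" using Y_nonempty by blast
  have "0 \<le> \<bar>f y\<bar>" by simp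
  also have "\<dots> \<le> (SUP y\<in>Y_space. \<bar>f y\<bar>)"
    using y B by (auto intro!: cSUP_upper bdd_aboveI2[of _ _ B])
  finally show ?thesis by (simp add: p_norm_def 1)
qed (simp add: p_norm_def)

text \<open>The constant 4 is not optimal; it makes the Minkowski inequality unnecessary.\<close>

lemma p_norm_add:
  assumes f: "f \<in> Lp_C0_space p lam" and g: "g \<in> Lp_C0_space p lam"
  shows "p_norm p lam (\<lambda>y. f y + g y) \<le> 4 * (p_norm p lam f + p_norm p lam g)"
proof (cases rule: p_cases)
  case 1
  obtain B where B: "\<And>y. y \<in> Y_space \<Longrightarrow> \<bar>f y\<bar> \<le> B" using C0_bounded f 1 by (metis Lp_C0_simps(1))
  obtain C where C: "\<And>y. y \<in> Y_space \<Longrightarrow> \<bar>g y\<bar> \<le> C" using C0_bounded g 1 by (metis Lp_C0_simps(1))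
  have "(SUP y\<in>Y_space. \<bar>f y + g y\<bar>) \<le> (SUP y\<in>Y_space. \<bar>f y\<bar>) + (SUP y\<in>Y_space. \<bar>g y\<bar>)"
  proof (rule cSUP_least[OF Y_nonempty])
    fix y assume y: "y \<in> Y_space"
    have "\<bar>f y\<bar> \<le> (SUP y\<in>Y_space. \<bar>f y\<bar>)" using y B by (auto intro!: cSUP_upper bdd_aboveI2[of _ _ B])
    moreover have "\<bar>g y\<bar> \<le> (SUP y\<in>Y_space. \<bar>g y\<bar>)" using y C by (auto intro!: cSUP_upper bdd_aboveI2[of _ _ C])
    ultimately show "\<bar>f y + g y\<bar> \<le> (SUP y\<in>Y_space. \<bar>f y\<bar>) + (SUP y\<in>Y_space. \<bar>g y\<bar>)" by linarith
  qed
  hence "p_norm p lam (\<lambda>y. f y + g y) \<le> p_norm p lam f + p_norm p lam g" by (simp add: p_norm_def 1)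
  also have "\<dots> \<le> 4 * (p_norm p lam f + p_norm p lam g)"
    using p_norm_nonneg[OF f] p_norm_nonneg[OF g] by simp
  finally show ?thesis .
next
  case (2 P)
  define I where "I h = (LINT y|lam. \<bar>h y\<bar> powr P)" for h
  have I0: "I h \<ge> 0" for h unfolding I_def by (rule integral_nonneg_AE) simp
  have int: "integrable lam (\<lambda>y. \<bar>h y\<bar> powr P)" if "h \<in> Lp_C0_space p lam" for h
    using that by (simp add: 2 Lp_C0_simps Lp_space_def)
  have "I (\<lambda>y. f y + g y) \<le> (LINT y|lam. 2 powr P * (\<bar>f y\<bar> powr P + \<bar>g y\<bar> powr P))"
    unfolding I_def using 2 int[OF f] int[OF g] int[OF Lp_C0_add[OF f g]]
    by (intro integral_mono abs_add_powr_le) auto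
  also have "\<dots> = 2 powr P * (I f + I g)" using int[OF f] int[OF g] by (simp add: I_def)
  also have "\<dots> \<le> 2 powr P * (2 * max (I f) (I g))" by (intro mult_left_mono) auto
  finally have "I (\<lambda>y. f y + g y) powr (1 / P) \<le> (2 powr P * (2 * max (I f) (I g))) powr (1 / P)"
    using 2 I0 by (intro powr_mono2) auto
  also have "\<dots> = 2 * (2 powr (1 / P) * max (I f) (I g) powr (1 / P))"
    using 2 I0[of f] by (simp add: powr_mult powr_powr max_def)
  \<comment> \<open>The maximum is replaced by the sum, and \<open>2 powr (1 / P)\<close> by 2; with
    the factor 2 from \<open>abs_add_powr_le\<close> this gives the constant 4.\<close>
  also have "\<dots> \<le> 2 * (2 * (I f powr (1 / P) + I g powr (1 / P)))"
  proof -
    have "(2::real) powr (1 / P) \<le> 2 powr 1" using 2 by (intro powr_mono) auto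
    thus ?thesis by (intro mult_left_mono mult_mono) (auto simp: max_def)
  qed
  finally show ?thesis by (simp add: p_norm_def 2 I_def)
qed

lemma p_norm_mult:
  assumes f: "f \<in> Lp_C0_space p lam"
  shows "p_norm p lam (\<lambda>y. c * f y) \<le> \<bar>c\<bar> * p_norm p lam f"
proof (cases rule: p_cases)
  case 1
  obtain B where B: "\<And>y. y \<in> Y_space \<Longrightarrow> \<bar>f y\<bar> \<le> B" using C0_bounded f 1 by (metis Lp_C0_simps(1))
  have "(SUP y\<in>Y_space. \<bar>c * f y\<bar>) \<le> \<bar>c\<bar> * (SUP y\<in>Y_space. \<bar>f y\<bar>)"
  proof (rule cSUP_least[OF Y_nonempty])
    fix y assume y: "y \<in> Y_space"
    have "\<bar>f y\<bar> \<le> (SUP y\<in>Y_space. \<bar>f y\<bar>)" using y B by (auto intro!: cSUP_upper bdd_aboveI2[of _ _ B])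
    thus "\<bar>c * f y\<bar> \<le> \<bar>c\<bar> * (SUP y\<in>Y_space. \<bar>f y\<bar>)" by (simp add: abs_mult mult_left_mono)
  qed
  thus ?thesis by (simp add: p_norm_def 1)
next
  case (2 P)
  have "0 \<le> (LINT y|lam. \<bar>f y\<bar> powr P)" by (rule integral_nonneg_AE) simp
  thus ?thesis using 2 by (simp add: p_norm_def abs_mult powr_mult powr_powr)
qed

lemma Lp_C0_set_integrable:
  assumes "f \<in> Lp_C0_space p lam" "A \<in> sets lam" "emeasure lam A < \<infinity>"
  shows "set_integrable lam A f"
  using assms Lp_set_integrable(1) C0_set_integrable(1) by (cases rule: p_cases) (auto simp: Lp_C0_simps)

lemma integral_continuous:
  assumes A: "A \<in> sets lam" "emeasure lam A < \<infinity>" and \<epsilon>: "\<epsilon> > 0"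
  obtains \<delta> where "\<delta> > 0" "\<And>f. f \<in> Lp_C0_space p lam \<Longrightarrow> p_norm p lam f < \<delta> \<Longrightarrow> \<bar>LINT y:A|lam. f y\<bar> < \<epsilon>"
proof (cases rule: p_cases)
  case 1
  define \<delta> where "\<delta> = \<epsilon> / (measure lam A + 1)"
  have "\<delta> > 0" using \<epsilon> by (simp add: \<delta>_def add_nonneg_pos)
  moreover have "\<bar>LINT y:A|lam. f y\<bar> < \<epsilon>" if f: "f \<in> Lp_C0_space p lam" "p_norm p lam f < \<delta>" for f
  proof -
    have "\<bar>LINT y:A|lam. f y\<bar> \<le> p_norm p lam f * measure lam A"
      using C0_set_integrable(2)[OF _ A] f by (simp add: 1 Lp_C0_simps)
    also have "\<dots> \<le> \<delta> * measure lam A" using f by (intro mult_right_mono) auto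
    also have "\<dots> < \<delta> * (measure lam A + 1)" using \<open>\<delta> > 0\<close> by simp
    also have "\<dots> = \<epsilon>" by (simp add: \<delta>_def add_nonneg_eq_0_iff)
    finally show ?thesis .
  qed
  ultimately show ?thesis using that by blast
next
  case (2 P)
  define M where "M = measure lam A + 1"
  have M: "M > 0" "measure lam A \<le> M" by (simp_all add: M_def add_nonneg_pos)
  define \<delta> where "\<delta> = \<epsilon> / (2 * M)"
  have \<delta>: "\<delta> > 0" using \<epsilon> M by (simp add: \<delta>_def)
  \<comment> \<open>\<delta> bounds the first term of \<open>Lp_set_integrable\<close> by
    \<open>\<epsilon> / 2\<close>. A p-norm below \<eta> means that the integral of the P-th power
    is below \<open>\<epsilon> / 2 * \<delta> powr (P - 1)\<close>, which bounds the second term by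
    \<open>\<epsilon> / 2\<close>.\<close>
  define \<eta> where "\<eta> = (\<epsilon> / 2 * \<delta> powr (P - 1)) powr (1 / P)"
  have "\<eta> > 0" using \<epsilon> \<delta> by (simp add: \<eta>_def)
  moreover have "\<bar>LINT y:A|lam. f y\<bar> < \<epsilon>" if f: "f \<in> Lp_C0_space p lam" "p_norm p lam f < \<eta>" for f
  proof -
    define I where "I = (LINT y|lam. \<bar>f y\<bar> powr P)"
    have I0: "I \<ge> 0" unfolding I_def by (rule integral_nonneg_AE) simp
    have "I powr (1 / P) < \<eta>" using f(2) by (simp add: p_norm_def 2 I_def)
    hence "(I powr (1 / P)) powr P < \<eta> powr P" using 2 by (intro powr_less_mono2) auto
    hence "I < \<epsilon> / 2 * \<delta> powr (P - 1)" using 2 I0 \<epsilon> \<delta> by (simp add: \<eta>_def powr_powr)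
    hence "\<delta> powr (1 - P) * I < \<delta> powr (1 - P) * (\<epsilon> / 2 * \<delta> powr (P - 1))"
      using \<delta> by (intro mult_strict_left_mono) auto
    also have "\<dots> = \<epsilon> / 2 * (\<delta> powr (1 - P) * \<delta> powr (P - 1))" by simp
    also have "\<delta> powr (1 - P) * \<delta> powr (P - 1) = 1" using \<delta> by (simp flip: powr_add)
    finally have "\<delta> powr (1 - P) * I < \<epsilon> / 2" by simp
    moreover have "\<delta> * measure lam A \<le> \<epsilon> / 2"
    proof -
      have "\<delta> * measure lam A \<le> \<delta> * M" using \<delta> M by (intro mult_left_mono) auto
      also have "\<dots> = \<epsilon> / 2" using M by (simp add: \<delta>_def)
      finally show ?thesis .
    qed
    moreover have "\<bar>LINT y:A|lam. f y\<bar> \<le> \<delta> * measure lam A + \<delta> powr (1 - P) * I"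
      unfolding I_def using f 2 by (intro Lp_set_integrable(2)[OF _ _ A \<delta>]) (auto simp: Lp_C0_simps)
    ultimately show ?thesis by linarith
  qed
  ultimately show ?thesis using that by blast
qed

end

section \<open>Closure of the S-unit space\<close>

context Lp_setting
begin

lemma closedin_S: "closedin Y_top S"
  by (rule compactin_imp_closedin[OF Hausdorff_Y_top compact])

text \<open>S is compact in a Hausdorff space, hence closed, so a support lies in S as soon as the
  function vanishes off S.\<close>

lemma closure_support_iff:
  "Abstract_Topology.closure_of Y_top {y \<in> Y_space. f y \<noteq> 0} \<subseteq> S \<longleftrightarrow> (\<forall>y\<in>Y_space - S. f y = 0)"
proof
  assume "Abstract_Topology.closure_of Y_top {y \<in> Y_space. f y \<noteq> 0} \<subseteq> S"
  moreover have "{y \<in> Y_space. f y \<noteq> 0} \<subseteq> Abstract_Topology.closure_of Y_top {y \<in> Y_space. f y \<noteq> 0}"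
    by (rule closure_of_subset) auto
  ultimately show "\<forall>y\<in>Y_space - S. f y = 0" by blast
next
  assume "\<forall>y\<in>Y_space - S. f y = 0"
  thus "Abstract_Topology.closure_of Y_top {y \<in> Y_space. f y \<noteq> 0} \<subseteq> S"
    by (intro closure_of_minimal closedin_S) auto
qed

lemma F_S_iff: "f \<in> F_S S \<longleftrightarrow> (\<exists>\<alpha>. \<alpha> \<noteq> 0 \<and> f = f_log \<alpha> \<and> (\<forall>y\<in>Y_space - S. f_log \<alpha> y = 0))"
  by (auto simp: F_S_def F_logs_def closure_support_iff)

lemma F_S_subset_Lp_C0: "f \<in> F_S S \<Longrightarrow> f \<in> Lp_C0_space p lam"
  using compact_support_Lp_C0[OF continuous_f_log] by (auto simp: F_S_iff)

text \<open>Sums and multiples of elements of \<open>F_S S\<close> are again of this form only on \<open>Y_space\<close>, because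
  \<open>point_norm y\<close> is arbitrary for other \<open>y\<close>.\<close>

lemma F_S_0: obtains h where "h \<in> F_S S" "\<And>y. y \<in> Y_space \<Longrightarrow> h y = 0"
  by (rule that[of "f_log 1"]) (auto simp: F_S_iff intro!: exI[of _ 1])

lemma F_S_add:
  assumes "f \<in> F_S S" "g \<in> F_S S"
  obtains h where "h \<in> F_S S" "\<And>y. y \<in> Y_space \<Longrightarrow> h y = f y + g y"
proof -
  obtain \<alpha> \<beta> where "\<alpha> \<noteq> 0" "\<beta> \<noteq> 0" "f = f_log \<alpha>" "g = f_log \<beta>"
    "\<forall>y\<in>Y_space - S. f_log \<alpha> y = 0" "\<forall>y\<in>Y_space - S. f_log \<beta> y = 0"
    using assms by (auto simp: F_S_iff)
  thus ?thesis
    by (intro that[of "f_log (\<alpha> * \<beta>)"]) (auto simp: F_S_iff f_log_mult intro!: exI[of _ "\<alpha> * \<beta>"])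
qed

lemma ex_root: "n > 0 \<Longrightarrow> \<exists>\<gamma> :: qbar. \<gamma> ^ n = \<alpha>"
  by (metis nth_root_exists)

text \<open>A number \<gamma> with \<open>\<gamma> ^ j = \<alpha> ^ i\<close> exists in the
  algebraic closure, and its function is i / j times that of \<alpha>.\<close>

lemma F_S_rat_mult:
  assumes "f \<in> F_S S"
  obtains h where "h \<in> F_S S" "\<And>y. y \<in> Y_space \<Longrightarrow> h y = real_of_rat q * f y"
proof -
  obtain \<alpha> where \<alpha>: "\<alpha> \<noteq> 0" "f = f_log \<alpha>" "\<forall>y\<in>Y_space - S. f_log \<alpha> y = 0"
    using assms by (auto simp: F_S_iff)
  obtain i j where "quotient_of q = (i, j)" by (metis surj_pair)
  hence q: "q = of_int i / of_int j" "j > 0" using quotient_of_div quotient_of_denom_pos by auto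
  \<comment> \<open>Absorbs the sign of the numerator, so that only natural exponents occur.\<close>
  define \<beta> where "\<beta> = (if i \<ge> 0 then \<alpha> else inverse \<alpha>)"
  have \<beta>: "\<beta> \<noteq> 0" using \<alpha> by (simp add: \<beta>_def)
  obtain \<gamma> where \<gamma>: "\<gamma> ^ nat j = \<beta> ^ nat \<bar>i\<bar>" using ex_root[of "nat j" "\<beta> ^ nat \<bar>i\<bar>"] q(2) by auto
  have \<gamma>0: "\<gamma> \<noteq> 0"
  proof
    assume "\<gamma> = 0"
    with \<gamma> q(2) have "\<beta> ^ nat \<bar>i\<bar> = 0" by (simp add: power_0_left)
    with \<beta> show False by simp
  qed
  have eq: "f_log \<gamma> y = real_of_rat q * f_log \<alpha> y" if y: "y \<in> Y_space" for y
  proof -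
    have "real (nat j) * f_log \<gamma> y = real (nat \<bar>i\<bar>) * f_log \<beta> y"
      using f_log_power[OF y \<gamma>0, of "nat j"] f_log_power[OF y \<beta>, of "nat \<bar>i\<bar>"] \<gamma> by simp
    also have "\<dots> = of_int i * f_log \<alpha> y" using y \<alpha>(1) by (auto simp: \<beta>_def f_log_inverse)
    finally show ?thesis using q(2) by (simp add: q(1) of_rat_divide field_simps)
  qed
  show ?thesis
    by (rule that[of "f_log \<gamma>"]) (use \<gamma>0 eq \<alpha> in \<open>auto simp: F_S_iff intro!: exI[of _ \<gamma>]\<close>)
qed

lemma Lp_1_integrable:
  assumes "f \<in> Lp_space 1 lam"
  shows "integrable lam f"
proof -
  have "f \<in> borel_measurable lam" "integrable lam (\<lambda>y. \<bar>f y\<bar> powr 1)"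
    using assms by (simp_all add: Lp_space_def)
  thus ?thesis using integrable_abs_cancel[of lam f] by simp
qed

lemma F_space_add:
  assumes "f \<in> F_space p lam" "g \<in> F_space p lam"
  shows "(\<lambda>y. f y + g y) \<in> F_space p lam"
proof -
  have "(\<lambda>y. f y + g y) \<in> Lp_C0_space p lam" using assms F_space_subset_Lp_C0 Lp_C0_add by blast
  moreover have "(LINT y|lam. f y + g y) = 0" if "p = 1"
  proof -
    have "f \<in> Lp_space 1 lam" "g \<in> Lp_space 1 lam" using assms that by (auto simp: F_space_def)
    hence "integrable lam f" "integrable lam g" using Lp_1_integrable by blast+
    thus ?thesis using assms that by (simp add: F_space_def)
  qed
  ultimately show ?thesis by (auto simp: F_space_def Lp_C0_space_def one_ereal_def split: if_splits)
qed

lemma F_space_mult: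
  assumes "f \<in> F_space p lam"
  shows "(\<lambda>y. c * f y) \<in> F_space p lam"
proof -
  have "(\<lambda>y. c * f y) \<in> Lp_C0_space p lam" using assms F_space_subset_Lp_C0 Lp_C0_mult by blast
  thus ?thesis using assms by (auto simp: F_space_def Lp_C0_space_def one_ereal_def split: if_splits)
qed

lemma F_S_closureD:
  assumes "g \<in> F_S_closure p lam S" "\<epsilon> > 0"
  obtains f where "f \<in> F_S S" "p_norm p lam (\<lambda>y. g y - f y) < \<epsilon>"
  using assms by (auto simp: F_S_closure_def)

lemma F_S_closure_Lp_C0: "g \<in> F_S_closure p lam S \<Longrightarrow> g \<in> Lp_C0_space p lam"
  using F_space_subset_Lp_C0 by (auto simp: F_S_closure_def)

text \<open>\<open>F_S S\<close> provides only rational multiples. For a real c, an approximant f'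
  of f is multiplied by a rational r close to c, and the error splits into
  \<open>c * (f - f')\<close> and \<open>(c - r) * f'\<close>.\<close>

lemma linear_subspace_F_S_closure: "linear_subspace (F_S_closure p lam S)"
  unfolding linear_subspace_def
proof (intro conjI ballI allI)
  obtain h where h: "h \<in> F_S S" "\<And>y. y \<in> Y_space \<Longrightarrow> h y = 0" using F_S_0 by metis
  have z: "(\<lambda>_. 0) \<in> Lp_C0_space p lam" by (rule compact_support_Lp_C0) auto
  have "p_norm p lam (\<lambda>y. 0 - h y) = p_norm p lam (\<lambda>_. 0)" using h by (intro p_norm_cong) auto
  also have "\<dots> \<le> 0" using p_norm_mult[OF z, of 0] by simp
  finally have "p_norm p lam (\<lambda>y. 0 - h y) \<le> 0" .
  moreover have "(\<lambda>_. 0) \<in> F_space p lam"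
    using z by (auto simp: F_space_def Lp_C0_space_def one_ereal_def split: if_splits)
  ultimately show "(\<lambda>_. 0) \<in> F_S_closure p lam S"
    using h(1) by (force simp: F_S_closure_def)
next
  fix f g assume fg: "f \<in> F_S_closure p lam S" "g \<in> F_S_closure p lam S"
  show "(\<lambda>y. f y + g y) \<in> F_S_closure p lam S"
    unfolding F_S_closure_def
  proof (safe intro!: F_space_add)
    show "f \<in> F_space p lam" "g \<in> F_space p lam" using fg by (auto simp: F_S_closure_def)
    fix \<epsilon> :: real assume \<epsilon>: "\<epsilon> > 0"
    \<comment> \<open>\<open>\<epsilon> / 8\<close> because \<open>p_norm_add\<close> costs the
      factor 4 on the sum of two errors.\<close>
    obtain f' where f': "f' \<in> F_S S" "p_norm p lam (\<lambda>y. f y - f' y) < \<epsilon> / 8"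
      using F_S_closureD[OF fg(1), of "\<epsilon> / 8"] \<epsilon> by auto
    obtain g' where g': "g' \<in> F_S S" "p_norm p lam (\<lambda>y. g y - g' y) < \<epsilon> / 8"
      using F_S_closureD[OF fg(2), of "\<epsilon> / 8"] \<epsilon> by auto
    obtain h where h: "h \<in> F_S S" "\<And>y. y \<in> Y_space \<Longrightarrow> h y = f' y + g' y" using F_S_add[OF f'(1) g'(1)] by blast
    have "p_norm p lam (\<lambda>y. f y + g y - h y) = p_norm p lam (\<lambda>y. (f y - f' y) + (g y - g' y))"
      using h(2) by (intro p_norm_cong) simp
    also have "\<dots> \<le> 4 * (p_norm p lam (\<lambda>y. f y - f' y) + p_norm p lam (\<lambda>y. g y - g' y))"
      by (intro p_norm_add Lp_C0_diff F_S_closure_Lp_C0 F_S_subset_Lp_C0 fg f' g')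
    also have "\<dots> < \<epsilon>" using f'(2) g'(2) by simp
    finally show "\<exists>h\<in>F_S S. p_norm p lam (\<lambda>y. f y + g y - h y) < \<epsilon>" using h(1) by blast
  qed
next
  fix c :: real and f assume f: "f \<in> F_S_closure p lam S"
  show "(\<lambda>y. c * f y) \<in> F_S_closure p lam S"
    unfolding F_S_closure_def
  proof (safe intro!: F_space_mult)
    show "f \<in> F_space p lam" using f by (auto simp: F_S_closure_def)
    fix \<epsilon> :: real assume \<epsilon>: "\<epsilon> > 0"
    define M where "M = \<bar>c\<bar> + 1"
    have M: "M > 0" "\<bar>c\<bar> \<le> M" by (simp_all add: M_def add_nonneg_pos)
    \<comment> \<open>With this \<delta> and the choice of r below, the total is at most
      \<open>4 * (\<epsilon> / 16 + \<epsilon> / 8)\<close>, which is below \<epsilon>.\<close>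
    define \<delta> where "\<delta> = \<epsilon> / (16 * M)"
    have \<delta>: "\<delta> > 0" using \<epsilon> M by (simp add: \<delta>_def)
    obtain f' where f': "f' \<in> F_S S" "p_norm p lam (\<lambda>y. f y - f' y) < \<delta>"
      using F_S_closureD[OF f \<delta>] by blast
    note V' = F_S_subset_Lp_C0[OF f'(1)]
    note V = Lp_C0_diff[OF F_S_closure_Lp_C0[OF f] V']
    define B where "B = p_norm p lam f' + 1"
    have B: "B > 0" "p_norm p lam f' \<le> B" using p_norm_nonneg[OF V'] by (simp_all add: B_def)
    obtain r where r: "r \<in> \<rat>" "c - \<epsilon> / (8 * B) < r" "r < c" using Rats_dense_in_real[of "c - \<epsilon> / (8 * B)" c] \<epsilon> B by auto
    then obtain q where q: "r = real_of_rat q" by (elim Rats_cases)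
    obtain h where h: "h \<in> F_S S" "\<And>y. y \<in> Y_space \<Longrightarrow> h y = r * f' y"
      using F_S_rat_mult[OF f'(1), of q] q by auto
    have "p_norm p lam (\<lambda>y. c * f y - h y) = p_norm p lam (\<lambda>y. c * (f y - f' y) + (c - r) * f' y)"
      using h(2) by (intro p_norm_cong) (simp add: algebra_simps)
    also have "\<dots> \<le> 4 * (p_norm p lam (\<lambda>y. c * (f y - f' y)) + p_norm p lam (\<lambda>y. (c - r) * f' y))"
      by (intro p_norm_add Lp_C0_mult V V')
    also have "\<dots> \<le> 4 * (\<bar>c\<bar> * p_norm p lam (\<lambda>y. f y - f' y) + \<bar>c - r\<bar> * p_norm p lam f')"
      by (intro mult_left_mono add_mono p_norm_mult V V') auto
    also have "\<dots> < \<epsilon>"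
    proof -
      have "\<bar>c\<bar> * p_norm p lam (\<lambda>y. f y - f' y) \<le> M * \<delta>"
        using M f'(2) p_norm_nonneg[OF V] by (intro mult_mono) auto
      also have "\<dots> = \<epsilon> / 16" using M by (simp add: \<delta>_def)
      finally have 1: "\<bar>c\<bar> * p_norm p lam (\<lambda>y. f y - f' y) \<le> \<epsilon> / 16" .
      have "\<bar>c - r\<bar> * p_norm p lam f' \<le> \<epsilon> / (8 * B) * B"
        using r B p_norm_nonneg[OF V'] \<epsilon> by (intro mult_mono) auto
      also have "\<dots> = \<epsilon> / 8" using B by simp
      finally show ?thesis using 1 \<epsilon> by simp
    qed
    finally show "\<exists>h\<in>F_S S. p_norm p lam (\<lambda>y. c * f y - h y) < \<epsilon>" using h(1) by blast
  qed
qed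

text \<open>Integration over A is continuous. If the integral of g were nonzero, some approximant
  from \<open>F_S S\<close> would have an integral closer to it than 0 is.\<close>

lemma integral_closure_eq_0:
  assumes A: "A \<in> sets lam" "emeasure lam A < \<infinity>" and zero: "\<And>f. f \<in> F_S S \<Longrightarrow> (LINT y:A|lam. f y) = 0"
    and g: "g \<in> F_S_closure p lam S"
  shows "(LINT y:A|lam. g y) = 0"
proof (rule ccontr)
  assume "\<not> ?thesis"
  hence pos: "\<bar>LINT y:A|lam. g y\<bar> > 0" by simp
  obtain \<delta> where \<delta>: "\<delta> > 0"
    "\<And>f. f \<in> Lp_C0_space p lam \<Longrightarrow> p_norm p lam f < \<delta> \<Longrightarrow> \<bar>LINT y:A|lam. f y\<bar> < \<bar>LINT y:A|lam. g y\<bar>"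
    using integral_continuous[OF A pos] by metis
  obtain f where f: "f \<in> F_S S" "p_norm p lam (\<lambda>y. g y - f y) < \<delta>" using F_S_closureD[OF g \<delta>(1)] by blast
  note V = F_S_closure_Lp_C0[OF g] F_S_subset_Lp_C0[OF f(1)]
  have "(LINT y:A|lam. g y - f y) = (LINT y:A|lam. g y) - (LINT y:A|lam. f y)"
    by (rule set_integral_diff(2)) (intro Lp_C0_set_integrable V A)+
  thus False using \<delta>(2)[OF Lp_C0_diff[OF V] f(2)] zero[OF f(1)] by simp
qed

text \<open>Elements of \<open>F_S S\<close> vanish off S, so off S the error \<open>g - f\<close>
  is g itself. A g that does not vanish there has a positive distance from
  \<open>F_S S\<close>.\<close>

lemma supp_in_closure:
  assumes g: "g \<in> F_S_closure p lam S"
  shows "supp_in p lam g S"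
proof (cases rule: p_cases)
  case 1
  have "g y = 0" if y: "y \<in> Y_space - S" for y
  proof (rule ccontr)
    assume "g y \<noteq> 0"
    then obtain f where f: "f \<in> F_S S" "p_norm p lam (\<lambda>y. g y - f y) < \<bar>g y\<bar>"
      using F_S_closureD[OF g, of "\<bar>g y\<bar>"] by auto
    have fy: "f y = 0" using f(1) y by (auto simp: F_S_iff)
    have "(\<lambda>y. g y - f y) \<in> C0_space"
      using Lp_C0_diff[OF F_S_closure_Lp_C0[OF g] F_S_subset_Lp_C0[OF f(1)]] by (simp add: 1 Lp_C0_simps)
    then obtain B where "\<And>y. y \<in> Y_space \<Longrightarrow> \<bar>g y - f y\<bar> \<le> B" using C0_bounded by blast
    hence "\<bar>g y - f y\<bar> \<le> p_norm p lam (\<lambda>y. g y - f y)"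
      unfolding p_norm_def 1 using y by (auto intro!: cSUP_upper bdd_aboveI2[of _ _ B])
    with f(2) fy show False by simp
  qed
  thus ?thesis by (simp add: supp_in_def 1 closure_support_iff)
next
  case (2 P)
  have [measurable]: "g \<in> borel_measurable lam" "S \<in> sets lam"
    using F_S_closure_Lp_C0[OF g] compact_sets[OF compact] by (auto simp: 2 Lp_C0_simps Lp_space_def)
  \<comment> \<open>The part of \<open>\<bar>g\<bar> powr P\<close> off S; its integral bounds the
    P-th power of the distance from below.\<close>
  define h where "h y = indicator (Y_space - S) y * \<bar>g y\<bar> powr P" for y
  have gint: "integrable lam (\<lambda>y. \<bar>g y\<bar> powr P)"
    using F_S_closure_Lp_C0[OF g] by (simp add: 2 Lp_C0_simps Lp_space_def)
  have Sm: "Y_space - S \<in> sets lam" using sets.compl_sets[of S lam] by simp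
  have hint: "integrable lam h"
    unfolding h_def using integrable_mult_indicator[OF Sm gint] by simp
  have h0: "h y \<ge> 0" for y by (simp add: h_def)
  have "(LINT y|lam. h y) \<le> 0"
  proof (rule ccontr)
    assume "\<not> ?thesis"
    hence pos: "(LINT y|lam. h y) > 0" by simp
    then obtain f where f: "f \<in> F_S S" "p_norm p lam (\<lambda>y. g y - f y) < (LINT y|lam. h y) powr (1 / P)"
      using F_S_closureD[OF g, of "(LINT y|lam. h y) powr (1 / P)"] by auto
    have int: "integrable lam (\<lambda>y. \<bar>g y - f y\<bar> powr P)"
      using Lp_C0_diff[OF F_S_closure_Lp_C0[OF g] F_S_subset_Lp_C0[OF f(1)]] by (simp add: 2 Lp_C0_simps Lp_space_def)
    have "(LINT y|lam. h y) \<le> (LINT y|lam. \<bar>g y - f y\<bar> powr P)"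
    proof (intro integral_mono hint int)
      fix y assume "y \<in> space lam"
      thus "h y \<le> \<bar>g y - f y\<bar> powr P" using f(1) by (auto simp: h_def indicator_def F_S_iff)
    qed
    hence "(LINT y|lam. h y) powr (1 / P) \<le> p_norm p lam (\<lambda>y. g y - f y)"
      unfolding p_norm_def using pos 2 by (auto intro!: powr_mono2)
    with f(2) show False by simp
  qed
  moreover have "(LINT y|lam. h y) \<ge> 0" using h0 by (intro integral_nonneg_AE) auto
  ultimately have "(LINT y|lam. h y) = 0" by simp
  hence "AE y in lam. h y = 0" using integral_nonneg_eq_0_iff_AE[OF hint] h0 by simp
  hence "AE y in lam. y \<notin> S \<longrightarrow> g y = 0"
  proof (rule AE_mp)
    show "AE y in lam. h y = 0 \<longrightarrow> y \<notin> S \<longrightarrow> g y = 0"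
      by (rule AE_I2) (auto simp: h_def indicator_def)
  qed
  thus ?thesis by (simp add: supp_in_def 2)
qed

end

theorem theorem1p5:
  fixes p :: ereal and S :: "qbar_place set" and K :: "qbar set"
    and lam :: "qbar_place measure"
  assumes "1 \<le> p"
    and "is_lambda lam"
    and "compactin Y_top S" and "openin Y_top S"
    and "S \<inter> Y_over \<rat> rat_place_inf = {}"
    and "number_field K" and "defined_over K S"
    and "\<exists>u. real_place K u"
    and "\<exists>v\<in>places K. \<exists>w\<in>places K. v \<noteq> w \<and> Y_over K v \<union> Y_over K w \<subseteq> S"
  shows "linear_subspace (F_S_closure p lam S) \<and> F_S_closure p lam S \<subset> F_space_S0 p lam S"
proof -
  interpret lambda_measure lam by unfold_locales fact
  note K = \<open>number_field K\<close>
  obtain u where u: "real_place K u" using assms(8) by blast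
  obtain v w where vw: "v \<in> places K" "w \<in> places K" "v \<noteq> w" "Y_over K v \<subseteq> S" "Y_over K w \<subseteq> S"
    using assms(9) by blast
  have Y_nonempty: "Y_space \<noteq> {}" using Y_over_nonempty[OF K vw(1)] by (auto simp: Y_over_iff)
  interpret Lp_setting lam p S
    by (intro Lp_setting.intro lambda_measure_axioms Lp_setting_axioms.intro Y_nonempty assms)
  have compact_over: "compactin Y_top (Y_over K x)" if "x \<in> places K" "Y_over K x \<subseteq> S" for x
    using closed_compactin[OF compact that(2) closedin_Y_over[OF K that(1)]] .
  have zero: "(LINT y:Y_over K x|lam. f y) = 0" if f: "f \<in> F_S S" and x: "x \<in> places K" "Y_over K x \<subseteq> S" for f x
  proof -
    obtain \<alpha> where \<alpha>: "\<alpha> \<noteq> 0" "f = f_log \<alpha>" "\<forall>y\<in>Y_space - S. f_log \<alpha> y = 0"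
      using f by (auto simp: F_S_iff)
    \<comment> \<open>Archimedean points lie outside S, where the function vanishes.\<close>
    have "f_log \<alpha> y = 0" if "y \<in> Y_over \<rat> rat_place_inf" for y
      using that assms(5) \<alpha>(3) by (auto simp: Y_over_iff)
    from integral_Y_over_eq_0[OF K u \<alpha>(1) this x(1) compact_over[OF x]] show ?thesis by (simp add: \<alpha>)
  qed
  have closure_zero: "(LINT y:Y_over K x|lam. g y) = 0"
    if "g \<in> F_S_closure p lam S" "x \<in> places K" "Y_over K x \<subseteq> S" for g x
    using integral_closure_eq_0[OF Y_over_sets[OF K that(2)] emeasure_Y_over_finite[OF K that(2)] zero[OF _ that(2,3)] that(1)] .
  obtain T where T: "T \<subseteq> places K" "S = (\<Union>x\<in>T. Y_over K x)"
    using assms(7) by (auto simp: defined_over_def)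
  have finT: "finite T"
  proof (rule finite_subset[OF _ finite_places_meeting_compact[OF compact K]])
    show "T \<subseteq> {x \<in> places K. Y_over K x \<inter> S \<noteq> {}}" using T Y_over_nonempty[OF K] by fastforce
  qed
  have S_fin: "S \<in> sets lam" "emeasure lam S < \<infinity>"
    using compact_sets[OF compact] emeasure_compact_finite[OF compact] by auto
  have closure_int: "(LINT y:S|lam. g y) = 0" if g: "g \<in> F_S_closure p lam S" for g
  proof -
    \<comment> \<open>Fibres over different places of K are disjoint, so at a point of S exactly one
      of the indicators is 1.\<close>
    have ind: "indicator S y *\<^sub>R g y = (\<Sum>x\<in>T. indicator (Y_over K x) y *\<^sub>R g y)" for y
    proof (cases "y \<in> S")
      case True
      then obtain x where x: "x \<in> T" "y \<in> Y_over K x" using T by auto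
      have "(\<Sum>x\<in>T. indicator (Y_over K x) y *\<^sub>R g y) = (\<Sum>x\<in>{x}. indicator (Y_over K x) y *\<^sub>R g y)"
        using finT x by (intro sum.mono_neutral_right) (auto simp: Y_over_iff indicator_def)
      thus ?thesis using True x by simp
    next
      case False
      hence "y \<notin> Y_over K x" if "x \<in> T" for x using T that by auto
      thus ?thesis using False by simp
    qed
    have "(LINT y:S|lam. g y) = (\<Sum>x\<in>T. LINT y:Y_over K x|lam. g y)"
      unfolding set_lebesgue_integral_def ind
    proof (rule Bochner_Integration.integral_sum)
      fix x assume "x \<in> T"
      hence x: "x \<in> places K" using T by auto
      from Lp_C0_set_integrable[OF F_S_closure_Lp_C0[OF g] Y_over_sets[OF K x] emeasure_Y_over_finite[OF K x]]
      show "integrable lam (\<lambda>y. indicator (Y_over K x) y *\<^sub>R g y)" by (simp add: set_integrable_def)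
    qed
    also have "\<dots> = 0" using T by (intro sum.neutral) (auto intro!: closure_zero[OF g])
    finally show ?thesis .
  qed
  have subset: "F_S_closure p lam S \<subseteq> F_space_S0 p lam S"
    using closure_int supp_in_closure by (auto simp: F_space_S0_def F_S_closure_def)
  define g where "g y = indicator (Y_over K v) y / measure lam (Y_over K v) -
    indicator (Y_over K w) y / measure lam (Y_over K w)" for y
  have ind_int: "integrable lam (indicator (Y_over K x) :: _ \<Rightarrow> real)" if "x \<in> places K" for x
    using Y_over_sets[OF K that] emeasure_Y_over_finite[OF K that] by (simp add: integrable_indicator_iff)
  have lamv: "measure lam (Y_over K v) > 0" "measure lam (Y_over K w) > 0"
    using measure_Y_over_pos[OF K] vw by auto
  \<comment> \<open>Both normalised indicators have integral 1. The mean-zero property is part of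
    \<open>F_space\<close> for \<open>p = 1\<close>, and it gives the integral over S for every
    p.\<close>
  have g_int: "(LINT y|lam. g y) = 0"
    unfolding g_def using ind_int vw lamv by simp
  have g_supp: "g y = 0" if "y \<notin> S" for y
    using that vw by (auto simp: g_def indicator_def)
  \<comment> \<open>g depends only on the place \<open>y K\<close>, so it factors through a discrete
    space; with its compact support this puts it in the ambient space for every p.\<close>
  have "continuous_map Y_top euclideanreal g"
  proof (rule continuous_map_eq)
    show "continuous_map Y_top euclideanreal
      ((\<lambda>x. (if x = v then 1 else 0) / measure lam (Y_over K v) - (if x = w then 1 else 0) / measure lam (Y_over K w)) \<circ> (\<lambda>y. y K))"
      by (rule continuous_map_compose[OF continuous_map_component[OF K]]) simp
  qed (auto simp: g_def indicator_def Y_over_iff)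
  hence gV: "g \<in> Lp_C0_space p lam" using compact_support_Lp_C0 g_supp by blast
  hence "g \<in> F_space p lam" using g_int by (auto simp: F_space_def Lp_C0_space_def one_ereal_def split: if_splits)
  moreover have "supp_in p lam g S" using g_supp by (simp add: supp_in_def closure_support_iff)
  moreover have "(LINT y:S|lam. g y) = (LINT y|lam. g y)"
    unfolding set_lebesgue_integral_def using g_supp
    by (intro Bochner_Integration.integral_cong) (auto simp: indicator_def)
  ultimately have "g \<in> F_space_S0 p lam S" using g_int by (simp add: F_space_S0_def)
  moreover have "g \<notin> F_S_closure p lam S"
  proof
    assume "g \<in> F_S_closure p lam S"
    from closure_zero[OF this vw(1,4)] have "(LINT y:Y_over K v|lam. g y) = 0" .
    moreover have "(LINT y:Y_over K v|lam. g y) = (LINT y|lam. indicator (Y_over K v) y / measure lam (Y_over K v))"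
      unfolding set_lebesgue_integral_def using vw(3)
      by (intro Bochner_Integration.integral_cong) (auto simp: g_def indicator_def Y_over_iff)
    moreover have "\<dots> = 1" using lamv by simp
    ultimately show False by simp
  qed
  ultimately show ?thesis using linear_subspace_F_S_closure subset by blast
qed

end
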